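(* Let $\mathbb{K}=\mathbb{R}$ or $\mathbb{K}=\mathbb{C}$. The local 3-reflective real (respectively complex) analytic planar projective billiards are exactly the real (respectively complex) right-spherical billiards. That is, let $(\alpha,\beta,\gamma)$ be a $\mathbb{K}$-analytic local projective billiard in $\mathbb{K}^2$ (three germs of $\mathbb{K}$-analytic line-framed planar curves) whose base points form a 3-periodic orbit. Then $(\alpha,\beta,\gamma)$ is 3-reflective if and only if there exist three non-collinear points $P,Q,R\in\mathbb{KP}^2$ such that $\alpha,\beta,\gamma$ are germs, at their respective base points, of $\omega(PQ,R)$, $\omega(QR,P)$, $\omega(RP,Q)$.
   Context: $\mathbb{P}(T\mathbb{K}^2)$ is the set of pairs $(A,L)$ with $A\in\mathbb{K}^2$ and $L$ a ($\mathbb{K}$-)line through $A$ (identified with a 1-dimensional subspace of $T_A\mathbb{K}^2$); $\pi(A,L)=A$. A $\mathbb{K}$-analytic line-framed planar curve is a regularly embedded connected $\mathbb{K}$-analytic curve $\alpha\subset\mathbb{P}(T\mathbb{K}^2)$ (holomorphic if $\mathbb{K}=\mathbb{C}$) such that $\pi$ sends $\alpha$ diffeomorphically (biholomorphically) onto a regularly embedded curve $a\subset\mathbb{K}^2$ (its classical boundary), and for every $(A,L)\in\alpha$ the line $L$ is transversal to $T_Aa$. A $\mathbb{K}$-analytic local projective billiard is a collection of germs of such curves $\alpha_1,\dots,\alpha_k$, with classical boundaries $a_1,\dots,a_k$. Symmetry of lines: for distinct lines $L,T$ through a point $A$, two lines $\ell,\ell'$ through $A$ are symmetric with respect to $(L,T)$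 if $\ell=\ell'=L$, or $\ell=\ell'=T$, or $L,T,\ell,\ell'$ are distinct and form a harmonic quadruple, i.e. their cross-ratio $(L,T;\ell,\ell')$ equals $-1$ (the cross-ratio of four concurrent lines is that of their intersection points with a line not through the common point; $(X_1,X_2;X_3,X_4)=h(X_1)$ where $h$ is the projective transformation with $h(X_2)=1,h(X_3)=0,h(X_4)=\infty$). A $k$-periodic orbit of a local projective billiard is a $k$-tuple $(A_1,L_1),\dots,(A_k,L_k)$, $(A_j,L_j)\in\alpha_j$, such that for every $j=1,\dots,k$ (indices cyclic) $A_j\ne A_{j\pm1}$, and the lines $A_{j-1}A_j$, $A_jA_{j+1}$ are not tangent to $a_j$ at $A_j$ and are symmetric with respect to $(L_j,T_{A_j}a_j)$. The billiard is $k$-reflective if its base points form a $k$-periodic orbit and every pair in $\alpha_1\times\alpha_2$ close to the pair of base points extends to a $k$-periodic orbit close to the base orbit. Right-spherical billiard: for a line $\ell\subset\mathbb{KP}^2$ and a point $P\notin\ell$, $\omega(\ell,P)=\{(A,AP): A\in\ell\}$, where $AP$ is the line through $A$ and $P$. For non-collinear points $P,Q,R$, the right-spherical billiard is $(\omega(PQ,R),\omega(QR,P),\omega(RP,Q))$; $\mathbb{K}^2$ is regarded as an affine chart of $\mathbb{KP}^2$. *)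

theory Defs
  imports "HOL-Complex_Analysis.Complex_Analysis"
begin

text \<open>
  The ground field is a type of sort \<open>{real_normed_field, banach}\<close>; the theorem instantiates it
  with \<open>real\<close> and \<open>complex\<close>.  Linear algebra over it is the library's \<open>vec.\<dots>\<close> for
  \<open>'k ^ 'n\<close>, which is \<open>'k\<close>-linear (and not merely real-linear).
\<close>

subsection \<open>Analytic arcs and regularly embedded curves in coordinate space\<close>

definition analytic_arc_at ::
    "('k::{real_normed_field,banach} \<Rightarrow> 'k ^ 'n) \<Rightarrow> 'k \<Rightarrow> bool" where
  "analytic_arc_at \<phi> t \<longleftrightarrow> (\<forall>i. \<exists>F. (\<lambda>h. \<phi> (t + h) $ i) has_fps_expansion F)"

lemma analytic_arc_at_complex:
  "analytic_arc_at \<phi> t \<longleftrightarrow> (\<forall>i. (\<lambda>s::complex. \<phi> s $ i) analytic_on {t})"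
proof -
  have *: "(\<exists>F. (\<lambda>h. f (t + h)) has_fps_expansion F) \<longleftrightarrow> f analytic_on {t}"
    for f :: "complex \<Rightarrow> complex"
    using analytic_at_imp_has_fps_expansion has_fps_expansion_imp_analytic by blast
  show ?thesis
    unfolding analytic_arc_at_def using *[of "\<lambda>s. \<phi> s $ i" for i] by simp
qed

definition velocity :: "('k::real_normed_field \<Rightarrow> 'k ^ 'n) \<Rightarrow> 'k \<Rightarrow> 'k ^ 'n" where
  "velocity \<phi> t = (\<chi> i. deriv (\<lambda>s. \<phi> s $ i) t)"

definition regular_curve :: "('k::{real_normed_field,banach} ^ 'n) set \<Rightarrow> bool" where
  "regular_curve C \<longleftrightarrow>
    (\<forall>p\<in>C. \<exists>U \<phi> \<psi> r. open U \<and> p \<in> U \<and> r > 0 \<and> \<phi> 0 = p \<and>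
       (\<forall>t\<in>ball 0 r. analytic_arc_at \<phi> t \<and> velocity \<phi> t \<noteq> 0) \<and>
       homeomorphism (ball 0 r) (C \<inter> U) \<phi> \<psi>)"


subsection \<open>Lines of the affine plane and tangent lines\<close>

definition line_dir :: "'k::field ^ 2 \<Rightarrow> 'k ^ 2 \<Rightarrow> ('k ^ 2) set" where
  "line_dir A v = range (\<lambda>t. A + t *s v)"

definition is_line :: "('k::field ^ 2) set \<Rightarrow> bool" where
  "is_line L \<longleftrightarrow> (\<exists>A v. v \<noteq> 0 \<and> L = line_dir A v)"

definition join :: "'k::field ^ 2 \<Rightarrow> 'k ^ 2 \<Rightarrow> ('k ^ 2) set" where
  "join A B = line_dir A (B - A)"

text \<open>The tangent line, as an affine line: \<open>A\<close> plus all velocities at \<open>A\<close> of analytic arcs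
  running in \<open>a\<close>.\<close>

definition tangent_line ::
    "('k::{real_normed_field,banach} ^ 2) set \<Rightarrow> 'k ^ 2 \<Rightarrow> ('k ^ 2) set" where
  "tangent_line a A =
    {A + velocity \<phi> 0 | \<phi>. analytic_arc_at \<phi> 0 \<and> \<phi> 0 = A \<and> (\<forall>\<^sub>F t in nhds 0. \<phi> t \<in> a)}"


subsection \<open>The projectivized tangent bundle\<close>

type_synonym 'k framed_point = "('k ^ 2) \<times> ('k ^ 2) set"

definition PT :: "'k::field framed_point set" where
  "PT = {(A, L). is_line L \<and> A \<in> L}"

text \<open>Inverses of the two standard affine charts of \<open>PT\<close>: the coordinates are those of the base
  point, followed by the slope of a non-vertical line, respectively the inverse slope of a
  non-horizontal one.\<close>

definition PT_param1 :: "'k::field ^ 3 \<Rightarrow> 'k framed_point" where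
  "PT_param1 w =
    (vector [w $ 1, w $ 2], line_dir (vector [w $ 1, w $ 2]) (vector [1, w $ 3]))"

definition PT_param2 :: "'k::field ^ 3 \<Rightarrow> 'k framed_point" where
  "PT_param2 w =
    (vector [w $ 1, w $ 2], line_dir (vector [w $ 1, w $ 2]) (vector [w $ 3, 1]))"

definition PT_topology :: "'k::real_normed_field framed_point topology" where
  "PT_topology = topology (\<lambda>U. U \<subseteq> PT \<and> open (PT_param1 -` U) \<and> open (PT_param2 -` U))"

lemma openin_PT_topology:
  "openin PT_topology U \<longleftrightarrow> U \<subseteq> PT \<and> open (PT_param1 -` U) \<and> open (PT_param2 -` U)"
proof -
  have "istopology (\<lambda>U :: 'a framed_point set.
          U \<subseteq> PT \<and> open (PT_param1 -` U) \<and> open (PT_param2 -` U))"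
    unfolding istopology_def by (auto simp: vimage_Union intro!: open_UN)
  then show ?thesis
    by (simp add: PT_topology_def topology_inverse')
qed

definition PT_analytic_arc_at ::
    "('k::{real_normed_field,banach} \<Rightarrow> 'k framed_point) \<Rightarrow> 'k \<Rightarrow> bool" where
  "PT_analytic_arc_at \<Phi> t \<longleftrightarrow>
    (\<exists>w. analytic_arc_at w t \<and>
      ((\<forall>\<^sub>F s in nhds t. \<Phi> s = PT_param1 (w s)) \<or> (\<forall>\<^sub>F s in nhds t. \<Phi> s = PT_param2 (w s))))"

definition PT_regular_curve :: "'k::{real_normed_field,banach} framed_point set \<Rightarrow> bool" where
  "PT_regular_curve \<alpha> \<longleftrightarrow>
    \<alpha> \<subseteq> PT \<and> regular_curve (PT_param1 -` \<alpha>) \<and> regular_curve (PT_param2 -` \<alpha>)"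


subsection \<open>Line-framed curves and local projective billiards\<close>

text \<open>The projection is \<open>fst\<close>.  A map between regular curves is analytic iff it takes analytic
  arcs to analytic arcs, since the local parametrizations are themselves such arcs.\<close>

definition projection_diffeo :: "'k::{real_normed_field,banach} framed_point set \<Rightarrow> bool" where
  "projection_diffeo \<alpha> \<longleftrightarrow>
    bij_betw fst \<alpha> (fst ` \<alpha>) \<and>
    (\<forall>\<Phi>. PT_analytic_arc_at \<Phi> 0 \<and> (\<forall>\<^sub>F t in nhds 0. \<Phi> t \<in> \<alpha>)
        \<longrightarrow> analytic_arc_at (fst \<circ> \<Phi>) 0) \<and>
    (\<forall>\<phi>. analytic_arc_at \<phi> 0 \<and> (\<forall>\<^sub>F t in nhds 0. \<phi> t \<in> fst ` \<alpha>)
        \<longrightarrow> PT_analytic_arc_at (inv_into \<alpha> fst \<circ> \<phi>) 0)"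

definition line_framed_curve :: "'k::{real_normed_field,banach} framed_point set \<Rightarrow> bool" where
  "line_framed_curve \<alpha> \<longleftrightarrow>
    PT_regular_curve \<alpha> \<and> connectedin PT_topology \<alpha> \<and>
    regular_curve (fst ` \<alpha>) \<and> projection_diffeo \<alpha> \<and>
    (\<forall>(A, L)\<in>\<alpha>. L \<noteq> tangent_line (fst ` \<alpha>) A)"

text \<open>A germ is given by a representing curve together with its base point.\<close>

definition same_germ ::
    "'k::real_normed_field framed_point \<Rightarrow> 'k framed_point set \<Rightarrow> 'k framed_point set \<Rightarrow> bool" where
  "same_germ p \<alpha> \<beta> \<longleftrightarrow> (\<exists>U. openin PT_topology U \<and> p \<in> U \<and> \<alpha> \<inter> U = \<beta> \<inter> U)"

definition local_projective_billiard ::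
    "'k::{real_normed_field,banach} framed_point set list \<Rightarrow> 'k framed_point list \<Rightarrow> bool" where
  "local_projective_billiard \<alpha>s ps \<longleftrightarrow>
    length ps = length \<alpha>s \<and>
    (\<forall>j<length \<alpha>s. line_framed_curve (\<alpha>s ! j) \<and> ps ! j \<in> \<alpha>s ! j)"


subsection \<open>The projective plane, cross-ratio and symmetric lines\<close>

text \<open>Points and lines of the projective plane are the linear subspaces of \<open>'k ^ 3\<close> of dimension
  1 and 2; the affine plane is the chart where the third coordinate is 1.\<close>

definition proj_point :: "('k::field ^ 3) set \<Rightarrow> bool" where
  "proj_point P \<longleftrightarrow> vec.subspace P \<and> vec.dim P = 1"

definition proj_line :: "('k::field ^ 3) set \<Rightarrow> bool" where
  "proj_line l \<longleftrightarrow> vec.subspace l \<and> vec.dim l = 2"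

definition proj_join :: "('k::field ^ 3) set \<Rightarrow> ('k ^ 3) set \<Rightarrow> ('k ^ 3) set" where
  "proj_join P Q = vec.span (P \<union> Q)"

definition chart_vec :: "'k::field ^ 2 \<Rightarrow> 'k ^ 3" where
  "chart_vec A = vector [A $ 1, A $ 2, 1]"

definition chart_point :: "'k::field ^ 2 \<Rightarrow> ('k ^ 3) set" where
  "chart_point A = vec.span {chart_vec A}"

definition chart_line :: "('k::field ^ 2) set \<Rightarrow> ('k ^ 3) set" where
  "chart_line L = vec.span (chart_vec ` L)"

text \<open>For points of the projective line \<open>m\<close>: some projective isomorphism from \<open>m\<close> to the standard
  projective line sends \<open>X1\<close>, \<open>X2\<close>, \<open>X3\<close>, \<open>X4\<close> to \<open>c\<close>, \<open>1\<close>, \<open>0\<close>, \<open>\<infinity>\<close>, where \<open>[x : y]\<close> stands for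
  \<open>x / y\<close>.\<close>

definition points_cross_ratio ::
    "('k::field ^ 3) set \<Rightarrow> ('k ^ 3) set \<Rightarrow> ('k ^ 3) set \<Rightarrow> ('k ^ 3) set \<Rightarrow> ('k ^ 3) set
      \<Rightarrow> 'k \<Rightarrow> bool" where
  "points_cross_ratio m X1 X2 X3 X4 c \<longleftrightarrow>
    (\<exists>h :: 'k ^ 3 \<Rightarrow> 'k ^ 2. Vector_Spaces.linear (*s) (*s) h \<and> inj_on h m \<and>
       h ` X1 = vec.span {vector [c, 1]} \<and> h ` X2 = vec.span {vector [1, 1]} \<and>
       h ` X3 = vec.span {vector [0, 1]} \<and> h ` X4 = vec.span {vector [1, 0]})"

text \<open>For affine lines through \<open>A\<close>, cut by a projective line not through \<open>A\<close>; the value does not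
  depend on the choice of the latter.\<close>

definition lines_cross_ratio ::
    "'k::field ^ 2 \<Rightarrow> ('k ^ 2) set \<Rightarrow> ('k ^ 2) set \<Rightarrow> ('k ^ 2) set \<Rightarrow> ('k ^ 2) set
      \<Rightarrow> 'k \<Rightarrow> bool" where
  "lines_cross_ratio A L1 L2 L3 L4 c \<longleftrightarrow>
    (\<exists>m. proj_line m \<and> \<not> chart_point A \<subseteq> m \<and>
       points_cross_ratio m
         (chart_line L1 \<inter> m) (chart_line L2 \<inter> m) (chart_line L3 \<inter> m) (chart_line L4 \<inter> m) c)"

definition symmetric_lines ::
    "'k::field ^ 2 \<Rightarrow> ('k ^ 2) set \<Rightarrow> ('k ^ 2) set \<Rightarrow> ('k ^ 2) set \<Rightarrow> ('k ^ 2) set \<Rightarrow> bool" where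
  "symmetric_lines A L T l l' \<longleftrightarrow>
    l = L \<and> l' = L \<or> l = T \<and> l' = T \<or>
    distinct [L, T, l, l'] \<and> lines_cross_ratio A L T l l' (- 1)"


subsection \<open>Periodic orbits and reflectivity\<close>

definition periodic_orbit ::
    "'k::{real_normed_field,banach} framed_point set list \<Rightarrow> 'k framed_point list \<Rightarrow> bool" where
  "periodic_orbit \<alpha>s ps \<longleftrightarrow>
    length ps = length \<alpha>s \<and>
    (\<forall>j<length \<alpha>s.
       ps ! j \<in> \<alpha>s ! j \<and>
       (let k = length \<alpha>s;
            A = fst (ps ! j);
            L = snd (ps ! j);
            B = fst (ps ! ((j + k - 1) mod k));
            C = fst (ps ! ((j + 1) mod k));
            T = tangent_line (fst ` (\<alpha>s ! j)) A
        in A \<noteq> B \<and> A \<noteq> C \<and> join B A \<noteq> T \<and> join A C \<noteq> T \<and>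
           symmetric_lines A L T (join B A) (join A C)))"

text \<open>Closeness is meant for germs: for all neighbourhoods \<open>W j\<close> of the base points, all pairs in
  the first two curves that are close enough to the base pair extend to an orbit within \<open>W\<close>.\<close>

definition reflective ::
    "'k::{real_normed_field,banach} framed_point set list \<Rightarrow> 'k framed_point list \<Rightarrow> bool" where
  "reflective \<alpha>s ps \<longleftrightarrow>
    periodic_orbit \<alpha>s ps \<and>
    (\<forall>W. (\<forall>j<length \<alpha>s. openin PT_topology (W j) \<and> ps ! j \<in> W j) \<longrightarrow>
      (\<exists>U V. openin PT_topology U \<and> openin PT_topology V \<and> ps ! 0 \<in> U \<and> ps ! 1 \<in> V \<and>
        (\<forall>p \<in> \<alpha>s ! 0 \<inter> U. \<forall>q \<in> \<alpha>s ! 1 \<inter> V.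
          \<exists>qs. periodic_orbit \<alpha>s qs \<and> qs ! 0 = p \<and> qs ! 1 = q \<and>
            (\<forall>j<length \<alpha>s. qs ! j \<in> W j))))"


subsection \<open>Right-spherical billiards\<close>

definition non_collinear ::
    "('k::field ^ 3) set \<Rightarrow> ('k ^ 3) set \<Rightarrow> ('k ^ 3) set \<Rightarrow> bool" where
  "non_collinear P Q R \<longleftrightarrow> \<not> (\<exists>l. proj_line l \<and> P \<subseteq> l \<and> Q \<subseteq> l \<and> R \<subseteq> l)"

definition omega :: "('k::field ^ 3) set \<Rightarrow> ('k ^ 3) set \<Rightarrow> 'k framed_point set" where
  "omega l P =
    {(A, {B. chart_point B \<subseteq> proj_join (chart_point A) P}) | A. chart_point A \<subseteq> l}"

end

theory Submission
  imports Defs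
begin

text \<open>
  Write \<open>A(s)\<close>, \<open>B(t)\<close>, \<open>C(u)\<close> for the three boundary curves. If every pair \<open>(s, t)\<close> closes up to a
  triangle with \<open>u = u(s, t)\<close>, then differentiating the reflection laws at \<open>B\<close>, \<open>A\<close> and \<open>C\<close> expresses
  both partial derivatives of \<open>u\<close> and shows \<open>\<kappa>\<^sup>3 = 1\<close>, where \<open>- \<kappa>\<close> is the Menelaus ratio of the three
  tangent lines in the triangle. Hence \<open>\<kappa>\<close> is locally constant. Its two vanishing logarithmic derivatives
  together with \<open>u\<^sub>s\<^sub>t = u\<^sub>t\<^sub>s\<close> are three linear equations for the three curvatures. For \<open>\<kappa> = 1\<close> they force
  all curvatures to vanish; for a primitive cube root of unity they give a formula for the curvature of
  \<open>A\<close> whose right-hand side depends on \<open>t\<close>, which is absurd. So the curves are lines and \<open>\<kappa> = 1\<close>; the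
  latter says that each framing line passes through the intersection of the other two boundary lines.

  Conversely, in coordinates with respect to \<open>P\<close>, \<open>Q\<close>, \<open>R\<close>, with \<open>A = a\<^sub>1P + a\<^sub>2Q\<close>, \<open>B = b\<^sub>1Q + b\<^sub>2R\<close>,
  \<open>C = c\<^sub>1R + c\<^sub>2P\<close>, the reflection law of the right-spherical billiard is at all three vertices the same
  equation \<open>a\<^sub>2b\<^sub>2c\<^sub>2 = a\<^sub>1b\<^sub>1c\<^sub>1\<close>.
\<close>

text \<open>Reflectivity provides \<open>u(s, t)\<close> only pointwise, so its regularity has to be
  won. The third vertex is the intersection of the lines reflected at the first two, hence
  continuous; and a continuous solution of an equation whose derivative does not vanish (no side is
  tangent) is differentiable. On an orbit lying on a single line this intersection is undetermined,
  which is why such a base orbit has to be excluded separately. The laws at \<open>B\<close> and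
  \<open>A\<close> are differentiated with that vertex fixed, so no derivative of a framing appears.
  At \<open>C\<close> the vertex moves in both differentiations, but the curvature of
  \<open>C\<close> and the derivative of its framing enter both results through one common
  coefficient; eliminating it leaves a relation between first-order brackets, and this is the
  equation of cubes. Over the real field it gives \<kappa> = 1 at once; the argument against the
  other roots is carried out for both fields together.\<close>

unbundle no fps_syntax

subsection \<open>Plane vectors and logarithmic derivatives\<close>

definition cross2 :: "'k::comm_ring ^ 2 \<Rightarrow> 'k ^ 2 \<Rightarrow> 'k" where
  "cross2 v w = v $ 1 * w $ 2 - v $ 2 * w $ 1"

text \<open>Derivatives are taken componentwise over the ground field itself, so that for
  \<open>complex\<close> a velocity is a holomorphic derivative and not a merely real one.\<close>

definition has_vd :: "('k::real_normed_field \<Rightarrow> 'k ^ 'n) \<Rightarrow> 'k ^ 'n \<Rightarrow> 'k \<Rightarrow> bool" where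
  "has_vd f f' x \<longleftrightarrow> (\<forall>i. ((\<lambda>s. f s $ i) has_field_derivative f' $ i) (at x))"

text \<open>Nonvanishing of \<open>f x\<close> is built in: the relation is then stable under
  products and quotients and determines \<open>l\<close>.\<close>

definition has_log_deriv :: "('k::real_normed_field \<Rightarrow> 'k) \<Rightarrow> 'k \<Rightarrow> 'k \<Rightarrow> bool" where
  "has_log_deriv f l x \<longleftrightarrow> f x \<noteq> 0 \<and> (f has_field_derivative f x * l) (at x)"

lemma cross2_simps:
  fixes u v w :: "'k::comm_ring_1 ^ 2"
  shows "cross2 (u + v) w = cross2 u w + cross2 v w" "cross2 w (u + v) = cross2 w u + cross2 w v"
    "cross2 (u - v) w = cross2 u w - cross2 v w" "cross2 w (u - v) = cross2 w u - cross2 w v"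
    "cross2 (c *s v) w = c * cross2 v w" "cross2 v (c *s w) = c * cross2 v w"
    "cross2 (- v) w = - cross2 v w" "cross2 v (- w) = - cross2 v w"
    "cross2 v v = 0" "cross2 v 0 = 0" "cross2 0 v = 0"
  by (simp_all add: cross2_def algebra_simps)

lemma cross2_commute: "cross2 w v = - cross2 v (w :: 'k::comm_ring_1 ^ 2)"
  by (simp add: cross2_def)

text \<open>The three-term Pluecker relation. It collapses the numerator in the derivative of a
  quotient of two brackets to a single product.\<close>

lemma cross2_plucker:
  fixes x y z w :: "'k::comm_ring_1 ^ 2"
  shows "cross2 x y * cross2 z w - cross2 x w * cross2 z y = cross2 x z * cross2 y w"
  by (simp add: cross2_def algebra_simps)

lemma vec2_eq_iff: "v = w \<longleftrightarrow> v $ 1 = w $ 1 \<and> v $ 2 = w $ (2 :: 2)"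
  by (simp add: vec_eq_iff forall_2)

text \<open>Cramer's rule for the frame \<open>b\<close>, \<open>c\<close>.\<close>

lemma cross2_expand:
  fixes b c v :: "'k::field ^ 2"
  assumes "cross2 b c \<noteq> 0"
  shows "v = (cross2 v c / cross2 b c) *s b + (cross2 b v / cross2 b c) *s c"
  using assms
  by (simp add: vec2_eq_iff divide_simps) (simp add: cross2_def algebra_simps)

lemma cross2_parallel:
  fixes v w :: "'k::field ^ 2"
  assumes "cross2 v w = 0" "v \<noteq> 0"
  obtains c where "w = c *s v"
proof -
  consider "v $ 1 \<noteq> 0" | "v $ 2 \<noteq> 0"
    using assms(2) by (auto simp: vec2_eq_iff)
  then show thesis
  proof cases
    case 1
    with assms show thesis
      by (intro that[of "w $ 1 / v $ 1"]) (auto simp: vec2_eq_iff cross2_def field_simps)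
  next
    case 2
    with assms show thesis
      by (intro that[of "w $ 2 / v $ 2"]) (auto simp: vec2_eq_iff cross2_def field_simps)
  qed
qed

lemma has_vd_diff:
  "has_vd f f' x \<Longrightarrow> has_vd g g' x \<Longrightarrow> has_vd (\<lambda>s. f s - g s) (f' - g') x"
  by (auto simp: has_vd_def intro!: derivative_intros)

lemma has_vd_const: "has_vd (\<lambda>s. c) 0 x"
  by (auto simp: has_vd_def)

lemma has_vd_compose:
  assumes "has_vd f f' (u x)" "(u has_field_derivative u') (at x)"
  shows "has_vd (\<lambda>s. f (u s)) (u' *s f') x"
  unfolding has_vd_def
proof
  fix i
  from DERIV_chain2[OF assms(1)[unfolded has_vd_def, rule_format, of i] assms(2)]
  show "((\<lambda>s. f (u s) $ i) has_field_derivative (u' *s f') $ i) (at x)"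
    by (simp add: mult.commute)
qed

lemma has_vd_cross2:
  assumes "has_vd f f' x" "has_vd g g' x"
  shows "((\<lambda>s. cross2 (f s) (g s)) has_field_derivative cross2 f' (g x) + cross2 (f x) g') (at x)"
  using assms unfolding has_vd_def cross2_def
  by (auto intro!: derivative_eq_intros simp: algebra_simps)

lemma has_vd_imp_isCont: "has_vd f f' x \<Longrightarrow> isCont f x"
  unfolding has_vd_def isCont_def
  by (metis DERIV_isCont isCont_def vec_tendstoI)

section \<open>Calculus of logarithmic derivatives\<close>

lemma has_log_deriv_mult:
  "has_log_deriv f l x \<Longrightarrow> has_log_deriv g m x \<Longrightarrow> has_log_deriv (\<lambda>s. f s * g s) (l + m) x"
  unfolding has_log_deriv_def
  by (auto intro!: derivative_eq_intros simp: algebra_simps)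

lemma has_log_deriv_divide:
  "has_log_deriv f l x \<Longrightarrow> has_log_deriv g m x \<Longrightarrow> has_log_deriv (\<lambda>s. f s / g s) (l - m) x"
  unfolding has_log_deriv_def
  by (auto intro!: derivative_eq_intros simp: field_simps)

lemma has_log_deriv_minus:
  "has_log_deriv f l x \<Longrightarrow> has_log_deriv (\<lambda>s. - f s) l x"
  unfolding has_log_deriv_def
  by (auto intro!: derivative_eq_intros simp: algebra_simps)

lemma has_log_deriv_power2:
  "has_log_deriv f l x \<Longrightarrow> has_log_deriv (\<lambda>s. (f s)\<^sup>2) (2 * l) x"
  unfolding power2_eq_square mult_2 by (rule has_log_deriv_mult)

lemma has_log_deriv_cong:
  assumes "has_log_deriv f l x" "\<forall>\<^sub>F s in nhds x. f s = g s"
  shows "has_log_deriv g l x"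
  using assms DERIV_cong_ev[OF refl assms(2) refl] eventually_nhds_x_imp_x[OF assms(2)]
  unfolding has_log_deriv_def by auto

lemma has_log_deriv_unique:
  "has_log_deriv f l x \<Longrightarrow> has_log_deriv f m x \<Longrightarrow> l = m"
  unfolding has_log_deriv_def by (metis DERIV_unique mult_left_cancel)

lemma DERIV_imp_has_log_deriv:
  "(f has_field_derivative d) (at x) \<Longrightarrow> f x \<noteq> 0 \<Longrightarrow> has_log_deriv f (d / f x) x"
  by (simp add: has_log_deriv_def)

text \<open>In Caratheodory's factorisation of \<open>T\<close> at \<open>u x\<close> the factor at
  \<open>u s\<close> tends to \<open>T'\<close>, because \<open>u\<close> is continuous; as
  \<open>T'\<close> is nonzero, it can be divided out of the difference quotient of
  \<open>R\<close>.\<close>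

lemma DERIV_continuous_preimage:
  fixes R T u :: "'k::real_normed_field \<Rightarrow> 'k"
  assumes R: "(R has_field_derivative R') (at x)"
    and T: "(T has_field_derivative T') (at (u x))" "T' \<noteq> 0"
    and u: "isCont u x" and eq: "\<forall>\<^sub>F s in nhds x. R s = T (u s)"
  shows "(u has_field_derivative R' / T') (at x)"
proof -
  from T(1) obtain m where m: "\<And>z. T z - T (u x) = m z * (z - u x)" "isCont m (u x)" "m (u x) = T'"
    unfolding CARAT_DERIV by blast
  have mu: "isCont (\<lambda>s. m (u s)) x"
    using isCont_o2[OF u m(2)] .
  have nz: "\<forall>\<^sub>F s in at x. m (u s) \<noteq> 0"
    using tendsto_imp_eventually_ne[OF mu[unfolded isCont_def]] T(2) m(3) by simp
  have "((\<lambda>s. (R s - R x) / (s - x) / m (u s)) \<longlongrightarrow> R' / T') (at x)"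
    using R mu T(2) m(3) unfolding has_field_derivative_iff isCont_def
    by (intro tendsto_divide) auto
  moreover have "\<forall>\<^sub>F s in at x. (R s - R x) / (s - x) / m (u s) = (u s - u x) / (s - x)"
  proof -
    have Rx: "R x = T (u x)"
      using eq by (rule eventually_nhds_x_imp_x)
    have "\<forall>\<^sub>F s in at x. R s = T (u s)"
      using eq by (simp add: eventually_nhds_conv_at)
    then show ?thesis
      using nz
    proof eventually_elim
      case (elim s)
      then show ?case
        using m(1)[of "u s"] Rx by simp
    qed
  qed
  ultimately show ?thesis
    unfolding has_field_derivative_iff by (rule Lim_transform_eventually)
qed

text \<open>Symmetry of second derivatives under Peano's hypotheses: one mixed derivative is given
  and continuous at the point, and the existence of the other is part of the conclusion. The second
  difference of \<open>f\<close> is estimated by two mean value inequalities, which hold over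
  \<open>complex\<close> as well as over \<open>real\<close>; the limits are then taken one variable
  at a time.\<close>

lemma mixed_partials_commute:
  fixes f fs ft fst' :: "'k::real_normed_field \<Rightarrow> 'k \<Rightarrow> 'k"
  assumes S: "open S" "(a, b) \<in> S"
    and fs: "\<And>s t. (s, t) \<in> S \<Longrightarrow> ((\<lambda>s. f s t) has_field_derivative fs s t) (at s)"
    and ft: "\<And>s t. (s, t) \<in> S \<Longrightarrow> ((\<lambda>t. f s t) has_field_derivative ft s t) (at t)"
    and fst': "\<And>s t. (s, t) \<in> S \<Longrightarrow> ((\<lambda>t. fs s t) has_field_derivative fst' s t) (at t)"
    and cont: "isCont (\<lambda>x. fst' (fst x) (snd x)) (a, b)"
  shows "((\<lambda>s. ft s b) has_field_derivative fst' a b) (at a)"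
  unfolding has_field_derivative_iff LIM_eq
proof (intro allI impI)
  fix e :: real
  assume e: "e > 0"
  define c where "c = fst' a b"
  obtain d1 where d1: "d1 > 0" "\<And>x. dist x (a, b) < d1 \<Longrightarrow> dist (fst' (fst x) (snd x)) c < e / 2"
    using cont[unfolded continuous_at_eps_delta, rule_format, OF half_gt_zero[OF e]]
    unfolding fst_conv snd_conv c_def by blast
  obtain d2 where d2: "d2 > 0" "\<And>x. dist x (a, b) < d2 \<Longrightarrow> x \<in> S"
    using S unfolding open_dist by blast
  \<comment> \<open>Halving puts the product of the two balls of radius \<open>d\<close> into both
    neighbourhoods, since the distance in a product is at most the sum of the distances.\<close>
  define d where "d = min d1 d2 / 2"
  have d: "d > 0" using d1 d2 by (simp add: d_def)
  have near: "(s, t) \<in> S \<and> norm (fst' s t - c) \<le> e / 2" if "s \<in> ball a d" "t \<in> ball b d" for s t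
  proof -
    have "dist (s, t) (a, b) \<le> dist s a + dist t b"
      by (simp add: dist_prod_def sqrt_sum_squares_le_sum)
    also have "\<dots> < d + d"
      using that by (intro add_strict_mono) (auto simp: dist_commute)
    finally have "dist (s, t) (a, b) < d1" "dist (s, t) (a, b) < d2"
      by (auto simp: d_def)
    then show ?thesis
      using d1(2)[of "(s, t)"] d2(2)[of "(s, t)"] by (simp add: dist_norm[of _ c] less_imp_le)
  qed
  \<comment> \<open>Subtracting the linear function with slope \<open>c\<close> leaves a derivative
    of norm at most \<open>e / 2\<close>.\<close>
  have inner: "norm ((fs s t - t * c) - (fs s b - b * c)) \<le> e / 2 * norm (t - b)"
    if "s \<in> ball a d" "t \<in> ball b d" for s t
  proof (rule field_differentiable_bound[of "ball b d" "\<lambda>t. fs s t - t * c" "\<lambda>t. fst' s t - c"])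
    show "((\<lambda>t. fs s t - t * c) has_field_derivative fst' s z - c) (at z within ball b d)"
      if "z \<in> ball b d" for z
    proof -
      have "((\<lambda>t. fs s t) has_field_derivative fst' s z) (at z within ball b d)"
        by (rule has_field_derivative_at_within, rule fst') (use near \<open>s \<in> ball a d\<close> that in blast)
      then show ?thesis
        by (auto intro!: derivative_eq_intros)
    qed
    show "norm (fst' s z - c) \<le> e / 2" if "z \<in> ball b d" for z
      using near \<open>s \<in> ball a d\<close> that by blast
    show "t \<in> ball b d" "b \<in> ball b d" "convex (ball b d)"
      using that d by simp_all
  qed
  have outer: "norm ((f s t - f s b - s * ((t - b) * c)) - (f a t - f a b - a * ((t - b) * c)))
      \<le> e / 2 * norm (t - b) * norm (s - a)"
    if "s \<in> ball a d" "t \<in> ball b d" for s t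
  proof (rule field_differentiable_bound[of "ball a d" "\<lambda>s. f s t - f s b - s * ((t - b) * c)"
        "\<lambda>s. fs s t - fs s b - (t - b) * c"])
    show "((\<lambda>s. f s t - f s b - s * ((t - b) * c)) has_field_derivative fs z t - fs z b - (t - b) * c)
        (at z within ball a d)" if "z \<in> ball a d" for z
    proof -
      have "b \<in> ball b d"
        using d by simp
      then have "((\<lambda>s. f s t) has_field_derivative fs z t) (at z within ball a d)"
        "((\<lambda>s. f s b) has_field_derivative fs z b) (at z within ball a d)"
        by (rule_tac [!] has_field_derivative_at_within, rule_tac [!] fs)
          (use near \<open>t \<in> ball b d\<close> that in blast)+
      then show ?thesis
        by (auto intro!: derivative_eq_intros)
    qed
    show "norm (fs z t - fs z b - (t - b) * c) \<le> e / 2 * norm (t - b)" if "z \<in> ball a d" for z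
      using inner[of z t] that \<open>t \<in> ball b d\<close> by (simp add: algebra_simps)
    show "s \<in> ball a d" "a \<in> ball a d" "convex (ball a d)"
      using that d by simp_all
  qed
  \<comment> \<open>Dividing by \<open>t - b\<close> and letting \<open>t\<close> tend to
    \<open>b\<close> turns the second difference into a difference of values of
    \<open>ft\<close>.\<close>
  have main: "norm ((ft s b - ft a b) - (s - a) * c) \<le> e / 2 * norm (s - a)" if "s \<in> ball a d" for s
  proof -
    have "((\<lambda>t. f s t - f a t) has_field_derivative ft s b - ft a b) (at b)"
    proof (intro DERIV_diff ft)
      have "a \<in> ball a d" "b \<in> ball b d"
        using d by simp_all
      then show "(s, b) \<in> S" "(a, b) \<in> S"
        using near that by blast+
    qed
    then have lim: "((\<lambda>t. ((f s t - f a t) - (f s b - f a b)) / (t - b)) \<longlongrightarrow> ft s b - ft a b) (at b)"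
      by (simp add: has_field_derivative_iff)
    have "((\<lambda>t. norm (((f s t - f a t) - (f s b - f a b)) / (t - b) - (s - a) * c))
        \<longlongrightarrow> norm (ft s b - ft a b - (s - a) * c)) (at b)"
      by (rule tendsto_norm[OF tendsto_diff[OF lim tendsto_const[of "(s - a) * c"]]])
    moreover have "\<forall>\<^sub>F t in at b. norm (((f s t - f a t) - (f s b - f a b)) / (t - b) - (s - a) * c)
        \<le> e / 2 * norm (s - a)"
    proof -
      have "\<forall>\<^sub>F t in at b. t \<in> ball b d"
        by (rule eventually_at_in_open') (use d in simp_all)
      moreover have "\<forall>\<^sub>F t in at b. t \<noteq> b"
        by (simp add: eventually_at_filter)
      ultimately show ?thesis
      proof eventually_elim
        case (elim t)
        have "norm (((f s t - f a t) - (f s b - f a b)) / (t - b) - (s - a) * c) * norm (t - b)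
          = norm ((f s t - f s b - s * ((t - b) * c)) - (f a t - f a b - a * ((t - b) * c)))"
        proof -
          have "(((f s t - f a t) - (f s b - f a b)) / (t - b) - (s - a) * c) * (t - b)
            = ((f s t - f a t) - (f s b - f a b)) - (s - a) * c * (t - b)"
            using elim(2) by (subst left_diff_distrib) simp
          also have "\<dots> = (f s t - f s b - s * ((t - b) * c)) - (f a t - f a b - a * ((t - b) * c))"
            by (simp add: algebra_simps)
          finally show ?thesis
            by (simp only: norm_mult[symmetric])
        qed
        also have "\<dots> \<le> e / 2 * norm (s - a) * norm (t - b)"
          using outer[OF \<open>s \<in> ball a d\<close> elim(1)] by (simp add: mult_ac)
        finally show ?case
          using elim(2) by (simp add: mult_le_cancel_right)
      qed
    qed
    ultimately show ?thesis
      by (rule tendsto_upperbound) simp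
  qed
  show "\<exists>r>0. \<forall>s. s \<noteq> a \<and> norm (s - a) < r \<longrightarrow> norm ((ft s b - ft a b) / (s - a) - fst' a b) < e"
  proof (intro exI conjI allI impI)
    show "d > 0" by fact
    fix s assume s: "s \<noteq> a \<and> norm (s - a) < d"
    have "norm ((ft s b - ft a b) / (s - a) - c) * norm (s - a) = norm ((ft s b - ft a b) - (s - a) * c)"
      using s by (simp only: norm_mult[symmetric]) (subst left_diff_distrib, simp add: mult.commute)
    also have "\<dots> \<le> e / 2 * norm (s - a)"
      using main[of s] s by (simp add: dist_norm norm_minus_commute)
    finally have "norm ((ft s b - ft a b) / (s - a) - c) \<le> e / 2"
      using s by (simp add: mult_le_cancel_right)
    then show "norm ((ft s b - ft a b) / (s - a) - fst' a b) < e"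
      using e by (simp add: c_def)
  qed
qed

subsection \<open>Second-order relations along a family of orbits\<close>

text \<open>Here \<open>(a1, a2, a3)\<close> are the coordinates of \<open>A'\<close> with respect to the vertices \<open>A, B, C\<close> (they
  sum to 0), \<open>\<alpha>2\<close> and \<open>\<alpha>3\<close> those of \<open>A''\<close>, and similarly for \<open>B\<close> and \<open>C\<close>; \<open>G = u\<^sub>s\<close> and \<open>H = u\<^sub>t\<close>.
  \<open>E1\<close> and \<open>E2\<close> say that \<open>\<kappa>\<close> is constant, \<open>E3\<close> that \<open>u\<^sub>s\<^sub>t = u\<^sub>t\<^sub>s\<close>.\<close>

lemma frame_relations:
  fixes a2 a3 b1 b3 c1 c2 \<alpha>2 \<alpha>3 \<beta>1 \<beta>3 \<gamma>1 \<gamma>2 G H \<kappa> :: "'k::field_char_0"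
  assumes nz: "a2 \<noteq> 0" "a3 \<noteq> 0" "b1 \<noteq> 0" "b3 \<noteq> 0" "c1 \<noteq> 0" "c2 \<noteq> 0"
  defines "a1 \<equiv> - a2 - a3" and "b2 \<equiv> - b1 - b3" and "c3 \<equiv> - c1 - c2"
  assumes G: "G = a3 * b1\<^sup>2 / (c1 * b3\<^sup>2)" and H: "H = b3 * a2\<^sup>2 / (c2 * a3\<^sup>2)"
    and \<kappa>: "a2 * b3 * c1 = - \<kappa> * a3 * b1 * c2" "\<kappa> ^ 3 = 1"
    and E1: "\<alpha>2 / a2 + G * (a2 * c3 - a3 * c2) / a2 + (b3 * a1 - b1 * a3) / b3 + G * \<gamma>1 / c1
      = \<alpha>3 / a3 + G * (b1 * c3 - b3 * c1) / b1 - (c1 * a2 - c2 * a1 - G * \<gamma>2) / c2"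
    and E2: "H * (a2 * c3 - a3 * c2) / a2 + \<beta>3 / b3 + (c1 * b2 - c2 * b1 + H * \<gamma>1) / c1
      = (a3 * b2 - a2 * b3) / a3 + (\<beta>1 - H * (b3 * c1 - b1 * c3)) / b1 + H * \<gamma>2 / c2"
    and E3: "G * ((a3 * b2 - a2 * b3) / a3 + 2 * ((\<beta>1 - H * (b3 * c1 - b1 * c3)) / b1)
        - (c1 * b2 - c2 * b1 + H * \<gamma>1) / c1 - 2 * (\<beta>3 / b3))
      = H * ((b3 * a1 - b1 * a3) / b3 + 2 * (\<alpha>2 / a2 + G * (a2 * c3 - a3 * c2) / a2)
        + (c1 * a2 - c2 * a1 - G * \<gamma>2) / c2 - 2 * (\<alpha>3 / a3))"
  shows "3 * (\<alpha>2 / a2 - \<alpha>3 / a3) = (a3 * b1 / b3) * (1 + \<kappa> - 2 * \<kappa>\<^sup>2)" (is ?goal_a)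
    and "3 * (\<beta>3 / b3 - \<beta>1 / b1) = - (a2 * b3 / a3) * (1 - 2 * \<kappa> + \<kappa>\<^sup>2)" (is ?goal_b)
    and "3 * H * (\<gamma>1 / c1 - \<gamma>2 / c2) = (a2 * b3 / a3) * (1 + \<kappa> - 2 * \<kappa>\<^sup>2)" (is ?goal_c)
    and "H * a3 * c2 / a2 = a2 * b3 / a3"
    and "H * b3 * c1 / b1 = - \<kappa> * (a2 * b3 / a3)"
proof -
  \<comment> \<open>Apart from \<open>a1\<close>, \<open>b2\<close> and \<open>c3\<close>, which
    cancel in the end, the mixed terms are \<open>X\<close> or \<open>Y\<close> times a power of
    \<kappa>. The quantities \<open>kA\<close>, \<open>kB\<close>, \<open>kC\<close> are the three
    curvatures up to nonzero factors.\<close>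
  define X where "X = a3 * b1 / b3"
  define Y where "Y = a2 * b3 / a3"
  define kA where "kA = \<alpha>2 / a2 - \<alpha>3 / a3"
  define kB where "kB = \<beta>3 / b3 - \<beta>1 / b1"
  define kC where "kC = \<gamma>1 / c1 - \<gamma>2 / c2"
  have \<kappa>0: "\<kappa> \<noteq> 0" using \<kappa>(2) by auto
  \<comment> \<open>Since \<open>\<kappa>\<^sup>2\<close> inverts \<kappa>, a division by \<kappa>
    becomes a multiplication; this happens in \<open>r1\<close>, \<open>r6\<close> and
    \<open>GY\<close>.\<close>
  have \<kappa>3: "\<kappa> * \<kappa>\<^sup>2 = 1" using \<kappa>(2) by (simp add: power3_eq_cube power2_eq_square mult.assoc)
  have c1: "c1 = - \<kappa> * a3 * b1 * c2 / (a2 * b3)"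
    using \<kappa>(1) nz by (simp add: field_simps)
  have XY: "X \<noteq> 0" "Y \<noteq> 0" using nz by (simp_all add: X_def Y_def)
  have r1: "G * a3 * c2 / a2 = - \<kappa>\<^sup>2 * X"
  proof -
    have "\<kappa> * (G * a3 * c2 / a2) = - X"
      using nz \<kappa>0 by (simp add: G c1 X_def field_simps power2_eq_square)
    then have "\<kappa>\<^sup>2 * (\<kappa> * (G * a3 * c2 / a2)) = - \<kappa>\<^sup>2 * X" by simp
    then show ?thesis using \<kappa>3 by (metis mult.assoc mult.commute mult_1)
  qed
  have r2: "c1 * a2 / c2 = - \<kappa> * X"
    using nz by (simp add: c1 X_def field_simps)
  have r3: "G * b3 * c1 / b1 = X"
    using nz by (simp add: G X_def field_simps power2_eq_square)
  have r4: "H * a3 * c2 / a2 = Y"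
    using nz by (simp add: H Y_def field_simps power2_eq_square)
  have r5: "H * b3 * c1 / b1 = - \<kappa> * Y"
    using nz by (simp add: H c1 Y_def field_simps power2_eq_square)
  have r6: "c2 * b1 / c1 = - \<kappa>\<^sup>2 * Y"
  proof -
    have "\<kappa> * (c2 * b1 / c1) = - Y"
      using nz \<kappa>0 by (simp add: c1 Y_def field_simps)
    then have "\<kappa>\<^sup>2 * (\<kappa> * (c2 * b1 / c1)) = - \<kappa>\<^sup>2 * Y" by simp
    then show ?thesis using \<kappa>3 by (metis mult.assoc mult.commute mult_1)
  qed
  have GY: "G * Y = - \<kappa>\<^sup>2 * (H * X)"
  proof -
    have "\<kappa> * (G * Y) = - H * X"
      using nz \<kappa>0 by (simp add: G H c1 X_def Y_def field_simps power2_eq_square)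
    then have "\<kappa>\<^sup>2 * (\<kappa> * (G * Y)) = - \<kappa>\<^sup>2 * (H * X)" by simp
    then show ?thesis using \<kappa>3 by (metis mult.assoc mult.commute mult_1)
  qed
  have s1: "G * (a2 * c3 - a3 * c2) / a2 = G * c3 + \<kappa>\<^sup>2 * X"
    using nz r1 by (simp add: right_diff_distrib diff_divide_distrib mult.assoc)
  have s2: "(b3 * a1 - b1 * a3) / b3 = a1 - X"
    using nz by (simp add: diff_divide_distrib X_def)
  have s3: "G * (b1 * c3 - b3 * c1) / b1 = G * c3 - X"
    using nz r3 by (simp add: right_diff_distrib diff_divide_distrib mult.assoc)
  have s4: "(c1 * a2 - c2 * a1 - G * \<gamma>2) / c2 = - \<kappa> * X - a1 - G * (\<gamma>2 / c2)"
    using nz r2 by (simp add: diff_divide_distrib)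
  have s5: "H * (a2 * c3 - a3 * c2) / a2 = H * c3 - Y"
    using nz r4 by (simp add: right_diff_distrib diff_divide_distrib mult.assoc)
  have s6: "(c1 * b2 - c2 * b1 + H * \<gamma>1) / c1 = b2 + \<kappa>\<^sup>2 * Y + H * (\<gamma>1 / c1)"
    using nz r6 by (simp add: diff_divide_distrib add_divide_distrib)
  have s7: "(a3 * b2 - a2 * b3) / a3 = b2 - Y"
    using nz by (simp add: diff_divide_distrib Y_def)
  have s8: "(\<beta>1 - H * (b3 * c1 - b1 * c3)) / b1 = \<beta>1 / b1 + \<kappa> * Y + H * c3"
    using nz r5 by (simp add: diff_divide_distrib right_diff_distrib mult.assoc)
  have E1': "kA + G * kC = (\<kappa> - \<kappa>\<^sup>2) * X"
    using E1 unfolding s1 s2 s3 s4 kA_def kC_def by (simp add: algebra_simps)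
  have E2': "kB + H * kC = (\<kappa> - \<kappa>\<^sup>2) * Y"
    using E2 unfolding s5 s6 s7 s8 kB_def kC_def by (simp add: algebra_simps)
  have E3': "2 * H * kA + 2 * G * kB + G * H * kC
      = H * X * (1 + \<kappa> - 2 * \<kappa>\<^sup>2) + G * Y * (2 * \<kappa> - 1 - \<kappa>\<^sup>2)"
    using E3 unfolding s1 s2 s4 s6 s7 s8 kA_def kB_def kC_def by (simp add: algebra_simps)
  have kA: "kA = (\<kappa> - \<kappa>\<^sup>2) * X - G * kC" and kB: "kB = (\<kappa> - \<kappa>\<^sup>2) * Y - H * kC"
    using E1' E2' by (simp_all add: algebra_simps)
  \<comment> \<open>Substituting \<open>kA\<close> and \<open>kB\<close> leaves
    \<open>G * H * kC\<close> with the coefficient - 2 - 2 + 1. This is the origin of the factor 3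
    in the conclusions, and it shows that the three equations are independent.\<close>
  have "3 * G * H * kC = H * X * (\<kappa> - 1) + G * Y * (1 - \<kappa>\<^sup>2)"
    using E3' unfolding kA kB by (simp add: algebra_simps)
  also have "H * X = - \<kappa> * (G * Y)"
  proof -
    have "\<kappa> * (G * Y) = - (\<kappa> * \<kappa>\<^sup>2) * (H * X)"
      unfolding GY by (simp add: algebra_simps)
    then show ?thesis unfolding \<kappa>3 by simp
  qed
  finally have "G * (3 * H * kC) = G * (Y * (1 + \<kappa> - 2 * \<kappa>\<^sup>2))"
    by (simp add: algebra_simps power2_eq_square)
  moreover have "G \<noteq> 0" using nz by (simp add: G)
  ultimately have C: "3 * H * kC = Y * (1 + \<kappa> - 2 * \<kappa>\<^sup>2)"
    by simp
  then show ?goal_c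
    by (simp add: kC_def Y_def)
  have "3 * kB = - Y * (1 - 2 * \<kappa> + \<kappa>\<^sup>2)"
    unfolding kB using C by (simp add: algebra_simps)
  then show ?goal_b
    by (simp add: kB_def Y_def)
  have "H * (3 * G * kC) = G * Y * (1 + \<kappa> - 2 * \<kappa>\<^sup>2)"
  proof -
    have "H * (3 * G * kC) = G * (3 * H * kC)" by simp
    then show ?thesis unfolding C by simp
  qed
  also have "\<dots> = H * (- (\<kappa>\<^sup>2 * (1 + \<kappa> - 2 * \<kappa>\<^sup>2)) * X)"
    unfolding GY by (simp add: algebra_simps)
  also have "\<kappa>\<^sup>2 * (1 + \<kappa> - 2 * \<kappa>\<^sup>2) = \<kappa>\<^sup>2 + 1 - 2 * \<kappa>"
    using \<kappa>3 by (simp add: algebra_simps power2_eq_square)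
  finally have "3 * G * kC = - (\<kappa>\<^sup>2 + 1 - 2 * \<kappa>) * X"
    using nz by (simp add: H)
  then have "3 * kA = X * (1 + \<kappa> - 2 * \<kappa>\<^sup>2)"
    unfolding kA by (simp add: algebra_simps)
  then show ?goal_a
    by (simp add: kA_def X_def)
  show "H * a3 * c2 / a2 = a2 * b3 / a3" "H * b3 * c1 / b1 = - \<kappa> * (a2 * b3 / a3)"
    using r4 r5 by (simp_all add: Y_def)
qed

section \<open>Differentiating the reflection law at a fixed and at a moving vertex\<close>

lemma isCont_eventually_nonzero:
  fixes f :: "'a::t2_space \<Rightarrow> 'b::real_normed_vector"
  assumes "isCont f x" "f x \<noteq> 0"
  shows "\<forall>\<^sub>F s in nhds x. f s \<noteq> 0"
  using assms tendsto_imp_eventually_ne[of f "f x" "nhds x" 0]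
  by (simp add: continuous_at flip: tendsto_at_iff_tendsto_nhds)

text \<open>With the reflecting vertex \<open>B\<close> fixed, the law says that the quotients of
  \<open>T\<close>-bracket by \<open>N\<close>-bracket of the two sides are opposite. After
  differentiation the law itself trades squares of \<open>N\<close>-brackets for squares of
  \<open>T\<close>-brackets, and the framing drops out of the derivative of
  \<open>u\<close>.\<close>

lemma mirror_partial:
  fixes A C :: "'k::real_normed_field \<Rightarrow> 'k ^ 2" and u :: "'k \<Rightarrow> 'k"
  assumes A: "has_vd A A' x" and C: "has_vd C C' (u x)" and u: "isCont u x"
    and eq: "\<forall>\<^sub>F s in nhds x. cross2 T (A s - B) * cross2 N (C (u s) - B)
        + cross2 T (C (u s) - B) * cross2 N (A s - B) = 0"
    and nz: "cross2 N (A x - B) \<noteq> 0" "cross2 T (A x - B) \<noteq> 0" "cross2 T (C (u x) - B) \<noteq> 0"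
      "cross2 C' (B - C (u x)) \<noteq> 0" "cross2 T N \<noteq> 0"
  shows "(u has_field_derivative - (cross2 A' (B - A x) * (cross2 T (C (u x) - B))\<^sup>2)
    / (cross2 C' (B - C (u x)) * (cross2 T (A x - B))\<^sup>2)) (at x)"
proof -
  define a where "a = A x - B"
  define c where "c = C (u x) - B"
  have eqx: "cross2 T a * cross2 N c + cross2 T c * cross2 N a = 0"
    using eventually_nhds_x_imp_x[OF eq] by (simp add: a_def c_def)
  have nz': "cross2 N a \<noteq> 0" "cross2 T a \<noteq> 0" "cross2 T c \<noteq> 0" "cross2 C' c \<noteq> 0"
    using nz by (auto simp: a_def c_def cross2_simps)
  have Nc: "cross2 N c \<noteq> 0"
    using eqx nz' by auto
  have d: "((\<lambda>s. cross2 V (A s - B)) has_field_derivative cross2 V A') (at x)"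
    "((\<lambda>v. cross2 V (C v - B)) has_field_derivative cross2 V C') (at (u x))" for V
    using has_vd_cross2[OF has_vd_const has_vd_diff[OF A has_vd_const[of B]], of V]
      has_vd_cross2[OF has_vd_const has_vd_diff[OF C has_vd_const[of B]], of V]
    by (simp_all add: cross2_simps)
  have R: "((\<lambda>s. cross2 T (A s - B) / cross2 N (A s - B)) has_field_derivative
      (cross2 T N * cross2 A' a) / (cross2 N a)\<^sup>2) (at x)"
    using DERIV_divide[OF d(1) d(1), of N T] nz'(1) cross2_plucker[of T A' N a]
    by (simp add: a_def power2_eq_square mult.commute)
  have T: "((\<lambda>v. - (cross2 T (C v - B) / cross2 N (C v - B))) has_field_derivative
      - ((cross2 T N * cross2 C' c) / (cross2 N c)\<^sup>2)) (at (u x))"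
    using DERIV_minus[OF DERIV_divide[OF d(2) d(2), of N T]] Nc cross2_plucker[of T C' N c]
    by (simp add: c_def power2_eq_square mult.commute)
  have ev: "\<forall>\<^sub>F s in nhds x. cross2 T (A s - B) / cross2 N (A s - B)
      = - (cross2 T (C (u s) - B) / cross2 N (C (u s) - B))"
  proof -
    have "isCont (\<lambda>s. cross2 N (A s - B)) x"
      using d(1) DERIV_isCont by blast
    moreover have "isCont (\<lambda>s. cross2 N (C (u s) - B)) x"
      using isCont_o2[OF u DERIV_isCont[OF d(2)]] .
    ultimately have "\<forall>\<^sub>F s in nhds x. cross2 N (A s - B) \<noteq> 0"
      "\<forall>\<^sub>F s in nhds x. cross2 N (C (u s) - B) \<noteq> 0"
      using isCont_eventually_nonzero nz'(1) Nc unfolding a_def c_def by blast+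
    with eq show ?thesis
      by eventually_elim (simp add: field_simps eq_neg_iff_add_eq_0)
  qed
  have "((\<lambda>s. u s) has_field_derivative (cross2 T N * cross2 A' a) / (cross2 N a)\<^sup>2
      / - ((cross2 T N * cross2 C' c) / (cross2 N c)\<^sup>2)) (at x)"
    by (rule DERIV_continuous_preimage[OF R T _ u ev]) (use nz' Nc nz(5) in simp)
  moreover have "(cross2 T N * cross2 A' a) / (cross2 N a)\<^sup>2 / - ((cross2 T N * cross2 C' c) / (cross2 N c)\<^sup>2)
    = - (cross2 A' (B - A x) * (cross2 T (C (u x) - B))\<^sup>2)
      / (cross2 C' (B - C (u x)) * (cross2 T (A x - B))\<^sup>2)"
  proof -
    have "cross2 N c / cross2 N a = - (cross2 T c / cross2 T a)"
      using eqx nz' by (simp add: field_simps eq_neg_iff_add_eq_0)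
    then have sq: "(cross2 N c)\<^sup>2 / (cross2 N a)\<^sup>2 = (cross2 T c)\<^sup>2 / (cross2 T a)\<^sup>2"
      by (metis power2_minus power_divide)
    have neg: "cross2 A' (B - A x) = - cross2 A' a" "cross2 C' (B - C (u x)) = - cross2 C' c"
      by (simp_all add: a_def c_def cross2_simps)
    have "- (cross2 A' (B - A x) * (cross2 T (C (u x) - B))\<^sup>2)
      / (cross2 C' (B - C (u x)) * (cross2 T (A x - B))\<^sup>2)
      = - (cross2 A' a / cross2 C' c) * ((cross2 T c)\<^sup>2 / (cross2 T a)\<^sup>2)"
      unfolding neg by (simp flip: a_def c_def)
    also have "\<dots> = - (cross2 A' a / cross2 C' c) * ((cross2 N c)\<^sup>2 / (cross2 N a)\<^sup>2)"
      by (simp add: sq)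
    finally show ?thesis
      using nz(5) nz' Nc by (simp add: field_simps)
  qed
  ultimately show ?thesis
    by simp
qed

text \<open>The invariant form of \<open>frame_relations\<close>, with the origin at
  \<open>A\<close>: each velocity is expanded in the two sides leaving its vertex, so that the
  brackets are, up to sign, coordinates times \<open>D\<close>. The second conclusion concerns what
  will be the logarithmic \<open>t\<close>-derivative of the factor of
  \<open>1 + \<kappa> - 2 * \<kappa>\<^sup>2\<close> in the first.\<close>

lemma orbit_frame_relations:
  fixes b c A1 A2 B1 B2 C1 C2 :: "'k::field_char_0 ^ 2"
  defines "D \<equiv> cross2 b c" and "f1 \<equiv> cross2 A1 b" and "f2 \<equiv> cross2 A1 c"
    and "g1 \<equiv> cross2 B1 (- b)" and "g2 \<equiv> cross2 B1 (c - b)"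
    and "h1 \<equiv> cross2 C1 (- c)" and "h2 \<equiv> cross2 C1 (b - c)"
  assumes nz: "D \<noteq> 0" "f1 \<noteq> 0" "f2 \<noteq> 0" "g1 \<noteq> 0" "g2 \<noteq> 0" "h1 \<noteq> 0" "h2 \<noteq> 0"
    and G: "G = - (f1 * g2\<^sup>2) / (h2 * g1\<^sup>2)" and H: "H = - (g1 * f2\<^sup>2) / (h1 * f1\<^sup>2)"
    and K3: "(f2 * g1 * h2) ^ 3 = (f1 * g2 * h1) ^ 3"
    and E1: "(cross2 A2 c + G * cross2 A1 C1) / f2 + cross2 B1 A1 / g1 + G * cross2 C2 (b - c) / h2
      = cross2 A2 b / f1 + G * cross2 B1 C1 / g2 + (G * cross2 C2 (- c) + cross2 C1 A1) / h1"
    and E2: "H * cross2 A1 C1 / f2 + cross2 B2 (- b) / g1 + (H * cross2 C2 (b - c) + cross2 C1 B1) / h2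
      = cross2 A1 B1 / f1 + (cross2 B2 (c - b) + H * cross2 B1 C1) / g2 + H * cross2 C2 (- c) / h1"
    and E3: "G * (cross2 A1 B1 / f1 + 2 * ((cross2 B2 (c - b) + H * cross2 B1 C1) / g2)
        - (H * cross2 C2 (b - c) + cross2 C1 B1) / h2 - 2 * (cross2 B2 (- b) / g1))
      = H * (cross2 B1 A1 / g1 + 2 * ((cross2 A2 c + G * cross2 A1 C1) / f2)
        - (G * cross2 C2 (- c) + cross2 C1 A1) / h1 - 2 * (cross2 A2 b / f1))"
    and \<kappa>: "\<kappa> = (f2 * g1 * h2) / (f1 * g2 * h1)"
  shows "3 * cross2 A1 A2 = f2 * f1\<^sup>2 * g2 / (g1 * D\<^sup>2) * (1 + \<kappa> - 2 * \<kappa>\<^sup>2)" (is ?goal_a)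
    and "3 * (H * cross2 A1 C1 / f2 + 2 * (cross2 A1 B1 / f1) + (cross2 B2 (c - b) + H * cross2 B1 C1) / g2
        - (cross2 B2 (- b) / g1 + 2 * ((cross2 B1 c + H * cross2 b C1) / D)))
      = - (f2 * g1 / (f1 * D)) * (\<kappa> + \<kappa>\<^sup>2 - 8)" (is ?goal_b)
    and "\<kappa> = 1 \<Longrightarrow> cross2 B1 B2 = 0" and "\<kappa> = 1 \<Longrightarrow> cross2 C1 C2 = 0"
proof -
  have fr: "\<exists>x y. v = x *s p + y *s q" if "cross2 p q \<noteq> 0" for v p q :: "'k ^ 2"
    using cross2_expand[OF that] by blast
  have cb: "cross2 c b = - D" by (simp add: D_def cross2_commute[of c b])
  have bc: "cross2 b c = D" by (simp add: D_def)
  note cs = cross2_simps cb bc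
  have D2: "cross2 (- b) (c - b) \<noteq> 0" "cross2 (- c) (b - c) \<noteq> 0"
    using nz(1) by (simp_all add: cs)
  obtain a2 a3 where A1: "A1 = a2 *s b + a3 *s c" using fr nz(1) D_def by blast
  obtain \<alpha>2 \<alpha>3 where A2: "A2 = \<alpha>2 *s b + \<alpha>3 *s c" using fr nz(1) D_def by blast
  obtain b1 b3 where B1: "B1 = b1 *s (- b) + b3 *s (c - b)" using fr[OF D2(1)] by blast
  obtain \<beta>1 \<beta>3 where B2: "B2 = \<beta>1 *s (- b) + \<beta>3 *s (c - b)" using fr[OF D2(1)] by blast
  obtain c1 c2 where C1: "C1 = c1 *s (- c) + c2 *s (b - c)" using fr[OF D2(2)] by blast
  obtain \<gamma>1 \<gamma>2 where C2: "C2 = \<gamma>1 *s (- c) + \<gamma>2 *s (b - c)" using fr[OF D2(2)] by blast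
  have f: "f1 = - a3 * D" "f2 = a2 * D" "g1 = b3 * D" "g2 = - b1 * D" "h1 = - c2 * D" "h2 = c1 * D"
    unfolding f1_def f2_def g1_def g2_def h1_def h2_def A1 B1 C1 by (simp_all add: cs algebra_simps)
  have nz': "a2 \<noteq> 0" "a3 \<noteq> 0" "b1 \<noteq> 0" "b3 \<noteq> 0" "c1 \<noteq> 0" "c2 \<noteq> 0"
    using nz f by auto
  have G': "G = a3 * b1\<^sup>2 / (c1 * b3\<^sup>2)"
    unfolding G f using nz(1) nz' by (simp add: field_simps power2_eq_square)
  have H': "H = b3 * a2\<^sup>2 / (c2 * a3\<^sup>2)"
    unfolding H f using nz(1) nz' by (simp add: field_simps power2_eq_square)
  have \<kappa>1: "a2 * b3 * c1 = - \<kappa> * a3 * b1 * c2"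
    unfolding \<kappa> f using nz(1) nz' by (simp add: field_simps)
  have \<kappa>3: "\<kappa> ^ 3 = 1"
    unfolding \<kappa> power_divide K3 using nz by simp
  have br: "cross2 A1 C1 = (a2 * (- c1 - c2) - a3 * c2) * D"
    "cross2 B1 A1 = (b3 * (- a2 - a3) - b1 * a3) * D"
    "cross2 A1 B1 = (a2 * b3 - a3 * (- b1 - b3)) * D"
    "cross2 B1 C1 = (b3 * c1 - b1 * (- c1 - c2)) * D"
    "cross2 C1 A1 = (c1 * a2 - c2 * (- a2 - a3)) * D"
    "cross2 C1 B1 = (c1 * (- b1 - b3) - c2 * b1) * D"
    "cross2 A2 c = \<alpha>2 * D" "cross2 A2 b = - \<alpha>3 * D"
    "cross2 B2 (- b) = \<beta>3 * D" "cross2 B2 (c - b) = - \<beta>1 * D"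
    "cross2 C2 (- c) = - \<gamma>2 * D" "cross2 C2 (b - c) = \<gamma>1 * D"
    "cross2 B1 c = (- b1 - b3) * D" "cross2 b C1 = (- c1 - c2) * D"
    unfolding A1 A2 B1 B2 C1 C2 by (simp_all add: cs algebra_simps)
  have s: "(cross2 A2 c + G * cross2 A1 C1) / f2 = \<alpha>2 / a2 + G * (a2 * (- c1 - c2) - a3 * c2) / a2"
    "cross2 B1 A1 / g1 = (b3 * (- a2 - a3) - b1 * a3) / b3"
    "G * cross2 C2 (b - c) / h2 = G * \<gamma>1 / c1"
    "cross2 A2 b / f1 = \<alpha>3 / a3"
    "G * cross2 B1 C1 / g2 = G * (b1 * (- c1 - c2) - b3 * c1) / b1"
    "(G * cross2 C2 (- c) + cross2 C1 A1) / h1 = - ((c1 * a2 - c2 * (- a2 - a3) - G * \<gamma>2) / c2)"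
    "H * cross2 A1 C1 / f2 = H * (a2 * (- c1 - c2) - a3 * c2) / a2"
    "cross2 B2 (- b) / g1 = \<beta>3 / b3"
    "(H * cross2 C2 (b - c) + cross2 C1 B1) / h2 = (c1 * (- b1 - b3) - c2 * b1 + H * \<gamma>1) / c1"
    "cross2 A1 B1 / f1 = (a3 * (- b1 - b3) - a2 * b3) / a3"
    "(cross2 B2 (c - b) + H * cross2 B1 C1) / g2 = (\<beta>1 - H * (b3 * c1 - b1 * (- c1 - c2))) / b1"
    "H * cross2 C2 (- c) / h1 = H * \<gamma>2 / c2"
    "(cross2 B1 c + H * cross2 b C1) / D = - b1 - b3 + H * (- c1 - c2)"
    unfolding f br using nz(1) nz' by (simp_all add: divide_simps) (simp_all add: algebra_simps)
  note rel = frame_relations[OF nz' G' H' \<kappa>1 \<kappa>3, of \<alpha>2 \<gamma>1 \<alpha>3 \<gamma>2 \<beta>3 \<beta>1]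
  have E1': "\<alpha>2 / a2 + G * (a2 * (- c1 - c2) - a3 * c2) / a2 + (b3 * (- a2 - a3) - b1 * a3) / b3 + G * \<gamma>1 / c1
    = \<alpha>3 / a3 + G * (b1 * (- c1 - c2) - b3 * c1) / b1 - (c1 * a2 - c2 * (- a2 - a3) - G * \<gamma>2) / c2"
    using E1 unfolding s by simp
  have E2': "H * (a2 * (- c1 - c2) - a3 * c2) / a2 + \<beta>3 / b3 + (c1 * (- b1 - b3) - c2 * b1 + H * \<gamma>1) / c1
      = (a3 * (- b1 - b3) - a2 * b3) / a3 + (\<beta>1 - H * (b3 * c1 - b1 * (- c1 - c2))) / b1 + H * \<gamma>2 / c2"
    using E2 unfolding s .
  have E3': "G * ((a3 * (- b1 - b3) - a2 * b3) / a3 + 2 * ((\<beta>1 - H * (b3 * c1 - b1 * (- c1 - c2))) / b1)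
        - (c1 * (- b1 - b3) - c2 * b1 + H * \<gamma>1) / c1 - 2 * (\<beta>3 / b3))
      = H * ((b3 * (- a2 - a3) - b1 * a3) / b3 + 2 * (\<alpha>2 / a2 + G * (a2 * (- c1 - c2) - a3 * c2) / a2)
        + (c1 * a2 - c2 * (- a2 - a3) - G * \<gamma>2) / c2 - 2 * (\<alpha>3 / a3))"
    using E3 unfolding s by (simp only: diff_minus_eq_add)
  note rel = rel[OF E1' E2' E3']
  have "cross2 A1 A2 = - (D * a2 * a3 * (\<alpha>2 / a2 - \<alpha>3 / a3))"
    unfolding A1 A2 using nz' by (simp add: cs divide_simps) (simp add: algebra_simps)
  then have "3 * cross2 A1 A2 = - (D * a2 * a3 * (3 * (\<alpha>2 / a2 - \<alpha>3 / a3)))"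
    by simp
  also have "\<dots> = f2 * f1\<^sup>2 * g2 / (g1 * D\<^sup>2) * (1 + \<kappa> - 2 * \<kappa>\<^sup>2)"
    unfolding rel f using nz' nz(1) by (simp add: divide_simps power2_eq_square)
  finally show ?goal_a .
  define Y where "Y = a2 * b3 / a3"
  have t: "H * (a2 * (- c1 - c2) - a3 * c2) / a2 = H * (- c1 - c2) - Y"
    "(a3 * (- b1 - b3) - a2 * b3) / a3 = - b1 - b3 - Y"
    "(\<beta>1 - H * (b3 * c1 - b1 * (- c1 - c2))) / b1 = \<beta>1 / b1 + \<kappa> * Y + H * (- c1 - c2)"
  proof -
    have "H * (a2 * (- c1 - c2) - a3 * c2) / a2 = H * (- c1 - c2) - H * a3 * c2 / a2"
      using nz' by (simp add: divide_simps) (simp add: algebra_simps)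
    then show "H * (a2 * (- c1 - c2) - a3 * c2) / a2 = H * (- c1 - c2) - Y"
      unfolding rel Y_def .
    show "(a3 * (- b1 - b3) - a2 * b3) / a3 = - b1 - b3 - Y"
      using nz' by (simp add: Y_def divide_simps)
    have "(\<beta>1 - H * (b3 * c1 - b1 * (- c1 - c2))) / b1 = \<beta>1 / b1 - H * b3 * c1 / b1 + H * (- c1 - c2)"
      using nz' by (simp add: divide_simps) (simp add: algebra_simps)
    then show "(\<beta>1 - H * (b3 * c1 - b1 * (- c1 - c2))) / b1 = \<beta>1 / b1 + \<kappa> * Y + H * (- c1 - c2)"
      unfolding rel Y_def by simp
  qed
  \<comment> \<open>The terms \<open>- b1 - b3\<close> and \<open>H * (- c1 - c2)\<close> cancel
    against the contribution of \<open>D\<^sup>2\<close>; only multiples of \<open>Y\<close> and the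
    curvature at \<open>B\<close> remain.\<close>
  have "3 * (H * cross2 A1 C1 / f2 + 2 * (cross2 A1 B1 / f1) + (cross2 B2 (c - b) + H * cross2 B1 C1) / g2
        - (cross2 B2 (- b) / g1 + 2 * ((cross2 B1 c + H * cross2 b C1) / D)))
      = - 9 * Y + 3 * \<kappa> * Y - 3 * (\<beta>3 / b3 - \<beta>1 / b1)"
    unfolding s t by (simp add: algebra_simps)
  also have "\<dots> = Y * (\<kappa> + \<kappa>\<^sup>2 - 8)"
    unfolding rel Y_def[symmetric] by (simp add: algebra_simps)
  also have "Y = - (f2 * g1 / (f1 * D))"
    unfolding f Y_def using nz(1) nz' by (simp add: divide_simps)
  finally show ?goal_b .
  show "cross2 B1 B2 = 0" if "\<kappa> = 1"
  proof -
    have "3 * (\<beta>3 / b3 - \<beta>1 / b1) = 0"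
      unfolding rel that by simp
    then have "b1 * \<beta>3 = b3 * \<beta>1"
      using nz' by (simp add: field_simps)
    then show ?thesis
      unfolding B1 B2 by (simp add: cs algebra_simps)
  qed
  show "cross2 C1 C2 = 0" if "\<kappa> = 1"
  proof -
    have "3 * H * (\<gamma>1 / c1 - \<gamma>2 / c2) = 0"
      unfolding rel that by simp
    moreover have "H \<noteq> 0" using H' nz' by simp
    ultimately have "c2 * \<gamma>1 = c1 * \<gamma>2"
      using nz' by (simp add: field_simps)
    then show ?thesis
      unfolding C1 C2 by (simp add: cs algebra_simps)
  qed
qed

text \<open>The coefficient of \<open>G\<close> is symmetric in \<open>a\<close> and
  \<open>y\<close>. Hence the same coefficient arises whether \<open>A\<close> or \<open>B\<close>
  moves along with \<open>C\<close>, and it can be eliminated between the two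
  differentiations.\<close>

lemma mirror_vertex_derivative:
  fixes A C T N :: "'k::real_normed_field \<Rightarrow> 'k ^ 2" and u :: "'k \<Rightarrow> 'k" and Y :: "'k ^ 2"
  assumes "has_vd A A' x" "has_vd C C' (u x)" "has_vd T T' (u x)" "has_vd N N' (u x)"
    and u: "(u has_field_derivative G) (at x)"
  defines "a \<equiv> A x - C (u x)" and "y \<equiv> Y - C (u x)" and "\<tau> \<equiv> T (u x)" and "\<nu> \<equiv> N (u x)"
  shows "((\<lambda>s. cross2 (T (u s)) (A s - C (u s)) * cross2 (N (u s)) (Y - C (u s))
      + cross2 (T (u s)) (Y - C (u s)) * cross2 (N (u s)) (A s - C (u s)))
    has_field_derivative G * (cross2 T' a * cross2 \<nu> y + cross2 \<tau> a * cross2 N' y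
        + cross2 T' y * cross2 \<nu> a + cross2 \<tau> y * cross2 N' a
        - cross2 \<tau> C' * cross2 \<nu> y - cross2 \<tau> a * cross2 \<nu> C'
        - cross2 \<tau> C' * cross2 \<nu> a - cross2 \<tau> y * cross2 \<nu> C')
      + (cross2 \<tau> A' * cross2 \<nu> y + cross2 \<tau> y * cross2 \<nu> A')) (at x)"
proof -
  note vd = has_vd_compose[OF assms(2) u] has_vd_compose[OF assms(3) u] has_vd_compose[OF assms(4) u]
  note dA = has_vd_diff[OF assms(1) vd(1)] and dY = has_vd_diff[OF has_vd_const[of Y] vd(1)]
  show ?thesis
    by (rule DERIV_cong[OF DERIV_add[OF
            DERIV_mult[OF has_vd_cross2[OF vd(2) dA] has_vd_cross2[OF vd(3) dY]]
            DERIV_mult[OF has_vd_cross2[OF vd(2) dY] has_vd_cross2[OF vd(3) dA]]]])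
      (simp add: cross2_simps a_def y_def \<tau>_def \<nu>_def algebra_simps)
qed

section \<open>Families of closed triangles over an open set of parameter pairs\<close>

lemma open_slices:
  assumes "open S" "(s, t) \<in> S"
  shows "\<forall>\<^sub>F s' in nhds s. (s', t) \<in> S" "\<forall>\<^sub>F t' in nhds t. (s, t') \<in> S"
proof -
  have "open ((\<lambda>s'. (s', t)) -` S)" "open ((\<lambda>t'. (s, t')) -` S)"
    using assms(1) by (auto intro!: open_vimage continuous_intros)
  from this[THEN eventually_nhds_in_open] assms(2)
  show "\<forall>\<^sub>F s' in nhds s. (s', t) \<in> S" "\<forall>\<^sub>F t' in nhds t. (s, t') \<in> S"
    by auto
qed

text \<open>The analytic content of the reflection laws, detached from curves and germs. A
  derivative is given for the framing at \<open>C\<close> alone, because the laws at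
  \<open>A\<close> and \<open>B\<close> are differentiated with their own vertex fixed. The
  conditions \<open>off_axis\<close> keep the sides away from the framing lines.\<close>

locale triangle_family =
  fixes A A1 A2 NA B B1 B2 NB C C1 C2 NC NC1 :: "'k::real_normed_field \<Rightarrow> 'k ^ 2"
    and S :: "('k \<times> 'k) set" and u :: "'k \<Rightarrow> 'k \<Rightarrow> 'k"
  assumes open_S: "open S"
    and der_A: "(s, t) \<in> S \<Longrightarrow> has_vd A (A1 s) s" "(s, t) \<in> S \<Longrightarrow> has_vd A1 (A2 s) s"
    and der_B: "(s, t) \<in> S \<Longrightarrow> has_vd B (B1 t) t" "(s, t) \<in> S \<Longrightarrow> has_vd B1 (B2 t) t"
    and der_C: "(s, t) \<in> S \<Longrightarrow> has_vd C (C1 (u s t)) (u s t)"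
      "(s, t) \<in> S \<Longrightarrow> has_vd C1 (C2 (u s t)) (u s t)"
    and der_NC: "(s, t) \<in> S \<Longrightarrow> has_vd NC (NC1 (u s t)) (u s t)"
    and cont_2: "(s, t) \<in> S \<Longrightarrow> isCont B2 t" "(s, t) \<in> S \<Longrightarrow> isCont C2 (u s t)"
    and cont_u: "(s, t) \<in> S \<Longrightarrow> isCont (\<lambda>x. u (fst x) (snd x)) (s, t)"
    and transversal: "(s, t) \<in> S \<Longrightarrow> cross2 (A1 s) (NA s) \<noteq> 0"
      "(s, t) \<in> S \<Longrightarrow> cross2 (B1 t) (NB t) \<noteq> 0"
      "(s, t) \<in> S \<Longrightarrow> cross2 (C1 (u s t)) (NC (u s t)) \<noteq> 0"
    and off_axis: "(s, t) \<in> S \<Longrightarrow> cross2 (NA s) (B t - A s) \<noteq> 0"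
      "(s, t) \<in> S \<Longrightarrow> cross2 (NB t) (A s - B t) \<noteq> 0"
      "(s, t) \<in> S \<Longrightarrow> cross2 (NC (u s t)) (A s - C (u s t)) \<noteq> 0"
    and mirror_A: "(s, t) \<in> S \<Longrightarrow> cross2 (A1 s) (B t - A s) * cross2 (NA s) (C (u s t) - A s)
      + cross2 (A1 s) (C (u s t) - A s) * cross2 (NA s) (B t - A s) = 0"
    and mirror_B: "(s, t) \<in> S \<Longrightarrow> cross2 (B1 t) (A s - B t) * cross2 (NB t) (C (u s t) - B t)
      + cross2 (B1 t) (C (u s t) - B t) * cross2 (NB t) (A s - B t) = 0"
    and mirror_C: "(s, t) \<in> S \<Longrightarrow>
      cross2 (C1 (u s t)) (A s - C (u s t)) * cross2 (NC (u s t)) (B t - C (u s t))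
      + cross2 (C1 (u s t)) (B t - C (u s t)) * cross2 (NC (u s t)) (A s - C (u s t)) = 0"
    and not_tangent: "(s, t) \<in> S \<Longrightarrow> cross2 (A1 s) (B t - A s) \<noteq> 0"
      "(s, t) \<in> S \<Longrightarrow> cross2 (A1 s) (C (u s t) - A s) \<noteq> 0"
      "(s, t) \<in> S \<Longrightarrow> cross2 (B1 t) (A s - B t) \<noteq> 0"
      "(s, t) \<in> S \<Longrightarrow> cross2 (B1 t) (C (u s t) - B t) \<noteq> 0"
      "(s, t) \<in> S \<Longrightarrow> cross2 (C1 (u s t)) (A s - C (u s t)) \<noteq> 0"
      "(s, t) \<in> S \<Longrightarrow> cross2 (C1 (u s t)) (B t - C (u s t)) \<noteq> 0"
    and non_degenerate: "(s, t) \<in> S \<Longrightarrow> cross2 (B t - A s) (C (u s t) - A s) \<noteq> 0"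
begin

text \<open>Brackets of the velocity at \<open>A\<close> (\<open>f\<close>), \<open>B\<close>
  (\<open>g\<close>) and \<open>C\<close> (\<open>h\<close>) with the two sides leaving that vertex;
  they are nonzero because no side is tangent.\<close>

definition f1 where "f1 s t = cross2 (A1 s) (B t - A s)"
definition f2 where "f2 s t = cross2 (A1 s) (C (u s t) - A s)"
definition g1 where "g1 s t = cross2 (B1 t) (A s - B t)"
definition g2 where "g2 s t = cross2 (B1 t) (C (u s t) - B t)"
definition h1 where "h1 s t = cross2 (C1 (u s t)) (A s - C (u s t))"
definition h2 where "h2 s t = cross2 (C1 (u s t)) (B t - C (u s t))"
definition D where "D s t = cross2 (B t - A s) (C (u s t) - A s)"
definition G where "G s t = - (f1 s t * (g2 s t)\<^sup>2) / (h2 s t * (g1 s t)\<^sup>2)"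
definition H where "H s t = - (g1 s t * (f2 s t)\<^sup>2) / (h1 s t * (f1 s t)\<^sup>2)"

lemmas bracket_defs = f1_def f2_def g1_def g2_def h1_def h2_def D_def

lemma nonzero:
  assumes "(s, t) \<in> S"
  shows "f1 s t \<noteq> 0" "f2 s t \<noteq> 0" "g1 s t \<noteq> 0" "g2 s t \<noteq> 0" "h1 s t \<noteq> 0" "h2 s t \<noteq> 0" "D s t \<noteq> 0"
  using not_tangent[OF assms] non_degenerate[OF assms] by (simp_all add: bracket_defs)

lemma cont_u_slices:
  assumes "(s, t) \<in> S"
  shows "isCont (\<lambda>s. u s t) s" "isCont (\<lambda>t. u s t) t"
proof -
  have "isCont (\<lambda>s. (s, t)) s" "isCont (\<lambda>t. (s, t)) t"
    by (intro continuous_intros)+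
  from this[THEN isCont_o2] show "isCont (\<lambda>s. u s t) s" "isCont (\<lambda>t. u s t) t"
    using cont_u[OF assms] by fastforce+
qed

lemma u_partials:
  assumes S: "(s, t) \<in> S"
  shows "((\<lambda>s. u s t) has_field_derivative G s t) (at s)"
    and "((\<lambda>t. u s t) has_field_derivative H s t) (at t)"
proof -
  have "\<forall>\<^sub>F s' in nhds s. cross2 (B1 t) (A s' - B t) * cross2 (NB t) (C (u s' t) - B t)
      + cross2 (B1 t) (C (u s' t) - B t) * cross2 (NB t) (A s' - B t) = 0"
    using open_slices(1)[OF open_S S] by eventually_elim (rule mirror_B)
  from mirror_partial[OF der_A(1)[OF S] der_C(1)[OF S] cont_u_slices(1)[OF S] this]
  show "((\<lambda>s. u s t) has_field_derivative G s t) (at s)"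
    unfolding G_def bracket_defs
    using off_axis(2)[OF S] not_tangent[OF S] transversal(2)[OF S] by blast
  have "\<forall>\<^sub>F t' in nhds t. cross2 (A1 s) (B t' - A s) * cross2 (NA s) (C (u s t') - A s)
      + cross2 (A1 s) (C (u s t') - A s) * cross2 (NA s) (B t' - A s) = 0"
    using open_slices(2)[OF open_S S] by eventually_elim (rule mirror_A)
  from mirror_partial[OF der_B(1)[OF S] der_C(1)[OF S] cont_u_slices(2)[OF S] this]
  show "((\<lambda>t. u s t) has_field_derivative H s t) (at t)"
    unfolding H_def bracket_defs
    using off_axis(1)[OF S] not_tangent[OF S] transversal(1)[OF S] by blast
qed

text \<open>Differentiating the law at \<open>C\<close> in \<open>s\<close> and in \<open>t\<close>
  gives \<open>G * P + QA = 0\<close> and \<open>H * P + QB = 0\<close> with the same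
  \<open>P\<close>, and only \<open>P\<close> contains \<open>C2\<close> and \<open>NC1\<close>.
  Eliminating it leaves first-order data, from which the law at \<open>C\<close> and the Pluecker
  relation remove the framing.\<close>

lemma GH_relation:
  assumes S: "(s, t) \<in> S"
  shows "H s t * f2 s t * (h2 s t)\<^sup>2 = G s t * g2 s t * (h1 s t)\<^sup>2"
proof -
  define a where "a = A s - C (u s t)"
  define b where "b = B t - C (u s t)"
  define \<tau> where "\<tau> = C1 (u s t)"
  define \<nu> where "\<nu> = NC (u s t)"
  define P where "P = cross2 (C2 (u s t)) a * cross2 \<nu> b + cross2 \<tau> a * cross2 (NC1 (u s t)) b
        + cross2 (C2 (u s t)) b * cross2 \<nu> a + cross2 \<tau> b * cross2 (NC1 (u s t)) a
        - cross2 \<tau> \<tau> * cross2 \<nu> b - cross2 \<tau> a * cross2 \<nu> \<tau>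
        - cross2 \<tau> \<tau> * cross2 \<nu> a - cross2 \<tau> b * cross2 \<nu> \<tau>"
  define QA where "QA = cross2 \<tau> (A1 s) * cross2 \<nu> b + cross2 \<tau> b * cross2 \<nu> (A1 s)"
  define QB where "QB = cross2 \<tau> (B1 t) * cross2 \<nu> a + cross2 \<tau> a * cross2 \<nu> (B1 t)"
  have zero: "d = 0" if "(F has_field_derivative d) (at x)" "\<forall>\<^sub>F y in nhds x. F y = 0"
    for F :: "'k \<Rightarrow> 'k" and d x
  proof -
    have "((\<lambda>y. 0) has_field_derivative d) (at x)"
      using that(1) DERIV_cong_ev[OF refl that(2) refl] by blast
    then show ?thesis using DERIV_unique DERIV_const by blast
  qed
  have ev: "\<forall>\<^sub>F s' in nhds s. cross2 (C1 (u s' t)) (A s' - C (u s' t)) * cross2 (NC (u s' t)) (B t - C (u s' t))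
      + cross2 (C1 (u s' t)) (B t - C (u s' t)) * cross2 (NC (u s' t)) (A s' - C (u s' t)) = 0"
    using open_slices(1)[OF open_S S] by eventually_elim (rule mirror_C)
  have eqA: "G s t * P + QA = 0"
    unfolding P_def QA_def a_def b_def \<tau>_def \<nu>_def
    by (rule zero[OF mirror_vertex_derivative[OF der_A(1)[OF S] der_C[OF S] der_NC[OF S] u_partials(1)[OF S]] ev])
  have "H s t * (cross2 (C2 (u s t)) b * cross2 \<nu> a + cross2 \<tau> b * cross2 (NC1 (u s t)) a
        + cross2 (C2 (u s t)) a * cross2 \<nu> b + cross2 \<tau> a * cross2 (NC1 (u s t)) b
        - cross2 \<tau> \<tau> * cross2 \<nu> a - cross2 \<tau> b * cross2 \<nu> \<tau>
        - cross2 \<tau> \<tau> * cross2 \<nu> b - cross2 \<tau> a * cross2 \<nu> \<tau>) + QB = 0"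
    unfolding QB_def a_def b_def \<tau>_def \<nu>_def
  proof (rule zero[OF mirror_vertex_derivative[OF der_B(1)[OF S] der_C[OF S] der_NC[OF S] u_partials(2)[OF S]]])
    show "\<forall>\<^sub>F t' in nhds t. cross2 (C1 (u s t')) (B t' - C (u s t')) * cross2 (NC (u s t')) (A s - C (u s t'))
      + cross2 (C1 (u s t')) (A s - C (u s t')) * cross2 (NC (u s t')) (B t' - C (u s t')) = 0"
      using open_slices(2)[OF open_S S] by eventually_elim (metis add.commute mirror_C)
  qed
  then have eqB: "H s t * P + QB = 0"
    by (simp add: P_def algebra_simps)
  have "H s t * QA = G s t * QB"
    using eqA eqB by (metis (no_types, lifting) add_eq_0_iff mult.left_commute mult_minus_right)
  have m: "cross2 \<tau> b * cross2 \<nu> a = - (cross2 \<tau> a * cross2 \<nu> b)"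
    using mirror_C[OF S] by (simp add: a_def b_def \<tau>_def \<nu>_def eq_neg_iff_add_eq_0 add.commute)
  have na: "cross2 \<nu> a \<noteq> 0" and ta: "cross2 \<tau> a \<noteq> 0" and tb: "cross2 \<tau> b \<noteq> 0"
    and tn: "cross2 \<tau> \<nu> \<noteq> 0"
    using off_axis(3)[OF S] not_tangent[OF S] transversal(3)[OF S]
    by (simp_all add: a_def b_def \<tau>_def \<nu>_def)
  have nb: "cross2 \<nu> b \<noteq> 0" using m na tb by auto
  have f: "cross2 (A1 s) a = - f2 s t" "cross2 (B1 t) b = - g2 s t" "cross2 \<tau> a = h1 s t" "cross2 \<tau> b = h2 s t"
    by (simp_all add: bracket_defs a_def b_def \<tau>_def cross2_simps)
  \<comment> \<open>Through \<open>m\<close>, the law at \<open>C\<close> turns the sum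
    \<open>QA\<close> into a difference of the shape required by the Pluecker relation.\<close>
  have "QA * cross2 \<nu> a = cross2 \<nu> b * (cross2 \<tau> \<nu> * cross2 (A1 s) a)"
  proof -
    have "QA * cross2 \<nu> a = cross2 \<nu> b * (cross2 \<tau> (A1 s) * cross2 \<nu> a)
        + (cross2 \<tau> b * cross2 \<nu> a) * cross2 \<nu> (A1 s)"
      unfolding QA_def by (simp add: algebra_simps)
    also have "\<dots> = cross2 \<nu> b * (cross2 \<tau> (A1 s) * cross2 \<nu> a - cross2 \<tau> a * cross2 \<nu> (A1 s))"
      unfolding m by (simp add: algebra_simps)
    finally show ?thesis unfolding cross2_plucker .
  qed
  moreover have "QB * cross2 \<nu> b = cross2 \<nu> a * (cross2 \<tau> \<nu> * cross2 (B1 t) b)"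
  proof -
    have "QB * cross2 \<nu> b = cross2 \<nu> a * (cross2 \<tau> (B1 t) * cross2 \<nu> b)
        + (cross2 \<tau> a * cross2 \<nu> b) * cross2 \<nu> (B1 t)"
      unfolding QB_def by (simp add: algebra_simps)
    also have "cross2 \<tau> a * cross2 \<nu> b = - (cross2 \<tau> b * cross2 \<nu> a)"
      unfolding m by simp
    also have "cross2 \<nu> a * (cross2 \<tau> (B1 t) * cross2 \<nu> b) + - (cross2 \<tau> b * cross2 \<nu> a) * cross2 \<nu> (B1 t)
       = cross2 \<nu> a * (cross2 \<tau> (B1 t) * cross2 \<nu> b - cross2 \<tau> b * cross2 \<nu> (B1 t))"
      by (simp add: algebra_simps)
    finally show ?thesis unfolding cross2_plucker .
  qed
  moreover have "H s t * (QA * cross2 \<nu> a) * cross2 \<nu> b = G s t * (QB * cross2 \<nu> b) * cross2 \<nu> a"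
    using \<open>H s t * QA = G s t * QB\<close> by (metis mult.assoc mult.commute)
  ultimately have "cross2 \<tau> \<nu> * (H s t * f2 s t * (cross2 \<nu> b)\<^sup>2) = cross2 \<tau> \<nu> * (G s t * g2 s t * (cross2 \<nu> a)\<^sup>2)"
    unfolding f by (simp add: power2_eq_square algebra_simps)
  then have "H s t * f2 s t * (cross2 \<nu> b)\<^sup>2 = G s t * g2 s t * (cross2 \<nu> a)\<^sup>2"
    using tn by simp
  then have "H s t * f2 s t * (h1 s t * cross2 \<nu> b)\<^sup>2 = G s t * g2 s t * (cross2 \<nu> a)\<^sup>2 * (h1 s t)\<^sup>2"
    by (simp add: power_mult_distrib mult.assoc)
  also have "h1 s t * cross2 \<nu> b = - (h2 s t * cross2 \<nu> a)"
    using m f by simp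
  finally have "(cross2 \<nu> a)\<^sup>2 * (H s t * f2 s t * (h2 s t)\<^sup>2) = (cross2 \<nu> a)\<^sup>2 * (G s t * g2 s t * (h1 s t)\<^sup>2)"
    by (simp add: power_mult_distrib mult_ac)
  then show ?thesis
    using na by simp
qed

text \<open>Inserting the formulas for \<open>G\<close> and \<open>H\<close> into
  \<open>GH_relation\<close> makes every bracket occur to the third power: this is where the cube
  roots of unity come from.\<close>

lemma cubes_equal:
  assumes S: "(s, t) \<in> S"
  shows "(f2 s t * g1 s t * h2 s t) ^ 3 = (f1 s t * g2 s t * h1 s t) ^ 3"
  using GH_relation[OF S] nonzero[OF S] unfolding G_def H_def
  by (simp add: field_simps power2_eq_square power3_eq_cube)


section \<open>Second-order consequences for a family of closed triangles\<close>

lemma log_derivs_s: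
  assumes S: "(s, t) \<in> S"
  shows "has_log_deriv (\<lambda>s. f1 s t) (cross2 (A2 s) (B t - A s) / f1 s t) s" (is ?goal_a)
    and "has_log_deriv (\<lambda>s. f2 s t)
      ((cross2 (A2 s) (C (u s t) - A s) + G s t * cross2 (A1 s) (C1 (u s t))) / f2 s t) s" (is ?goal_b)
    and "has_log_deriv (\<lambda>s. g1 s t) (cross2 (B1 t) (A1 s) / g1 s t) s"
    and "has_log_deriv (\<lambda>s. g2 s t) (G s t * cross2 (B1 t) (C1 (u s t)) / g2 s t) s" (is ?goal_c)
    and "has_log_deriv (\<lambda>s. h1 s t)
      ((G s t * cross2 (C2 (u s t)) (A s - C (u s t)) + cross2 (C1 (u s t)) (A1 s)) / h1 s t) s" (is ?goal_d)
    and "has_log_deriv (\<lambda>s. h2 s t) (G s t * cross2 (C2 (u s t)) (B t - C (u s t)) / h2 s t) s" (is ?goal_e)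
proof -
  note vC = has_vd_compose[where u = "\<lambda>s. u s t", OF der_C(1)[OF S] u_partials(1)[OF S]]
    and vC1 = has_vd_compose[where u = "\<lambda>s. u s t", OF der_C(2)[OF S] u_partials(1)[OF S]]
    and vA = der_A(1)[OF S] and vA1 = der_A(2)[OF S] and c = has_vd_const and d = has_vd_diff
  show ?goal_a
    using DERIV_imp_has_log_deriv[OF has_vd_cross2[OF vA1 d[OF c[of "B t"] vA]]] nonzero(1)[OF S]
    unfolding f1_def by (simp add: cross2_simps)
  show ?goal_b
    using DERIV_imp_has_log_deriv[OF has_vd_cross2[OF vA1 d[OF vC vA]]] nonzero(2)[OF S]
    unfolding f2_def by (simp add: cross2_simps)
  show "has_log_deriv (\<lambda>s. g1 s t) (cross2 (B1 t) (A1 s) / g1 s t) s"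
    using DERIV_imp_has_log_deriv[OF has_vd_cross2[OF c[of "B1 t"] d[OF vA c[of "B t"]]]] nonzero(3)[OF S]
    unfolding g1_def by (simp add: cross2_simps)
  show ?goal_c
    using DERIV_imp_has_log_deriv[OF has_vd_cross2[OF c[of "B1 t"] d[OF vC c[of "B t"]]]] nonzero(4)[OF S]
    unfolding g2_def by (simp add: cross2_simps)
  show ?goal_d
    using DERIV_imp_has_log_deriv[OF has_vd_cross2[OF vC1 d[OF vA vC]]] nonzero(5)[OF S]
    unfolding h1_def by (simp add: cross2_simps right_diff_distrib)
  show ?goal_e
    using DERIV_imp_has_log_deriv[OF has_vd_cross2[OF vC1 d[OF c[of "B t"] vC]]] nonzero(6)[OF S]
    unfolding h2_def by (simp add: cross2_simps right_diff_distrib)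
qed

lemma log_derivs_t:
  assumes S: "(s, t) \<in> S"
  shows "has_log_deriv (\<lambda>t. f1 s t) (cross2 (A1 s) (B1 t) / f1 s t) t"
    and "has_log_deriv (\<lambda>t. f2 s t) (H s t * cross2 (A1 s) (C1 (u s t)) / f2 s t) t" (is ?goal_a)
    and "has_log_deriv (\<lambda>t. g1 s t) (cross2 (B2 t) (A s - B t) / g1 s t) t" (is ?goal_b)
    and "has_log_deriv (\<lambda>t. g2 s t)
      ((cross2 (B2 t) (C (u s t) - B t) + H s t * cross2 (B1 t) (C1 (u s t))) / g2 s t) t" (is ?goal_c)
    and "has_log_deriv (\<lambda>t. h1 s t) (H s t * cross2 (C2 (u s t)) (A s - C (u s t)) / h1 s t) t" (is ?goal_d)
    and "has_log_deriv (\<lambda>t. h2 s t)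
      ((H s t * cross2 (C2 (u s t)) (B t - C (u s t)) + cross2 (C1 (u s t)) (B1 t)) / h2 s t) t" (is ?goal_e)
    and "has_log_deriv (\<lambda>t. D s t)
      ((cross2 (B1 t) (C (u s t) - A s) + H s t * cross2 (B t - A s) (C1 (u s t))) / D s t) t" (is ?goal_f)
proof -
  note vC = has_vd_compose[where u = "\<lambda>t. u s t", OF der_C(1)[OF S] u_partials(2)[OF S]]
    and vC1 = has_vd_compose[where u = "\<lambda>t. u s t", OF der_C(2)[OF S] u_partials(2)[OF S]]
    and vB = der_B(1)[OF S] and vB1 = der_B(2)[OF S] and c = has_vd_const and d = has_vd_diff
  show "has_log_deriv (\<lambda>t. f1 s t) (cross2 (A1 s) (B1 t) / f1 s t) t"
    using DERIV_imp_has_log_deriv[OF has_vd_cross2[OF c[of "A1 s"] d[OF vB c[of "A s"]]]] nonzero(1)[OF S]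
    unfolding f1_def by (simp add: cross2_simps)
  show ?goal_a
    using DERIV_imp_has_log_deriv[OF has_vd_cross2[OF c[of "A1 s"] d[OF vC c[of "A s"]]]] nonzero(2)[OF S]
    unfolding f2_def by (simp add: cross2_simps)
  show ?goal_b
    using DERIV_imp_has_log_deriv[OF has_vd_cross2[OF vB1 d[OF c[of "A s"] vB]]] nonzero(3)[OF S]
    unfolding g1_def by (simp add: cross2_simps)
  show ?goal_c
    using DERIV_imp_has_log_deriv[OF has_vd_cross2[OF vB1 d[OF vC vB]]] nonzero(4)[OF S]
    unfolding g2_def by (simp add: cross2_simps)
  show ?goal_d
    using DERIV_imp_has_log_deriv[OF has_vd_cross2[OF vC1 d[OF c[of "A s"] vC]]] nonzero(5)[OF S]
    unfolding h1_def by (simp add: cross2_simps right_diff_distrib)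
  show ?goal_e
    using DERIV_imp_has_log_deriv[OF has_vd_cross2[OF vC1 d[OF vB vC]]] nonzero(6)[OF S]
    unfolding h2_def by (simp add: cross2_simps right_diff_distrib)
  show ?goal_f
    using DERIV_imp_has_log_deriv[OF has_vd_cross2[OF d[OF vB c[of "A s"]] d[OF vC c[of "A s"]]]] nonzero(7)[OF S]
    unfolding D_def by (simp add: cross2_simps right_diff_distrib)
qed

text \<open>Logarithmic differentiation of an equality of cubes; it replaces the argument that a
  continuous cube root of unity is locally constant.\<close>

lemma cubes_log_deriv:
  assumes "has_log_deriv F l x" "has_log_deriv F' l' x" "\<forall>\<^sub>F y in nhds x. F y ^ 3 = F' y ^ 3"
  shows "l = (l' :: 'k)"
proof -
  have "has_log_deriv (\<lambda>y. F y * F y * F y) (l + l + l) x" "has_log_deriv (\<lambda>y. F' y * F' y * F' y) (l' + l' + l') x"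
    using assms(1,2) by (intro has_log_deriv_mult; simp)+
  moreover have "\<forall>\<^sub>F y in nhds x. F y * F y * F y = F' y * F' y * F' y"
    using assms(3) by (simp add: power3_eq_cube)
  ultimately have "has_log_deriv (\<lambda>y. F' y * F' y * F' y) (l + l + l) x"
    "has_log_deriv (\<lambda>y. F' y * F' y * F' y) (l' + l' + l') x"
    by (auto intro: has_log_deriv_cong)
  then have "l + l + l = l' + l' + l'"
    by (rule has_log_deriv_unique)
  then have "3 * l = 3 * l'" by simp
  then show ?thesis by simp
qed

text \<open>The \<open>t\<close>-derivative of \<open>G\<close>, as an explicit expression from
  which its joint continuity can be read off, as the symmetry of second derivatives
  requires.\<close>

definition Gt where
  "Gt s t = G s t * (cross2 (A1 s) (B1 t) / f1 s t
    + 2 * ((cross2 (B2 t) (C (u s t) - B t) + H s t * cross2 (B1 t) (C1 (u s t))) / g2 s t)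
    - (H s t * cross2 (C2 (u s t)) (B t - C (u s t)) + cross2 (C1 (u s t)) (B1 t)) / h2 s t
    - 2 * (cross2 (B2 t) (A s - B t) / g1 s t))"

lemma G_deriv_t:
  assumes S: "(s, t) \<in> S"
  shows "((\<lambda>t. G s t) has_field_derivative Gt s t) (at t)"
proof -
  note l = log_derivs_t[OF S]
  have "has_log_deriv (\<lambda>t. - (f1 s t * (g2 s t)\<^sup>2) / (h2 s t * (g1 s t)\<^sup>2))
     (cross2 (A1 s) (B1 t) / f1 s t
    + 2 * ((cross2 (B2 t) (C (u s t) - B t) + H s t * cross2 (B1 t) (C1 (u s t))) / g2 s t)
    - ((H s t * cross2 (C2 (u s t)) (B t - C (u s t)) + cross2 (C1 (u s t)) (B1 t)) / h2 s t
    + 2 * (cross2 (B2 t) (A s - B t) / g1 s t))) t"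
    by (intro has_log_deriv_divide has_log_deriv_minus has_log_deriv_mult has_log_deriv_power2 l)
  then show ?thesis
    unfolding has_log_deriv_def Gt_def G_def[symmetric] by (simp add: diff_diff_eq)
qed

lemma H_log_deriv_s:
  assumes S: "(s, t) \<in> S"
  shows "((\<lambda>s. H s t) has_field_derivative H s t * (cross2 (B1 t) (A1 s) / g1 s t
    + 2 * ((cross2 (A2 s) (C (u s t) - A s) + G s t * cross2 (A1 s) (C1 (u s t))) / f2 s t)
    - (G s t * cross2 (C2 (u s t)) (A s - C (u s t)) + cross2 (C1 (u s t)) (A1 s)) / h1 s t
    - 2 * (cross2 (A2 s) (B t - A s) / f1 s t))) (at s)"
proof -
  note l = log_derivs_s[OF S]
  have "has_log_deriv (\<lambda>s. - (g1 s t * (f2 s t)\<^sup>2) / (h1 s t * (f1 s t)\<^sup>2))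
     (cross2 (B1 t) (A1 s) / g1 s t
    + 2 * ((cross2 (A2 s) (C (u s t) - A s) + G s t * cross2 (A1 s) (C1 (u s t))) / f2 s t)
    - ((G s t * cross2 (C2 (u s t)) (A s - C (u s t)) + cross2 (C1 (u s t)) (A1 s)) / h1 s t
    + 2 * (cross2 (A2 s) (B t - A s) / f1 s t))) s"
    by (intro has_log_deriv_divide has_log_deriv_minus has_log_deriv_mult has_log_deriv_power2 l)
  then show ?thesis
    unfolding has_log_deriv_def H_def[symmetric] by (simp add: diff_diff_eq)
qed

lemma Gt_cont:
  assumes S: "(s, t) \<in> S"
  shows "isCont (\<lambda>x. Gt (fst x) (snd x)) (s, t)"
proof -
  define X where "X = (s, t)"
  have X: "X \<in> S" "fst X = s" "snd X = t" by (simp_all add: X_def S)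
  have cont1: "isCont (\<lambda>x. F (fst x)) X" if "isCont F s" for F :: "'k \<Rightarrow> 'k ^ 2"
    using isCont_o2[of X fst F] that X by (simp add: isCont_fst)
  have cont2: "isCont (\<lambda>x. F (snd x)) X" if "isCont F t" for F :: "'k \<Rightarrow> 'k ^ 2"
    using isCont_o2[of X snd F] that X by (simp add: isCont_snd)
  have cont3: "isCont (\<lambda>x. F (u (fst x) (snd x))) X" if "isCont F (u s t)" for F :: "'k \<Rightarrow> 'k ^ 2"
    using isCont_o2[of X "\<lambda>x. u (fst x) (snd x)" F] cont_u[OF S] that X by (simp add: X_def)
  have cross: "isCont (\<lambda>x. cross2 (F x) (F' x)) X" if "isCont F X" "isCont F' X"
    for F F' :: "'k \<times> 'k \<Rightarrow> 'k ^ 2"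
    unfolding cross2_def by (intro continuous_intros that)
  have c: "isCont (\<lambda>x. A (fst x)) X" "isCont (\<lambda>x. A1 (fst x)) X"
    "isCont (\<lambda>x. B (snd x)) X" "isCont (\<lambda>x. B1 (snd x)) X" "isCont (\<lambda>x. B2 (snd x)) X"
    "isCont (\<lambda>x. C (u (fst x) (snd x))) X" "isCont (\<lambda>x. C1 (u (fst x) (snd x))) X"
    "isCont (\<lambda>x. C2 (u (fst x) (snd x))) X"
    using der_A[OF S] der_B[OF S] der_C[OF S] cont_2[OF S]
    by (auto intro!: cont1 cont2 cont3 intro: has_vd_imp_isCont)
  have "isCont (\<lambda>x. Gt (fst x) (snd x)) X"
    unfolding Gt_def G_def H_def bracket_defs
    by (intro continuous_intros cross c; (use not_tangent[OF S] X in simp))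
  then show ?thesis by (simp add: X_def)
qed

text \<open>Together with \<open>H_log_deriv_s\<close> this gives two expressions for the same mixed
  derivative of \<open>u\<close>, that is, the equation \<open>E3\<close>.\<close>

lemma mixed_partials:
  assumes S: "(s, t) \<in> S"
  shows "((\<lambda>s. H s t) has_field_derivative Gt s t) (at s)"
  using mixed_partials_commute[OF open_S S u_partials(1) u_partials(2) G_deriv_t Gt_cont[OF S]] .

definition \<kappa> where "\<kappa> s t = (f2 s t * g1 s t * h2 s t) / (f1 s t * g2 s t * h1 s t)"

text \<open>The logarithmic \<open>t\<close>-derivative of the factor \<open>W\<close> in \<open>3 A' \<times> A'' = W (1 + \<kappa> - 2 \<kappa>\<^sup>2)\<close>.\<close>

definition LW where
  "LW s t = H s t * cross2 (A1 s) (C1 (u s t)) / f2 s t + 2 * (cross2 (A1 s) (B1 t) / f1 s t)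
    + (cross2 (B2 t) (C (u s t) - B t) + H s t * cross2 (B1 t) (C1 (u s t))) / g2 s t
    - (cross2 (B2 t) (A s - B t) / g1 s t
      + 2 * ((cross2 (B1 t) (C (u s t) - A s) + H s t * cross2 (B t - A s) (C1 (u s t))) / D s t))"

text \<open>The equations \<open>E1\<close> and \<open>E2\<close>, obtained from
  \<open>cubes_equal\<close> by logarithmic differentiation in \<open>s\<close> and in
  \<open>t\<close>.\<close>

lemma kappa_log_derivs:
  assumes S: "(s, t) \<in> S"
  shows "(cross2 (A2 s) (C (u s t) - A s) + G s t * cross2 (A1 s) (C1 (u s t))) / f2 s t
      + cross2 (B1 t) (A1 s) / g1 s t + G s t * cross2 (C2 (u s t)) (B t - C (u s t)) / h2 s t
    = cross2 (A2 s) (B t - A s) / f1 s t + G s t * cross2 (B1 t) (C1 (u s t)) / g2 s t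
      + (G s t * cross2 (C2 (u s t)) (A s - C (u s t)) + cross2 (C1 (u s t)) (A1 s)) / h1 s t" (is ?goal_a)
    and "H s t * cross2 (A1 s) (C1 (u s t)) / f2 s t + cross2 (B2 t) (A s - B t) / g1 s t
      + (H s t * cross2 (C2 (u s t)) (B t - C (u s t)) + cross2 (C1 (u s t)) (B1 t)) / h2 s t
    = cross2 (A1 s) (B1 t) / f1 s t
      + (cross2 (B2 t) (C (u s t) - B t) + H s t * cross2 (B1 t) (C1 (u s t))) / g2 s t
      + H s t * cross2 (C2 (u s t)) (A s - C (u s t)) / h1 s t" (is ?goal_b)
proof -
  note ls = log_derivs_s[OF S] and lt = log_derivs_t[OF S] and m = has_log_deriv_mult
  have "\<forall>\<^sub>F s' in nhds s. (f2 s' t * g1 s' t * h2 s' t) ^ 3 = (f1 s' t * g2 s' t * h1 s' t) ^ 3"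
    using open_slices(1)[OF open_S S] by eventually_elim (rule cubes_equal)
  from cubes_log_deriv[OF m[OF m[OF ls(2,3)] ls(6)] m[OF m[OF ls(1,4)] ls(5)] this]
  show ?goal_a
    .
  have "\<forall>\<^sub>F t' in nhds t. (f2 s t' * g1 s t' * h2 s t') ^ 3 = (f1 s t' * g2 s t' * h1 s t') ^ 3"
    using open_slices(2)[OF open_S S] by eventually_elim (rule cubes_equal)
  from cubes_log_deriv[OF m[OF m[OF lt(2,3)] lt(6)] m[OF m[OF lt(1,4)] lt(5)] this]
  show ?goal_b
    .
qed

lemma curvature_relations:
  assumes S: "(s, t) \<in> S"
  shows "3 * cross2 (A1 s) (A2 s)
      = f2 s t * (f1 s t)\<^sup>2 * g2 s t / (g1 s t * (D s t)\<^sup>2) * (1 + \<kappa> s t - 2 * (\<kappa> s t)\<^sup>2)" (is ?goal_a)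
    and "3 * LW s t = - (f2 s t * g1 s t / (f1 s t * D s t)) * (\<kappa> s t + (\<kappa> s t)\<^sup>2 - 8)" (is ?goal_b)
    and "\<kappa> s t = 1 \<Longrightarrow> cross2 (B1 t) (B2 t) = 0"
    and "\<kappa> s t = 1 \<Longrightarrow> cross2 (C1 (u s t)) (C2 (u s t)) = 0"
proof -
  define b where "b = B t - A s"
  define c where "c = C (u s t) - A s"
  have d: "B t - A s = b" "A s - B t = - b" "C (u s t) - A s = c" "A s - C (u s t) = - c"
    "C (u s t) - B t = c - b" "B t - C (u s t) = b - c"
    by (simp_all add: b_def c_def)
  note bd = bracket_defs[of s t, unfolded d]
  have E3: "Gt s t = H s t * (cross2 (B1 t) (A1 s) / g1 s t
    + 2 * ((cross2 (A2 s) (C (u s t) - A s) + G s t * cross2 (A1 s) (C1 (u s t))) / f2 s t)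
    - (G s t * cross2 (C2 (u s t)) (A s - C (u s t)) + cross2 (C1 (u s t)) (A1 s)) / h1 s t
    - 2 * (cross2 (A2 s) (B t - A s) / f1 s t))"
    using DERIV_unique[OF mixed_partials[OF S] H_log_deriv_s[OF S]] .
  note rel = orbit_frame_relations[where ?b = b and ?c = c and ?A1.0 = "A1 s" and ?A2.0 = "A2 s"
      and ?B1.0 = "B1 t" and ?B2.0 = "B2 t" and ?C1.0 = "C1 (u s t)" and ?C2.0 = "C2 (u s t)"
      and ?G = "G s t" and ?H = "H s t" and ?\<kappa> = "\<kappa> s t", folded bd, OF _ _ _ _ _ _ _ G_def H_def
      cubes_equal[OF S] kappa_log_derivs[OF S, unfolded d] E3[unfolded Gt_def d] \<kappa>_def]
  note rel = rel[OF nonzero(7,1-6)[OF S]]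
  show ?goal_a
    by (rule rel)
  show ?goal_b
    unfolding LW_def d by (rule rel)
  show "\<kappa> s t = 1 \<Longrightarrow> cross2 (B1 t) (B2 t) = 0"
    "\<kappa> s t = 1 \<Longrightarrow> cross2 (C1 (u s t)) (C2 (u s t)) = 0"
    by (rule rel; assumption)+
qed

text \<open>In \<open>3 * cross2 (A1 s) (A2 s) = W t * q t\<close> the left-hand side is independent
  of \<open>t\<close>, and \<open>q\<close> has derivative 0, so \<open>W t * LW s t * q t\<close>
  must vanish. For \<kappa> = 1 it does, because \<open>q\<close> is 0; for a primitive cube root
  all three factors are nonzero.\<close>

lemma kappa_eq_1:
  assumes S: "(s, t) \<in> S"
  shows "\<kappa> s t = 1"
proof (rule ccontr)
  assume ne: "\<kappa> s t \<noteq> 1"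
  have "\<kappa> s t ^ 3 = 1"
    using cubes_equal[OF S] nonzero[OF S] by (simp add: \<kappa>_def power_divide)
  then have "(\<kappa> s t - 1) * ((\<kappa> s t)\<^sup>2 + \<kappa> s t + 1) = 0"
    by (simp add: algebra_simps power2_eq_square power3_eq_cube)
  with ne have "(\<kappa> s t)\<^sup>2 + (\<kappa> s t + 1) = 0"
    by (simp add: add.assoc)
  then have sum: "(\<kappa> s t)\<^sup>2 = - (\<kappa> s t + 1)"
    by (rule eq_neg_iff_add_eq_0[THEN iffD2])
  note l = log_derivs_t[OF S]
  define W where "W t = f2 s t * (f1 s t)\<^sup>2 * g2 s t / (g1 s t * (D s t)\<^sup>2)" for t
  define q where "q t = 1 + \<kappa> s t - 2 * (\<kappa> s t)\<^sup>2" for t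
  have W: "has_log_deriv W (LW s t) t"
    unfolding W_def LW_def
    by (intro has_log_deriv_divide has_log_deriv_mult has_log_deriv_power2 l)
  have "has_log_deriv (\<lambda>t. \<kappa> s t) 0 t"
    unfolding \<kappa>_def
    using has_log_deriv_divide[OF has_log_deriv_mult[OF has_log_deriv_mult[OF l(2,3)] l(6)]
        has_log_deriv_mult[OF has_log_deriv_mult[OF l(1,4)] l(5)]] kappa_log_derivs(2)[OF S]
    by simp
  then have k: "((\<lambda>t. \<kappa> s t) has_field_derivative 0) (at t)"
    by (simp add: has_log_deriv_def)
  have q: "(q has_field_derivative 0) (at t)"
    unfolding q_def by (rule derivative_eq_intros k refl)+ simp
  have "((\<lambda>t. W t * q t) has_field_derivative W t * LW s t * q t) (at t)"
    using DERIV_mult[of W "W t * LW s t" t UNIV q 0] W q by (simp add: has_log_deriv_def)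
  moreover have ev: "\<forall>\<^sub>F t' in nhds t. W t' * q t' = 3 * cross2 (A1 s) (A2 s)"
    using open_slices(2)[OF open_S S]
    by eventually_elim (simp add: W_def q_def curvature_relations(1))
  ultimately have "((\<lambda>t. 3 * cross2 (A1 s) (A2 s)) has_field_derivative W t * LW s t * q t) (at t)"
    unfolding DERIV_cong_ev[OF refl ev refl] by blast
  then have "W t * LW s t * q t = 0"
    using DERIV_unique DERIV_const by blast
  moreover have "q t \<noteq> 0"
  proof
    assume "q t = 0"
    moreover have "q t = 3 * (\<kappa> s t + 1)"
      unfolding q_def sum by (simp add: algebra_simps)
    ultimately have "\<kappa> s t + 1 = 0"
      by (metis mult_eq_0_iff zero_neq_numeral)
    with sum have "\<kappa> s t = 0" by simp
    with \<open>\<kappa> s t + 1 = 0\<close> show False by simp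
  qed
  moreover have "3 * LW s t \<noteq> 0"
  proof -
    \<comment> \<open>The sum of \<kappa> and its square is - 1 here, so the last factor becomes -
      9.\<close>
    have "3 * LW s t = - (f2 s t * g1 s t / (f1 s t * D s t)) * (- 9)"
      unfolding curvature_relations(2)[OF S] sum by simp
    then show ?thesis using nonzero[OF S] by simp
  qed
  ultimately show False
    using W by (auto simp: has_log_deriv_def)
qed

text \<open>The tangents are cevians of the triangle. Equality of the two products puts their feet
  on the opposite sides on one line, as in Menelaus' theorem; concurrency would need the opposite
  sign.\<close>

lemma brackets_balanced: "(s, t) \<in> S \<Longrightarrow> f2 s t * g1 s t * h2 s t = f1 s t * g2 s t * h1 s t"
  using kappa_eq_1[of s t] nonzero[of s t] by (simp add: \<kappa>_def)

lemma curvatures_vanish: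
  assumes S: "(s, t) \<in> S"
  shows "cross2 (A1 s) (A2 s) = 0" "cross2 (B1 t) (B2 t) = 0" "cross2 (C1 (u s t)) (C2 (u s t)) = 0"
  using curvature_relations[OF S] kappa_eq_1[OF S] by auto

end

subsection \<open>Projective points and lines in coordinates\<close>

text \<open>In homogeneous coordinates \<open>vprod p q\<close> is the covector of the line through
  two points and, dually, the common point of two lines; \<open>sprod (vprod p q) r\<close> is a
  determinant. The pairing \<open>sprod\<close> is bilinear over \<open>complex\<close> too, not
  Hermitian.\<close>

definition vprod :: "'k::comm_ring ^ 3 \<Rightarrow> 'k ^ 3 \<Rightarrow> 'k ^ 3" where
  "vprod x y = vector [x $ 2 * y $ 3 - x $ 3 * y $ 2, x $ 3 * y $ 1 - x $ 1 * y $ 3,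
    x $ 1 * y $ 2 - x $ 2 * y $ 1]"

definition sprod :: "'k::comm_ring ^ 3 \<Rightarrow> 'k ^ 3 \<Rightarrow> 'k" where
  "sprod x y = x $ 1 * y $ 1 + x $ 2 * y $ 2 + x $ 3 * y $ 3"

text \<open>The point at infinity in the direction \<open>v\<close>.\<close>

definition dir_vec :: "'k::zero ^ 2 \<Rightarrow> 'k ^ 3" where
  "dir_vec v = vector [v $ 1, v $ 2, 0]"

lemma vec3_eq_iff: "x = y \<longleftrightarrow> x $ 1 = y $ 1 \<and> x $ 2 = y $ 2 \<and> x $ 3 = y $ (3 :: 3)"
  by (simp add: vec_eq_iff forall_3)

lemma vprod_nth [simp]:
  "vprod x y $ 1 = x $ 2 * y $ 3 - x $ 3 * y $ 2" "vprod x y $ 2 = x $ 3 * y $ 1 - x $ 1 * y $ 3"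
  "vprod x y $ 3 = x $ 1 * y $ 2 - x $ 2 * y $ 1"
  by (simp_all add: vprod_def)

lemma dir_vec_nth [simp]: "dir_vec v $ 1 = v $ 1" "dir_vec v $ 2 = v $ 2" "dir_vec v $ 3 = 0"
  by (simp_all add: dir_vec_def)

lemma chart_vec_nth [simp]: "chart_vec A $ 1 = A $ 1" "chart_vec A $ 2 = A $ 2" "chart_vec A $ 3 = 1"
  by (simp_all add: chart_vec_def)

lemma mem_span_singleton: "x \<in> vec.span {p} \<longleftrightarrow> (\<exists>a. x = a *s (p :: 'k::field ^ 'n))"
  by (auto simp: vec.span_singleton)

lemma mem_span_pair: "x \<in> vec.span {p, q} \<longleftrightarrow> (\<exists>a b. x = a *s p + b *s (q :: 'k::field ^ 'n))"
proof -
  have "x \<in> vec.span {p, q} \<longleftrightarrow> (\<exists>a b. x - a *s p = b *s q)"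
    by (simp add: vec.span_insert mem_span_singleton)
  also have "\<dots> \<longleftrightarrow> (\<exists>a b. x = a *s p + b *s q)"
    by (simp add: diff_eq_eq add.commute)
  finally show ?thesis .
qed

lemma span_singleton_scale: "k \<noteq> 0 \<Longrightarrow> vec.span {k *s v} = vec.span {v :: 'k::field ^ 'n}"
proof safe
  fix x assume k: "k \<noteq> 0"
  show "x \<in> vec.span {k *s v} \<Longrightarrow> x \<in> vec.span {v}"
    by (auto simp: mem_span_singleton vector_smult_assoc)
  assume "x \<in> vec.span {v}"
  then obtain a where "x = a *s v" by (auto simp: mem_span_singleton)
  then have "x = (a / k) *s (k *s v)" using k by (simp add: vector_smult_assoc)
  then show "x \<in> vec.span {k *s v}" unfolding mem_span_singleton by blast
qed

lemma vprod_swap: "sprod (vprod p q) r = sprod (vprod q r) (p :: 'k::comm_ring ^ 3)"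
  by (simp add: sprod_def algebra_simps)

text \<open>When the determinant vanishes, the coefficients of \<open>x\<close> come from Cramer's
  rule in two coordinates in which \<open>p\<close> and \<open>q\<close> have a nonzero
  minor.\<close>

lemma mem_span_pair_iff:
  fixes p q x :: "'k::field ^ 3"
  assumes "vprod p q \<noteq> 0"
  shows "x \<in> vec.span {p, q} \<longleftrightarrow> sprod (vprod p q) x = 0"
proof
  assume "x \<in> vec.span {p, q}"
  then show "sprod (vprod p q) x = 0"
    by (auto simp: mem_span_pair sprod_def algebra_simps)
next
  assume eq: "sprod (vprod p q) x = 0"
  define m1 where "m1 = vprod p q $ 1"
  define m2 where "m2 = vprod p q $ 2"
  define m3 where "m3 = vprod p q $ 3"
  have eq': "m1 * x $ 1 + m2 * x $ 2 + m3 * x $ 3 = 0"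
    using eq by (simp only: sprod_def m1_def m2_def m3_def)
  have id: "m1 * p $ 1 + m2 * p $ 2 + m3 * p $ 3 = 0" "m1 * q $ 1 + m2 * q $ 2 + m3 * q $ 3 = 0"
    by (simp_all add: m1_def m2_def m3_def algebra_simps)
  consider "m1 \<noteq> 0" | "m2 \<noteq> 0" | "m3 \<noteq> 0"
    using assms by (auto simp: vec3_eq_iff m1_def m2_def m3_def simp del: vprod_nth)
  then have "\<exists>m a b. m \<noteq> 0 \<and> m *s x = a *s p + b *s q"
  proof cases
    case 1
    have "m1 *s x = (x $ 2 * q $ 3 - x $ 3 * q $ 2) *s p + (p $ 2 * x $ 3 - p $ 3 * x $ 2) *s q"
      using eq' by (simp add: vec3_eq_iff m1_def m2_def m3_def) algebra
    then show ?thesis using 1 by blast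
  next
    case 2
    have "m2 *s x = (x $ 3 * q $ 1 - x $ 1 * q $ 3) *s p + (p $ 3 * x $ 1 - p $ 1 * x $ 3) *s q"
      using eq' by (simp add: vec3_eq_iff m1_def m2_def m3_def) algebra
    then show ?thesis using 2 by blast
  next
    case 3
    have "m3 *s x = (x $ 1 * q $ 2 - x $ 2 * q $ 1) *s p + (p $ 1 * x $ 2 - p $ 2 * x $ 1) *s q"
      using eq' by (simp add: vec3_eq_iff m1_def m2_def m3_def) algebra
    then show ?thesis using 3 by blast
  qed
  then obtain m a b where m: "m \<noteq> 0" "m *s x = a *s p + b *s q" by blast
  have "x = (1 / m) *s (m *s x)" using m(1) by (simp add: vector_smult_assoc)
  also have "\<dots> = (a / m) *s p + (b / m) *s q"
    unfolding m(2) by (simp add: vec_eq_iff add_divide_distrib)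
  finally show "x \<in> vec.span {p, q}" by (auto simp: mem_span_pair)
qed

lemma vprod_parallel:
  fixes p q :: "'k::field ^ 3"
  assumes "vprod p q = 0" "p \<noteq> 0"
  obtains k where "q = k *s p"
proof -
  have e: "p $ 2 * q $ 3 = p $ 3 * q $ 2" "p $ 3 * q $ 1 = p $ 1 * q $ 3" "p $ 1 * q $ 2 = p $ 2 * q $ 1"
    using assms(1) by (simp_all add: vec3_eq_iff)
  consider "p $ 1 \<noteq> 0" | "p $ 2 \<noteq> 0" | "p $ 3 \<noteq> 0"
    using assms(2) by (auto simp: vec3_eq_iff)
  then show thesis
  proof cases
    case 1
    with e show thesis by (intro that[of "q $ 1 / p $ 1"]) (simp add: vec3_eq_iff field_simps)
  next
    case 2
    with e show thesis by (intro that[of "q $ 2 / p $ 2"]) (simp add: vec3_eq_iff field_simps)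
  next
    case 3
    with e show thesis by (intro that[of "q $ 3 / p $ 3"]) (simp add: vec3_eq_iff field_simps)
  qed
qed

lemma independent_pair:
  fixes p q :: "'k::field ^ 3"
  assumes "vprod p q \<noteq> 0"
  shows "vec.independent {p, q}" "card {p, q} = 2"
proof -
  have "p \<noteq> q" "q \<noteq> 0" "p \<notin> vec.span {q}"
    using assms by (auto simp: mem_span_singleton vec3_eq_iff algebra_simps)
  then show "vec.independent {p, q}" "card {p, q} = 2"
    by (auto simp: vec.independent_insert)
qed

lemma proj_line_span_pair: "vprod p q \<noteq> 0 \<Longrightarrow> proj_line (vec.span {p, q})"
  unfolding proj_line_def
  using independent_pair[of p q] by (simp add: vec.dim_eq_card_independent)

lemma proj_point_span_singleton: "p \<noteq> 0 \<Longrightarrow> proj_point (vec.span {p})"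
  unfolding proj_point_def
  using vec.dim_span_eq_card_independent[of "{p}"] by (simp add: vec.independent_insert)

lemma proj_pointE:
  assumes "proj_point P"
  obtains p where "p \<noteq> 0" "P = vec.span {p}"
proof -
  obtain B where B: "B \<subseteq> P" "vec.independent B" "P \<subseteq> vec.span B" "card B = 1"
    using vec.basis_exists[of P] assms unfolding proj_point_def by metis
  then obtain p where "B = {p}" by (auto simp: card_1_singleton_iff)
  moreover have "vec.span B = P"
    using B assms by (simp add: proj_point_def vec.span_subspace)
  ultimately show thesis using B(2) that[of p] by (auto simp: vec.independent_insert)
qed

lemma span_singleton_subset_iff: "vec.subspace l \<Longrightarrow> vec.span {p} \<subseteq> l \<longleftrightarrow> p \<in> l"
  by (metis empty_subsetI insert_subset vec.span_base vec.span_minimal singletonI subsetD)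

lemma proj_join_span: "proj_join (vec.span {p}) (vec.span {q}) = vec.span {p, q}"
proof -
  have "vec.span (vec.span {p} \<union> vec.span {q}) = vec.span ({p} \<union> {q})"
    by (simp only: vec.span_Un vec.span_span)
  then show ?thesis by (simp add: proj_join_def insert_commute)
qed

text \<open>The vectors \<open>q\<close> and \<open>r\<close> may be zero or proportional to
  \<open>p\<close>; an auxiliary vector then spans a common line with \<open>p\<close>. Conversely,
  a nonzero determinant gives three independent vectors, too many for a space of dimension
  2.\<close>

lemma non_collinear_iff:
  fixes p q r :: "'k::field ^ 3"
  assumes "p \<noteq> 0"
  shows "non_collinear (vec.span {p}) (vec.span {q}) (vec.span {r}) \<longleftrightarrow> sprod (vprod p q) r \<noteq> 0"
proof
  assume nc: "non_collinear (vec.span {p}) (vec.span {q}) (vec.span {r})"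
  show "sprod (vprod p q) r \<noteq> 0"
  proof
    assume zero: "sprod (vprod p q) r = 0"
    have "\<exists>v w. vprod v w \<noteq> 0 \<and> p \<in> vec.span {v, w} \<and> q \<in> vec.span {v, w} \<and> r \<in> vec.span {v, w}"
    proof (cases "vprod p q = 0")
      case False
      moreover have "p \<in> vec.span {p, q}" "q \<in> vec.span {p, q}" by (simp_all add: vec.span_base)
      ultimately show ?thesis using zero mem_span_pair_iff[OF False] by blast
    next
      case True
      then obtain k where k: "q = k *s p" using vprod_parallel assms by blast
      obtain e where e: "vprod p e \<noteq> 0" "r \<in> vec.span {p, e}"
      proof (cases "vprod p r = 0")
        case False
        then show ?thesis using that[of r] by (simp add: vec.span_base)
      next
        case True
        then obtain k' where k': "r = k' *s p" using vprod_parallel assms by blast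
        have "\<exists>e. vprod p e \<noteq> 0"
        proof (rule ccontr)
          assume "\<not> ?thesis"
          then have "vprod p (vector [1, 0, 0]) = 0" "vprod p (vector [0, 1, 0]) = 0" by blast+
          then show False using assms by (simp add: vec3_eq_iff)
        qed
        then obtain e where "vprod p e \<noteq> 0" ..
        with k' show ?thesis using that[of e] by (auto simp: vec.span_base vec.span_scale)
      qed
      have "p \<in> vec.span {p, e}" by (simp add: vec.span_base)
      with k have "q \<in> vec.span {p, e}" by (simp add: vec.span_scale)
      with e \<open>p \<in> vec.span {p, e}\<close> show ?thesis by blast
    qed
    then show False
      using nc unfolding non_collinear_def
      by (metis proj_line_span_pair span_singleton_subset_iff vec.subspace_span)
  qed
next
  assume nz: "sprod (vprod p q) r \<noteq> 0"
  show "non_collinear (vec.span {p}) (vec.span {q}) (vec.span {r})"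
    unfolding non_collinear_def
  proof safe
    fix l assume l: "proj_line l" "vec.span {p} \<subseteq> l" "vec.span {q} \<subseteq> l" "vec.span {r} \<subseteq> l"
    then have sub: "{r, p, q} \<subseteq> l"
      by (auto simp: proj_line_def span_singleton_subset_iff)
    have pq: "vprod p q \<noteq> 0" using nz by (auto simp: sprod_def simp del: vprod_nth)
    have r: "r \<notin> vec.span {p, q}" using nz mem_span_pair_iff[OF pq] by blast
    then have "r \<notin> {p, q}" by (meson vec.span_base)
    then have "card {r, p, q} = 3" "vec.independent {r, p, q}"
      using independent_pair[OF pq] r by (auto simp: vec.independent_insert)
    then show False
      using vec.independent_card_le_dim[OF sub] l(1) by (simp add: proj_line_def)
  qed
qed

section \<open>Affine lines and their projective closures\<close>

lemma mem_line_dir_iff: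
  fixes A v X :: "'k::field ^ 2"
  assumes "v \<noteq> 0"
  shows "X \<in> line_dir A v \<longleftrightarrow> cross2 v (X - A) = 0"
proof
  assume "cross2 v (X - A) = 0"
  then obtain c where "X - A = c *s v" using cross2_parallel assms by blast
  then have "X = A + c *s v" by (simp add: algebra_simps)
  then show "X \<in> line_dir A v" by (auto simp: line_dir_def)
qed (auto simp: line_dir_def cross2_simps)

lemma line_dir_eq_iff:
  fixes A v w :: "'k::field ^ 2"
  assumes "v \<noteq> 0" "w \<noteq> 0"
  shows "line_dir A v = line_dir A w \<longleftrightarrow> cross2 v w = 0"
proof
  assume "line_dir A v = line_dir A w"
  moreover have "A + w \<in> line_dir A w" by (simp add: mem_line_dir_iff assms cross2_simps)
  ultimately have "A + w \<in> line_dir A v" by simp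
  then show "cross2 v w = 0" by (simp add: mem_line_dir_iff assms)
next
  assume "cross2 v w = 0"
  then obtain c where c: "w = c *s v" using cross2_parallel assms by blast
  with assms have "c \<noteq> 0" by auto
  then show "line_dir A v = line_dir A w"
    by (auto simp: mem_line_dir_iff assms c cross2_simps)
qed

text \<open>An incoming side is written as the join from the previous vertex; here it is re-anchored
  at the vertex of reflection, so that all lines there are compared by their directions.\<close>

lemma join_eq_line_dir:
  fixes A B :: "'k::field ^ 2"
  assumes "A \<noteq> B"
  shows "join B A = line_dir A (B - A)"
proof -
  have "cross2 (A - B) (X - B) = - cross2 (B - A) (X - A)" for X
    by (simp add: cross2_def algebra_simps)
  moreover have "B - A \<noteq> 0" "A - B \<noteq> 0" using assms by auto
  ultimately show ?thesis
    by (auto simp: join_def mem_line_dir_iff)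
qed

lemma chart_line_line_dir: "chart_line (line_dir A v) = vec.span {chart_vec A, dir_vec (v :: 'k::field ^ 2)}"
proof
  have "chart_vec (A + t *s v) = chart_vec A + t *s dir_vec v" for t
    by (simp add: vec3_eq_iff)
  then have "chart_vec ` line_dir A v \<subseteq> vec.span {chart_vec A, dir_vec v}"
    by (auto simp: line_dir_def vec.span_base vec.span_add vec.span_scale)
  then show "chart_line (line_dir A v) \<subseteq> vec.span {chart_vec A, dir_vec v}"
    unfolding chart_line_def by (simp add: vec.span_minimal)
  have "A \<in> line_dir A v" "A + v \<in> line_dir A v"
    unfolding line_dir_def using rangeI[of "\<lambda>t. A + t *s v" 0] rangeI[of "\<lambda>t. A + t *s v" 1] by auto
  then have "chart_vec A \<in> chart_line (line_dir A v)" "chart_vec (A + v) \<in> chart_line (line_dir A v)"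
    unfolding chart_line_def by (simp_all add: vec.span_base)
  moreover have "dir_vec v = chart_vec (A + v) - chart_vec A"
    by (simp add: vec3_eq_iff)
  ultimately have "{chart_vec A, dir_vec v} \<subseteq> chart_line (line_dir A v)"
    unfolding chart_line_def by (simp add: vec.span_diff)
  then show "vec.span {chart_vec A, dir_vec v} \<subseteq> chart_line (line_dir A v)"
    unfolding chart_line_def by (simp add: vec.span_minimal)
qed

subsection \<open>Harmonic lines\<close>

lemma linear_image_span_singleton:
  assumes "Vector_Spaces.linear (*s) (*s) (h :: 'k::field ^ 'n \<Rightarrow> 'k ^ 'm)"
  shows "h ` vec.span {v} = vec.span {h v}"
proof -
  interpret h: Vector_Spaces.linear "(*s)" "(*s)" h by fact
  show ?thesis
    by (auto simp: mem_span_singleton h.scale) (metis h.scale imageI mem_span_singleton)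
qed

text \<open>The cross-ratio map lets one choose representatives \<open>x1, \<dots>, x4\<close> of the four points with
  \<open>x2 = x3 + x4\<close> and \<open>x1 = x3 - x4\<close>.\<close>

lemma harmonic_imp_mirror_equation:
  fixes b c n t A :: "'k::field_char_0 ^ 2"
  assumes cr: "lines_cross_ratio A (line_dir A n) (line_dir A t) (line_dir A b) (line_dir A c) (- 1)"
    and bc: "cross2 b c \<noteq> 0"
  shows "cross2 t b * cross2 n c + cross2 t c * cross2 n b = 0"
proof -
  let ?E = "chart_vec A"
  obtain m where m: "proj_line m" "\<not> chart_point A \<subseteq> m"
    and pcr: "points_cross_ratio m (vec.span {?E, dir_vec n} \<inter> m) (vec.span {?E, dir_vec t} \<inter> m)
      (vec.span {?E, dir_vec b} \<inter> m) (vec.span {?E, dir_vec c} \<inter> m) (- 1)"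
    using cr unfolding lines_cross_ratio_def chart_line_line_dir by (elim exE conjE)
  from pcr obtain h where h: "Vector_Spaces.linear (*s) (*s) (h :: 'k ^ 3 \<Rightarrow> 'k ^ 2)" and inj: "inj_on h m"
    and h1: "h ` (vec.span {?E, dir_vec n} \<inter> m) = vec.span {vector [- 1, 1]}"
    and h2: "h ` (vec.span {?E, dir_vec t} \<inter> m) = vec.span {vector [1, 1]}"
    and h3: "h ` (vec.span {?E, dir_vec b} \<inter> m) = vec.span {vector [0, 1]}"
    and h4: "h ` (vec.span {?E, dir_vec c} \<inter> m) = vec.span {vector [1, 0]}"
    unfolding points_cross_ratio_def by (elim exE conjE)
  interpret h: Vector_Spaces.linear "(*s)" "(*s)" h by fact
  have sub: "vec.subspace m" using m(1) by (simp add: proj_line_def)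
  have E: "?E \<notin> m" using m(2) sub by (simp add: chart_point_def span_singleton_subset_iff)
  have ex: "\<exists>x. x \<in> vec.span {?E, dir_vec v} \<and> x \<in> m \<and> h x = w"
    if "h ` (vec.span {?E, dir_vec v} \<inter> m) = vec.span {w}" for v w
  proof -
    have "w \<in> h ` (vec.span {?E, dir_vec v} \<inter> m)"
      unfolding that by (simp add: vec.span_base)
    then show ?thesis by blast
  qed
  obtain x1 where x1: "x1 \<in> vec.span {?E, dir_vec n}" "x1 \<in> m" "h x1 = vector [- 1, 1]"
    using ex[OF h1] by blast
  obtain x2 where x2: "x2 \<in> vec.span {?E, dir_vec t}" "x2 \<in> m" "h x2 = vector [1, 1]"
    using ex[OF h2] by blast
  obtain x3 where x3: "x3 \<in> vec.span {?E, dir_vec b}" "x3 \<in> m" "h x3 = vector [0, 1]"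
    using ex[OF h3] by blast
  obtain x4 where x4: "x4 \<in> vec.span {?E, dir_vec c}" "x4 \<in> m" "h x4 = vector [1, 0]"
    using ex[OF h4] by blast
  have "h (x3 + x4) = h x2" "h (x3 - x4) = h x1"
    by (simp_all add: h.add h.diff x1 x2 x3 x4 vec2_eq_iff)
  moreover have "x3 + x4 \<in> m" "x3 - x4 \<in> m"
    using sub x3 x4 by (simp_all add: vec.subspace_add vec.subspace_diff)
  ultimately have sum: "x2 = x3 + x4" "x1 = x3 - x4"
    using inj x1 x2 by (auto simp: inj_on_def)
  obtain k1 \<nu> where y1: "x1 = k1 *s ?E + \<nu> *s dir_vec n" using x1(1) by (auto simp: mem_span_pair)
  obtain k2 \<mu> where y2: "x2 = k2 *s ?E + \<mu> *s dir_vec t" using x2(1) by (auto simp: mem_span_pair)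
  obtain k3 \<beta> where y3: "x3 = k3 *s ?E + \<beta> *s dir_vec b" using x3(1) by (auto simp: mem_span_pair)
  obtain k4 \<gamma> where y4: "x4 = k4 *s ?E + \<gamma> *s dir_vec c" using x4(1) by (auto simp: mem_span_pair)
  \<comment> \<open>Otherwise \<open>x3\<close> would be a multiple of \<open>?E\<close>, whereas
    \<open>m\<close> does not pass through \<open>A\<close>.\<close>
  have "\<beta> \<noteq> 0"
  proof
    assume "\<beta> = 0"
    then have x3': "x3 = k3 *s ?E" using y3 by simp
    then have "k3 \<noteq> 0" using x3(3) h.zero by (auto simp: vec2_eq_iff)
    then have "?E = (1 / k3) *s x3" using x3' by (simp add: vector_smult_assoc)
    then show False using E sub x3(2) by (metis vec.subspace_scale)
  qed
  have k: "k2 = k3 + k4" "k1 = k3 - k4"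
    using sum unfolding y1 y2 y3 y4 by (simp_all add: vec3_eq_iff)
  have t: "\<mu> *s t = \<beta> *s b + \<gamma> *s c" and n: "\<nu> *s n = \<beta> *s b - \<gamma> *s c"
    using sum unfolding y1 y2 y3 y4 k by (auto simp: vec3_eq_iff vec2_eq_iff algebra_simps)
  have cb: "cross2 c b = - cross2 b c" by (rule cross2_commute)
  have "\<mu> \<noteq> 0"
  proof
    assume "\<mu> = 0"
    then have "\<beta> *s b + \<gamma> *s c = 0" using t by simp
    then have "cross2 (\<beta> *s b + \<gamma> *s c) c = 0" by (simp add: cross2_simps)
    then show False using bc \<open>\<beta> \<noteq> 0\<close> by (simp add: cross2_simps)
  qed
  have "\<nu> \<noteq> 0"
  proof
    assume "\<nu> = 0"
    then have "\<beta> *s b - \<gamma> *s c = 0" using n by simp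
    then have "cross2 (\<beta> *s b - \<gamma> *s c) c = 0" by (simp add: cross2_simps)
    then show False using bc \<open>\<beta> \<noteq> 0\<close> by (simp add: cross2_simps)
  qed
  \<comment> \<open>The factors \<mu> and \<nu> allow \<open>t\<close> and \<open>n\<close> to be
    replaced by their expansions in \<open>b\<close> and \<open>c\<close>, for which the two
    products cancel.\<close>
  have "\<mu> * \<nu> * (cross2 t b * cross2 n c + cross2 t c * cross2 n b)
    = cross2 (\<mu> *s t) b * cross2 (\<nu> *s n) c + cross2 (\<mu> *s t) c * cross2 (\<nu> *s n) b"
    by (simp add: cross2_simps algebra_simps)
  also have "\<dots> = 0"
    unfolding t n by (simp add: cross2_simps cb)
  finally show ?thesis using \<open>\<mu> \<noteq> 0\<close> \<open>\<nu> \<noteq> 0\<close> by simp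
qed

text \<open>The lines are cut by the line at infinity, where they become their direction vectors.
  The map \<open>h\<close> takes coordinates in the frame \<open>c\<close>, \<open>b\<close>, scaled
  so that \<open>t\<close> goes to \<open>[1, 1]\<close>; the mirror equation then says that
  \<open>n\<close> goes to a multiple of \<open>[- 1, 1]\<close>.\<close>

lemma mirror_equation_imp_harmonic:
  fixes b c n t A :: "'k::field_char_0 ^ 2"
  assumes eq: "cross2 t b * cross2 n c + cross2 t c * cross2 n b = 0"
    and nz: "cross2 b c \<noteq> 0" "cross2 t b \<noteq> 0" "cross2 t c \<noteq> 0" "cross2 n b \<noteq> 0"
  shows "lines_cross_ratio A (line_dir A n) (line_dir A t) (line_dir A b) (line_dir A c) (- 1)"
proof -
  define m :: "('k ^ 3) set" where "m = vec.span {vector [1, 0, 0], vector [0, 1, 0]}"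
  have pm: "vprod (vector [1, 0, 0]) (vector [0, 1, 0]) \<noteq> (0 :: 'k ^ 3)"
    by (simp add: vec3_eq_iff)
  have m_iff: "z \<in> m \<longleftrightarrow> z $ 3 = 0" for z
    unfolding m_def mem_span_pair_iff[OF pm] by (simp add: sprod_def)
  have pl: "proj_line m" unfolding m_def by (rule proj_line_span_pair[OF pm])
  have off: "\<not> chart_point A \<subseteq> m"
    unfolding chart_point_def using vec.span_base[of "chart_vec A" "{chart_vec A}"] m_iff[of "chart_vec A"]
    by auto
  have int: "chart_line (line_dir A v) \<inter> m = vec.span {dir_vec v}" for v
  proof -
    have zz: "z \<in> vec.span {chart_vec A, dir_vec v} \<and> z $ 3 = 0 \<longleftrightarrow> z \<in> vec.span {dir_vec v}" for z
    proof
      assume "z \<in> vec.span {chart_vec A, dir_vec v} \<and> z $ 3 = 0"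
      then obtain k l where z: "z = k *s chart_vec A + l *s dir_vec v" and "z $ 3 = 0"
        unfolding mem_span_pair by blast
      then have "k = 0" by simp
      with z show "z \<in> vec.span {dir_vec v}" unfolding mem_span_singleton by auto
    next
      assume "z \<in> vec.span {dir_vec v}"
      then obtain l where "z = l *s dir_vec v"
        unfolding mem_span_singleton by blast
      then have "z = 0 *s chart_vec A + l *s dir_vec v" "z $ 3 = 0" by simp_all
      then show "z \<in> vec.span {chart_vec A, dir_vec v} \<and> z $ 3 = 0"
        unfolding mem_span_pair by blast
    qed
    show ?thesis
      by (intro set_eqI) (simp only: chart_line_line_dir Int_iff m_iff zz)
  qed
  define p :: "'k ^ 3 \<Rightarrow> 'k ^ 2" where "p z = vector [z $ 1, z $ 2]" for z
  define h :: "'k ^ 3 \<Rightarrow> 'k ^ 2"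
    where "h z = vector [cross2 b (p z) / cross2 b t, cross2 (p z) c / cross2 t c]" for z
  have bt: "cross2 b t \<noteq> 0" using nz(2) cross2_commute[of b t] by simp
  have lin: "Vector_Spaces.linear (*s) (*s) h"
    by unfold_locales
      (simp_all add: h_def p_def vec2_eq_iff cross2_def algebra_simps add_divide_distrib diff_divide_distrib)
  have inj: "inj_on h m"
  proof (rule inj_onI)
    fix x y assume xy: "x \<in> m" "y \<in> m" "h x = h y"
    then have e: "cross2 b (p x) = cross2 b (p y)" "cross2 (p x) c = cross2 (p y) c"
      using nz bt by (simp_all add: h_def vec2_eq_iff)
    have "p x = p y"
      by (subst (1 2) cross2_expand[OF nz(1)]) (simp add: e)
    then show "x = y" using xy by (simp add: p_def m_iff vec2_eq_iff vec3_eq_iff)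
  qed
  have pd: "p (dir_vec v) = v" for v by (simp add: p_def vec2_eq_iff)
  have "h (dir_vec n) = (cross2 n c / cross2 t c) *s vector [- 1, 1]"
  proof -
    have "cross2 b n / cross2 b t = - (cross2 n c / cross2 t c)"
      using eq nz bt by (simp add: cross2_commute[of b n] cross2_commute[of b t] field_simps eq_neg_iff_add_eq_0)
    then show ?thesis by (simp add: h_def pd vec2_eq_iff)
  qed
  moreover have "h (dir_vec t) = vector [1, 1]"
    using nz bt by (simp add: h_def pd vec2_eq_iff)
  moreover have "h (dir_vec b) = (cross2 b c / cross2 t c) *s vector [0, 1]"
    by (simp add: h_def pd vec2_eq_iff cross2_simps)
  moreover have "h (dir_vec c) = (cross2 b c / cross2 b t) *s vector [1, 0]"
    by (simp add: h_def pd vec2_eq_iff cross2_simps)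
  moreover have "cross2 n c \<noteq> 0" using eq nz by auto
  ultimately have pcr: "points_cross_ratio m (vec.span {dir_vec n}) (vec.span {dir_vec t})
      (vec.span {dir_vec b}) (vec.span {dir_vec c}) (- 1)"
    unfolding points_cross_ratio_def using lin inj nz bt
    by (intro exI[of _ h]) (simp add: linear_image_span_singleton span_singleton_scale)
  show ?thesis
    unfolding lines_cross_ratio_def by (rule exI[of _ m]) (simp only: pl off pcr int simp_thms)
qed

text \<open>The polynomial form of the reflection law. Nonvanishing of the \<open>T\<close>-brackets
  excludes tangent sides and, at the same time, coinciding vertices.\<close>

definition mirror :: "'k::field ^ 2 \<Rightarrow> 'k ^ 2 \<Rightarrow> 'k ^ 2 \<Rightarrow> 'k ^ 2 \<Rightarrow> 'k ^ 2 \<Rightarrow> bool" where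
  "mirror A T N B C \<longleftrightarrow> cross2 T (B - A) \<noteq> 0 \<and> cross2 T (C - A) \<noteq> 0 \<and>
    cross2 T (B - A) * cross2 N (C - A) + cross2 T (C - A) * cross2 N (B - A) = 0"

lemma mirror_commute: "mirror A T N B C \<longleftrightarrow> mirror A T N C B"
  by (auto simp: mirror_def add.commute)

text \<open>The equation includes the alternative \<open>l = l' = L\<close>, where both
  \<open>N\<close>-brackets vanish. If exactly one side lies on \<open>L\<close>, or if the sides
  coincide away from \<open>L\<close>, both conditions fail, the latter because 2 is nonzero. In the
  remaining case without tangent sides the four lines are distinct and the cross-ratio
  decides.\<close>

lemma mirror_iff_symmetric:
  fixes A T N B C :: "'k::field_char_0 ^ 2"
  assumes TN: "cross2 T N \<noteq> 0"
  shows "A \<noteq> B \<and> A \<noteq> C \<and> join B A \<noteq> line_dir A T \<and> join A C \<noteq> line_dir A T \<and>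
      symmetric_lines A (line_dir A N) (line_dir A T) (join B A) (join A C) \<longleftrightarrow> mirror A T N B C"
proof (cases "A = B \<or> A = C")
  case True
  then show ?thesis by (auto simp: mirror_def cross2_simps)
next
  case False
  define b where "b = B - A"
  define c where "c = C - A"
  have nz: "b \<noteq> 0" "c \<noteq> 0" "T \<noteq> 0" "N \<noteq> 0"
    using False TN by (auto simp: b_def c_def cross2_simps)
  have j: "join B A = line_dir A b" "join A C = line_dir A c"
    using False join_eq_line_dir[of A B] by (simp_all add: b_def c_def join_def)
  have eqs: "line_dir A v = line_dir A w \<longleftrightarrow> cross2 v w = 0" if "v \<in> {b, c, T, N}" "w \<in> {b, c, T, N}" for v w
    using that nz line_dir_eq_iff[of v w A] by auto
  show ?thesis
  proof (cases "cross2 T b = 0 \<or> cross2 T c = 0")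
    case True
    then have "join B A = line_dir A T \<or> join A C = line_dir A T"
      unfolding j using eqs[of b T] eqs[of c T] cross2_commute[of b T] cross2_commute[of c T] by auto
    then show ?thesis using True by (auto simp: mirror_def b_def c_def)
  next
    case F: False
    then have jT: "join B A \<noteq> line_dir A T" "join A C \<noteq> line_dir A T"
      unfolding j using eqs[of b T] eqs[of c T] cross2_commute[of b T] cross2_commute[of c T] by auto
    have "symmetric_lines A (line_dir A N) (line_dir A T) (line_dir A b) (line_dir A c) \<longleftrightarrow>
      cross2 T b * cross2 N c + cross2 T c * cross2 N b = 0"
    proof (cases "cross2 N b = 0 \<and> cross2 N c = 0")
      case True
      then show ?thesis
        unfolding symmetric_lines_def using eqs[of N b] eqs[of N c] by auto
    next
      case N: False
      show ?thesis
      proof (cases "cross2 N b = 0 \<or> cross2 N c = 0 \<or> cross2 b c = 0")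
        case True
        have "\<not> symmetric_lines A (line_dir A N) (line_dir A T) (line_dir A b) (line_dir A c)"
          using True N jT eqs[of N b] eqs[of N c] eqs[of b c] unfolding symmetric_lines_def j by auto
        moreover have "cross2 T b * cross2 N c + cross2 T c * cross2 N b \<noteq> 0"
        proof (cases "cross2 b c = 0")
          case True
          then obtain k where k: "c = k *s b" using cross2_parallel nz by blast
          then show ?thesis using F N by (auto simp: cross2_simps)
        next
          case False
          then show ?thesis using True F N by auto
        qed
        ultimately show ?thesis by blast
      next
        case G: False
        have ne: "line_dir A b \<noteq> line_dir A N" "line_dir A b \<noteq> line_dir A T"
          using G jT eqs[of N b] unfolding j by auto
        have "distinct [line_dir A N, line_dir A T, line_dir A b, line_dir A c]"
          using F G TN eqs[of N T] eqs[of N b] eqs[of N c] eqs[of T b] eqs[of T c] eqs[of b c]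
            cross2_commute[of N T] by simp
        with ne have "symmetric_lines A (line_dir A N) (line_dir A T) (line_dir A b) (line_dir A c) \<longleftrightarrow>
            lines_cross_ratio A (line_dir A N) (line_dir A T) (line_dir A b) (line_dir A c) (- 1)"
          unfolding symmetric_lines_def by blast
        also have "\<dots> \<longleftrightarrow> cross2 T b * cross2 N c + cross2 T c * cross2 N b = 0"
          using harmonic_imp_mirror_equation mirror_equation_imp_harmonic F G by blast
        finally show ?thesis .
      qed
    qed
    moreover have "mirror A T N B C \<longleftrightarrow> cross2 T b * cross2 N c + cross2 T c * cross2 N b = 0"
      using F by (simp add: mirror_def b_def c_def)
    ultimately show ?thesis
      using False jT unfolding j by blast
  qed
qed

subsection \<open>Local charts of line-framed curves\<close>

lemma isCont_eventually:
  assumes "isCont f x" "\<forall>\<^sub>F y in nhds (f x). P y"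
  shows "\<forall>\<^sub>F s in nhds x. P (f s)"
proof -
  have "filterlim f (nhds (f x)) (nhds x)"
    using assms(1) by (simp only: isCont_def tendsto_at_iff_tendsto_nhds)
  then show ?thesis using assms(2) by (simp add: filterlim_iff)
qed

lemma has_vd_velocity: "has_vd f f' x \<Longrightarrow> velocity f x = f'"
  by (auto simp: velocity_def has_vd_def vec_eq_iff intro: DERIV_imp_deriv)

lemma has_vd_unique: "has_vd f f' x \<Longrightarrow> has_vd f f'' x \<Longrightarrow> f' = f''"
  by (auto dest!: has_vd_velocity)

lemma has_vd_cong_ev:
  assumes "\<forall>\<^sub>F y in nhds x. f y = g y" "has_vd f f' x"
  shows "has_vd g f' x"
  unfolding has_vd_def
proof
  fix i
  have ev: "\<forall>\<^sub>F y in nhds x. f y $ i = g y $ i"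
    using assms(1) by eventually_elim simp
  then show "((\<lambda>s. g s $ i) has_field_derivative f' $ i) (at x)"
    using assms(2) unfolding DERIV_cong_ev[OF refl ev refl, symmetric] has_vd_def by blast
qed

lemma has_vd_componentD: "has_vd f f' x \<Longrightarrow> ((\<lambda>s. f s $ i) has_field_derivative f' $ i) (at x)"
  by (simp add: has_vd_def)

text \<open>Formal differentiation does not shrink the radius of convergence, so on one ball the
  derivatives are the sums of the formal ones. The curvature computation needs two of them and the
  continuity of the second.\<close>

lemma fps_expansion_smooth:
  fixes f :: "'k::{real_normed_field,banach} \<Rightarrow> 'k"
  assumes "(\<lambda>h. f (t + h)) has_fps_expansion F"
  shows "\<exists>r>0. \<forall>s\<in>ball t r. (f has_field_derivative eval_fps (fps_deriv F) (s - t)) (at s) \<and>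
    ((\<lambda>s. eval_fps (fps_deriv F) (s - t)) has_field_derivative eval_fps (fps_deriv (fps_deriv F)) (s - t)) (at s) \<and>
    isCont (\<lambda>s. eval_fps (fps_deriv (fps_deriv F)) (s - t)) s"
proof -
  have R: "fps_conv_radius F > 0" and ev: "\<forall>\<^sub>F h in nhds 0. eval_fps F h = f (t + h)"
    using assms by (simp_all add: has_fps_expansion_def)
  obtain r1 where r1: "r1 > 0" "\<And>h. norm h < r1 \<Longrightarrow> eval_fps F h = f (t + h)"
    using ev unfolding eventually_nhds_metric by (auto simp: dist_norm)
  obtain r2 where r2: "r2 > 0" "ereal r2 < fps_conv_radius F"
    using R ereal_dense2[of 0 "fps_conv_radius F"] by (auto simp: zero_ereal_def)
  define r where "r = min r1 r2"
  have R1: "fps_conv_radius (fps_deriv F) \<ge> fps_conv_radius F"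
    by (rule fps_conv_radius_deriv)
  have R2: "fps_conv_radius (fps_deriv (fps_deriv F)) \<ge> fps_conv_radius F"
    using R1 fps_conv_radius_deriv[of "fps_deriv F"] by (rule order_trans)
  have R3: "fps_conv_radius (fps_deriv (fps_deriv (fps_deriv F))) \<ge> fps_conv_radius F"
    using R2 fps_conv_radius_deriv[of "fps_deriv (fps_deriv F)"] by (rule order_trans)
  show ?thesis
  proof (intro exI[of _ r] conjI ballI)
    show "r > 0" using r1 r2 by (simp add: r_def)
    fix s assume s: "s \<in> ball t r"
    then have n: "norm (s - t) < r1" "ereal (norm (s - t)) < fps_conv_radius F"
      using r2 less_trans[of "ereal (norm (s - t))" "ereal r2"] by (auto simp: r_def dist_norm norm_minus_commute)
    have d: "((\<lambda>s. eval_fps G (s - t)) has_field_derivative eval_fps (fps_deriv G) (s - t)) (at s)"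
      if "fps_conv_radius G \<ge> fps_conv_radius F" for G
    proof -
      have "(eval_fps G has_field_derivative eval_fps (fps_deriv G) (s - t)) (at (s - t))"
        using n(2) that by (intro has_field_derivative_eval_fps) simp
      moreover have "((\<lambda>s. s - t) has_field_derivative 1) (at s)"
        by (auto intro!: derivative_eq_intros)
      ultimately show ?thesis
        using DERIV_chain2 by fastforce
    qed
    have "\<forall>\<^sub>F y in nhds s. y \<in> ball t r1"
      using n(1) by (intro eventually_nhds_in_open) (auto simp: dist_norm norm_minus_commute)
    then have "\<forall>\<^sub>F y in nhds s. eval_fps F (y - t) = f y"
      by eventually_elim (use r1(2)[of "y - t" for y] in \<open>simp add: dist_norm norm_minus_commute\<close>)
    from DERIV_cong_ev[OF refl this refl] d[OF order_refl]
    show "(f has_field_derivative eval_fps (fps_deriv F) (s - t)) (at s)" by blast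
    show "((\<lambda>s. eval_fps (fps_deriv F) (s - t)) has_field_derivative eval_fps (fps_deriv (fps_deriv F)) (s - t)) (at s)"
      by (rule d[OF R1])
    show "isCont (\<lambda>s. eval_fps (fps_deriv (fps_deriv F)) (s - t)) s"
      by (rule DERIV_isCont[OF d[OF R2]])
  qed
qed

lemma analytic_arc_smooth:
  fixes \<phi> :: "'k::{real_normed_field,banach} \<Rightarrow> 'k ^ 'n"
  assumes "analytic_arc_at \<phi> t"
  shows "\<exists>r>0. \<exists>\<phi>1 \<phi>2. \<forall>s\<in>ball t r. has_vd \<phi> (\<phi>1 s) s \<and> has_vd \<phi>1 (\<phi>2 s) s \<and> isCont \<phi>2 s"
proof -
  obtain F where F: "\<And>i. (\<lambda>h. \<phi> (t + h) $ i) has_fps_expansion F i"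
    using assms unfolding analytic_arc_at_def by metis
  obtain r where r: "\<And>i. r i > 0" "\<And>i s. s \<in> ball t (r i) \<Longrightarrow>
      ((\<lambda>s. \<phi> s $ i) has_field_derivative eval_fps (fps_deriv (F i)) (s - t)) (at s) \<and>
      ((\<lambda>s. eval_fps (fps_deriv (F i)) (s - t)) has_field_derivative
        eval_fps (fps_deriv (fps_deriv (F i))) (s - t)) (at s) \<and>
      isCont (\<lambda>s. eval_fps (fps_deriv (fps_deriv (F i))) (s - t)) s"
    using fps_expansion_smooth[OF F] by metis
  have pos: "Min (range r) > 0" using r(1) by simp
  have sub: "s \<in> ball t (r i)" if "s \<in> ball t (Min (range r))" for s i
    using that Min_le[of "range r" "r i"] by simp
  define \<phi>1 where "\<phi>1 s = (\<chi> i. eval_fps (fps_deriv (F i)) (s - t))" for s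
  define \<phi>2 where "\<phi>2 s = (\<chi> i. eval_fps (fps_deriv (fps_deriv (F i))) (s - t))" for s
  have "has_vd \<phi> (\<phi>1 s) s \<and> has_vd \<phi>1 (\<phi>2 s) s \<and> isCont \<phi>2 s" if s: "s \<in> ball t (Min (range r))" for s
  proof (intro conjI)
    show "has_vd \<phi> (\<phi>1 s) s" "has_vd \<phi>1 (\<phi>2 s) s"
      using r(2)[OF sub[OF s]] by (simp_all add: has_vd_def \<phi>1_def \<phi>2_def)
    show "isCont \<phi>2 s"
      unfolding isCont_def
      by (rule vec_tendstoI) (use r(2)[OF sub[OF s]] in \<open>simp add: \<phi>2_def isCont_def\<close>)
  qed
  with pos show ?thesis by blast
qed

section \<open>Changing the speed of an arc, and tangent lines\<close>

lemma has_fps_expansion_scale: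
  fixes f :: "'k::{real_normed_field,banach} \<Rightarrow> 'k"
  assumes "f has_fps_expansion F"
  shows "\<exists>G. (\<lambda>h. f (c * h)) has_fps_expansion G"
proof (cases "c = 0")
  case True
  then show ?thesis using has_fps_expansion_const[of "f 0"] by auto
next
  case False
  define G where "G = Abs_fps (\<lambda>n. c ^ n * fps_nth F n)"
  have R: "fps_conv_radius F > 0" and ev: "\<forall>\<^sub>F h in nhds 0. eval_fps F h = f h"
    using assms by (simp_all add: has_fps_expansion_def)
  have "fps_conv_radius G = fps_conv_radius F / ereal (norm c)"
    unfolding G_def fps_conv_radius_def using False by (simp add: conv_radius_mult_power)
  with R False have "fps_conv_radius G > 0"
    by (cases "fps_conv_radius F") auto
  moreover have "eval_fps G h = eval_fps F (c * h)" for h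
    by (simp add: eval_fps_def G_def power_mult_distrib mult_ac)
  moreover have "\<forall>\<^sub>F h in nhds 0. eval_fps F (c * h) = f (c * h)"
  proof -
    have "isCont (\<lambda>h. c * h) 0" by (intro continuous_intros)
    then show ?thesis using ev isCont_eventually[where f = "\<lambda>h. c * h" and x = 0] by simp
  qed
  ultimately show ?thesis unfolding has_fps_expansion_def by auto
qed

text \<open>Running through an arc at speed \<open>c\<close> realises every multiple of its
  velocity, which is why the velocities fill a whole tangent line.\<close>

lemma analytic_arc_scale:
  assumes "analytic_arc_at \<phi> t"
  shows "analytic_arc_at (\<lambda>s. \<phi> (t + c * s)) 0"
  using assms has_fps_expansion_scale[of "\<lambda>h. \<phi> (t + h) $ i" for i]
  unfolding analytic_arc_at_def by fastforce

lemma analytic_arc_has_vd: "analytic_arc_at \<phi> t \<Longrightarrow> has_vd \<phi> (velocity \<phi> t) t"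
  using analytic_arc_smooth[of \<phi> t] has_vd_velocity[of \<phi> _ t] by (metis centre_in_ball)

text \<open>An arc inside the curve is the chart after a change of parameter that is a priori only
  continuous. Some component of the velocity of the chart is nonzero, so
  \<open>DERIV_continuous_preimage\<close> makes the change differentiable, and the chain rule makes
  the two velocities proportional.\<close>

lemma tangent_line_chart:
  fixes \<phi> :: "'k::{real_normed_field,banach} \<Rightarrow> 'k ^ 2"
  assumes U: "open U" and hom: "homeomorphism (ball 0 r) (a \<inter> U) \<phi> \<psi>"
    and t: "t \<in> ball 0 r" and an: "analytic_arc_at \<phi> t" and v: "velocity \<phi> t \<noteq> 0"
  shows "tangent_line a (\<phi> t) = line_dir (\<phi> t) (velocity \<phi> t)"
proof
  let ?v = "velocity \<phi> t"
  have vd: "has_vd \<phi> ?v t" by (rule analytic_arc_has_vd[OF an])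
  show "line_dir (\<phi> t) ?v \<subseteq> tangent_line a (\<phi> t)"
  proof
    fix x assume "x \<in> line_dir (\<phi> t) ?v"
    then obtain c where x: "x = \<phi> t + c *s ?v" by (auto simp: line_dir_def)
    define \<xi> where "\<xi> s = \<phi> (t + c * s)" for s
    have an': "analytic_arc_at \<xi> 0" unfolding \<xi>_def by (rule analytic_arc_scale[OF an])
    have "((\<lambda>s. t + c * s) has_field_derivative c) (at 0)"
      by (auto intro!: derivative_eq_intros)
    then have "has_vd \<xi> (c *s ?v) 0"
      unfolding \<xi>_def using has_vd_compose[of \<phi> ?v "\<lambda>s. t + c * s" 0 c] vd by simp
    then have "velocity \<xi> 0 = c *s ?v" by (rule has_vd_velocity)
    moreover have "\<forall>\<^sub>F s in nhds 0. \<xi> s \<in> a"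
    proof -
      have "isCont (\<lambda>s. t + c * s) 0" by (intro continuous_intros)
      moreover have "\<forall>\<^sub>F s in nhds t. s \<in> ball 0 r"
        using t by (intro eventually_nhds_in_open) auto
      ultimately have "\<forall>\<^sub>F s in nhds 0. t + c * s \<in> ball 0 r"
        using isCont_eventually[where f = "\<lambda>s. t + c * s" and x = 0] by simp
      then show ?thesis
        by eventually_elim (use hom in \<open>auto simp: \<xi>_def homeomorphism_def\<close>)
    qed
    moreover have "\<xi> 0 = \<phi> t" by (simp add: \<xi>_def)
    ultimately show "x \<in> tangent_line a (\<phi> t)"
      unfolding tangent_line_def x using an' by force
  qed
  show "tangent_line a (\<phi> t) \<subseteq> line_dir (\<phi> t) ?v"
  proof
    fix x assume "x \<in> tangent_line a (\<phi> t)"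
    then obtain \<xi> where \<xi>: "x = \<phi> t + velocity \<xi> 0" "analytic_arc_at \<xi> 0" "\<xi> 0 = \<phi> t"
      "\<forall>\<^sub>F s in nhds 0. \<xi> s \<in> a"
      unfolding tangent_line_def by blast
    have vd': "has_vd \<xi> (velocity \<xi> 0) 0" by (rule analytic_arc_has_vd[OF \<xi>(2)])
    have \<phi>t: "\<phi> t \<in> a \<inter> U" "\<psi> (\<phi> t) = t" using hom t by (auto simp: homeomorphism_def)
    have cont: "isCont \<xi> 0" by (rule has_vd_imp_isCont[OF vd'])
    moreover have "\<forall>\<^sub>F y in nhds (\<phi> t). y \<in> U"
      using U \<phi>t by (intro eventually_nhds_in_open) auto
    ultimately have "\<forall>\<^sub>F s in nhds 0. \<xi> s \<in> U"
      using isCont_eventually[where f = \<xi> and x = 0] \<xi>(3) by simp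
    with \<xi>(4) have aU: "\<forall>\<^sub>F s in nhds 0. \<xi> s \<in> a \<inter> U"
      by eventually_elim simp
    have eq: "\<forall>\<^sub>F s in nhds 0. \<xi> s = \<phi> (\<psi> (\<xi> s))"
      using aU by eventually_elim (use hom in \<open>simp add: homeomorphism_def\<close>)
    have "isCont (\<lambda>s. \<psi> (\<xi> s)) 0"
      unfolding isCont_def \<xi>(3)
    proof (rule continuous_on_tendsto_compose[of "a \<inter> U" \<psi>])
      show "continuous_on (a \<inter> U) \<psi>" using hom by (simp add: homeomorphism_def)
      show "\<xi> \<midarrow>0\<rightarrow> \<phi> t" using cont \<xi>(3) by (simp add: isCont_def)
      show "\<phi> t \<in> a \<inter> U" by fact
      show "\<forall>\<^sub>F s in at 0. \<xi> s \<in> a \<inter> U" using aU by (simp add: eventually_nhds_conv_at)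
    qed
    moreover obtain i where i: "?v $ i \<noteq> 0" using v by (auto simp: vec_eq_iff)
    moreover have "\<forall>\<^sub>F s in nhds 0. \<xi> s $ i = \<phi> (\<psi> (\<xi> s)) $ i"
      using eq by eventually_elim simp
    ultimately have "((\<lambda>s. \<psi> (\<xi> s)) has_field_derivative velocity \<xi> 0 $ i / ?v $ i) (at 0)"
      using DERIV_continuous_preimage[of "\<lambda>s. \<xi> s $ i" _ 0 "\<lambda>s. \<phi> s $ i" "?v $ i" "\<lambda>s. \<psi> (\<xi> s)"]
        has_vd_componentD[OF vd', of i] has_vd_componentD[OF vd, of i] \<phi>t \<xi>(3) by simp
    then have "has_vd (\<lambda>s. \<phi> (\<psi> (\<xi> s))) ((velocity \<xi> 0 $ i / ?v $ i) *s ?v) 0"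
      using vd \<phi>t \<xi>(3) by (intro has_vd_compose) simp_all
    moreover have "has_vd (\<lambda>s. \<phi> (\<psi> (\<xi> s))) (velocity \<xi> 0) 0"
      by (rule has_vd_cong_ev[OF eq vd'])
    ultimately have "velocity \<xi> 0 = (velocity \<xi> 0 $ i / ?v $ i) *s ?v"
      by (rule has_vd_unique[symmetric])
    then obtain c where "velocity \<xi> 0 = c *s ?v" by blast
    then show "x \<in> line_dir (\<phi> t) ?v"
      unfolding \<xi>(1) line_dir_def by (intro range_eqI[where x = c]) simp
  qed
qed

text \<open>A local parametrization of a line-framed curve at \<open>p\<close>: the boundary
  \<open>\<phi>\<close>, a direction field \<open>n\<close> of the framing lines and a local inverse
  \<open>\<psi>\<close>. The neighbourhoods in \<open>covers\<close> lie in the plane rather than in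
  the bundle, as the projection is injective on the curve.\<close>

locale framed_chart =
  fixes \<alpha> :: "'k::{real_normed_field,banach} framed_point set" and p :: "'k framed_point"
    and r :: real and \<phi> \<phi>1 \<phi>2 n n1 :: "'k \<Rightarrow> 'k ^ 2" and \<psi> :: "'k ^ 2 \<Rightarrow> 'k"
  assumes r_pos: "r > 0" and base: "\<phi> 0 = fst p" "p = (\<phi> 0, line_dir (\<phi> 0) (n 0))"
    and der: "t \<in> ball 0 r \<Longrightarrow> has_vd \<phi> (\<phi>1 t) t" "t \<in> ball 0 r \<Longrightarrow> has_vd \<phi>1 (\<phi>2 t) t"
      "t \<in> ball 0 r \<Longrightarrow> isCont \<phi>2 t" "t \<in> ball 0 r \<Longrightarrow> has_vd n (n1 t) t"
    and transversal: "t \<in> ball 0 r \<Longrightarrow> cross2 (\<phi>1 t) (n t) \<noteq> 0"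
    and mem: "t \<in> ball 0 r \<Longrightarrow> (\<phi> t, line_dir (\<phi> t) (n t)) \<in> \<alpha>"
    and tangent: "t \<in> ball 0 r \<Longrightarrow> tangent_line (fst ` \<alpha>) (\<phi> t) = line_dir (\<phi> t) (\<phi>1 t)"
    and inverse: "t \<in> ball 0 r \<Longrightarrow> \<psi> (\<phi> t) = t" "continuous_on (\<phi> ` ball 0 r) \<psi>"
    and covers: "0 < e \<Longrightarrow> e \<le> r \<Longrightarrow> \<exists>O'. open O' \<and> fst p \<in> O' \<and>
      (\<forall>x\<in>\<alpha>. fst x \<in> O' \<longrightarrow> (\<exists>t\<in>ball 0 e. x = (\<phi> t, line_dir (\<phi> t) (n t))))"
    and continuous: "openin PT_topology U \<Longrightarrow> p \<in> U \<Longrightarrow>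
      \<exists>e>0. e \<le> r \<and> (\<forall>t\<in>ball 0 e. (\<phi> t, line_dir (\<phi> t) (n t)) \<in> U)"

text \<open>In either chart of the bundle the slope coordinate yields a differentiable direction
  vector, with components 1 and slope or inverse slope and 1, which cannot vanish.\<close>

lemma PT_analytic_arc_direction:
  fixes \<Phi> :: "'k::{real_normed_field,banach} \<Rightarrow> 'k framed_point"
  assumes "PT_analytic_arc_at \<Phi> 0"
  shows "\<exists>n n1 r. r > 0 \<and> (\<forall>s\<in>ball 0 r. has_vd n (n1 s) s \<and> n s \<noteq> 0) \<and>
      (\<forall>\<^sub>F s in nhds 0. \<Phi> s = (fst (\<Phi> s), line_dir (fst (\<Phi> s)) (n s)))" (is ?goal_a)
    and "openin PT_topology U \<Longrightarrow> \<Phi> 0 \<in> U \<Longrightarrow> \<forall>\<^sub>F s in nhds 0. \<Phi> s \<in> U"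
proof -
  obtain w where w: "analytic_arc_at w 0"
    "(\<forall>\<^sub>F s in nhds 0. \<Phi> s = PT_param1 (w s)) \<or> (\<forall>\<^sub>F s in nhds 0. \<Phi> s = PT_param2 (w s))"
    using assms unfolding PT_analytic_arc_at_def by blast
  obtain r w1 where r: "r > 0" "\<And>s. s \<in> ball 0 r \<Longrightarrow> has_vd w (w1 s) s"
    using analytic_arc_smooth[OF w(1)] by blast
  show ?goal_a
    using w(2)
  proof
    assume ev: "\<forall>\<^sub>F s in nhds 0. \<Phi> s = PT_param1 (w s)"
    show ?thesis
    proof (intro exI conjI ballI)
      show "r > 0" by fact
      fix s :: 'k assume s: "s \<in> ball 0 r"
      show "has_vd (\<lambda>s. vector [1, w s $ 3] :: 'k ^ 2) (vector [0, w1 s $ 3]) s"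
        using r(2)[OF s] by (simp add: has_vd_def forall_2)
      show "(vector [1, w s $ 3] :: 'k ^ 2) \<noteq> 0" by (simp add: vec2_eq_iff)
    next
      show "\<forall>\<^sub>F s in nhds 0. \<Phi> s = (fst (\<Phi> s), line_dir (fst (\<Phi> s)) (vector [1, w s $ 3]))"
        using ev by eventually_elim (simp add: PT_param1_def)
    qed
  next
    assume ev: "\<forall>\<^sub>F s in nhds 0. \<Phi> s = PT_param2 (w s)"
    show ?thesis
    proof (intro exI conjI ballI)
      show "r > 0" by fact
      fix s :: 'k assume s: "s \<in> ball 0 r"
      show "has_vd (\<lambda>s. vector [w s $ 3, 1] :: 'k ^ 2) (vector [w1 s $ 3, 0]) s"
        using r(2)[OF s] by (simp add: has_vd_def forall_2)
      show "(vector [w s $ 3, 1] :: 'k ^ 2) \<noteq> 0" by (simp add: vec2_eq_iff)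
    next
      show "\<forall>\<^sub>F s in nhds 0. \<Phi> s = (fst (\<Phi> s), line_dir (fst (\<Phi> s)) (vector [w s $ 3, 1]))"
        using ev by eventually_elim (simp add: PT_param2_def)
    qed
  qed
  assume U: "openin PT_topology U" "\<Phi> 0 \<in> U"
  have "isCont w 0" using r by (intro has_vd_imp_isCont[of w "w1 0"]) simp
  have *: "\<forall>\<^sub>F s in nhds 0. \<Phi> s \<in> U"
    if ev: "\<forall>\<^sub>F s in nhds 0. \<Phi> s = f (w s)" and f: "open (f -` U)" for f
  proof -
    have "w 0 \<in> f -` U" using eventually_nhds_x_imp_x[OF ev] U(2) by simp
    then have "\<forall>\<^sub>F y in nhds (w 0). y \<in> f -` U" using f by (intro eventually_nhds_in_open)
    then have "\<forall>\<^sub>F s in nhds 0. w s \<in> f -` U" using isCont_eventually[OF \<open>isCont w 0\<close>] by blast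
    with ev show ?thesis by eventually_elim simp
  qed
  show "\<forall>\<^sub>F s in nhds 0. \<Phi> s \<in> U"
    using w(2) * U(1) unfolding openin_PT_topology by blast
qed

text \<open>A chart of the boundary is lifted through the inverse of the projection. By the
  diffeomorphism condition the lift is an analytic arc of framed points, and this arc supplies the
  direction field.\<close>

lemma framed_chart_exists:
  fixes \<alpha> :: "'k::{real_normed_field,banach} framed_point set"
  assumes lf: "line_framed_curve \<alpha>" and p: "p \<in> \<alpha>"
  shows "\<exists>r \<phi> \<phi>1 \<phi>2 n n1 \<psi>. framed_chart \<alpha> p r \<phi> \<phi>1 \<phi>2 n n1 \<psi>"
proof -
  let ?a = "fst ` \<alpha>"
  have "fst p \<in> ?a" using p by simp
  moreover have "regular_curve ?a" using lf by (simp add: line_framed_curve_def)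
  ultimately obtain U \<phi> \<psi> r0 where U: "open U" "fst p \<in> U" and r0: "r0 > 0" and \<phi>0: "\<phi> 0 = fst p"
    and an: "\<And>t. t \<in> ball 0 r0 \<Longrightarrow> analytic_arc_at \<phi> t" "\<And>t. t \<in> ball 0 r0 \<Longrightarrow> velocity \<phi> t \<noteq> 0"
    and hom: "homeomorphism (ball 0 r0) (?a \<inter> U) \<phi> \<psi>"
    unfolding regular_curve_def by meson
  have bij: "inj_on fst \<alpha>"
    using lf by (simp add: line_framed_curve_def projection_diffeo_def bij_betw_def)
  have inv: "inv_into \<alpha> fst (fst x) = x" if "x \<in> \<alpha>" for x
    using bij that by simp
  define \<Phi> where "\<Phi> = inv_into \<alpha> fst \<circ> \<phi>"
  have \<phi>a: "\<phi> t \<in> ?a \<inter> U" if "t \<in> ball 0 r0" for t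
    using hom that by (auto simp: homeomorphism_def)
  have \<Phi>: "\<Phi> t \<in> \<alpha>" "fst (\<Phi> t) = \<phi> t" if "t \<in> ball 0 r0" for t
    using \<phi>a[OF that] unfolding \<Phi>_def by (auto simp: inv_into_into f_inv_into_f)
  have ev0: "\<forall>\<^sub>F t in nhds 0. t \<in> ball (0::'k) r0"
    using r0 by (intro eventually_nhds_in_open) auto
  have "\<forall>\<^sub>F t in nhds 0. \<phi> t \<in> ?a"
    using ev0 by eventually_elim (use \<phi>a in blast)
  then have arc: "PT_analytic_arc_at \<Phi> 0"
    using lf an(1)[of 0] r0 unfolding \<Phi>_def line_framed_curve_def projection_diffeo_def by simp
  have \<Phi>0: "\<Phi> 0 = p" using inv[OF p] by (simp add: \<Phi>_def \<phi>0)
  obtain n n1 r1 where r1: "r1 > 0" and n: "\<And>s. s \<in> ball 0 r1 \<Longrightarrow> has_vd n (n1 s) s"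
      "\<And>s. s \<in> ball 0 r1 \<Longrightarrow> n s \<noteq> 0"
    and evn: "\<forall>\<^sub>F s in nhds 0. \<Phi> s = (fst (\<Phi> s), line_dir (fst (\<Phi> s)) (n s))"
    using PT_analytic_arc_direction(1)[OF arc] by blast
  obtain r2 where r2: "r2 > 0" "\<And>s. s \<in> ball 0 r2 \<Longrightarrow> \<Phi> s = (fst (\<Phi> s), line_dir (fst (\<Phi> s)) (n s))"
    using evn unfolding eventually_nhds_metric by (auto simp: dist_commute)
  have "analytic_arc_at \<phi> 0" using an(1)[of 0] r0 by simp
  then obtain r3 \<phi>1 \<phi>2 where r3: "r3 > 0"
    "\<forall>s\<in>ball 0 r3. has_vd \<phi> (\<phi>1 s) s \<and> has_vd \<phi>1 (\<phi>2 s) s \<and> isCont \<phi>2 s"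
    using analytic_arc_smooth by blast
  define r where "r = min (min r0 r1) (min r2 r3)"
  have r: "r > 0" "\<And>s. s \<in> ball 0 r \<Longrightarrow> s \<in> ball 0 r0 \<and> s \<in> ball 0 r1 \<and> s \<in> ball 0 r2 \<and> s \<in> ball 0 r3"
    using r0 r1 r2(1) r3(1) by (auto simp: r_def)
  have eq: "\<Phi> s = (\<phi> s, line_dir (\<phi> s) (n s))" if "s \<in> ball 0 r" for s
    using r2(2)[of s] r(2)[OF that] \<Phi>(2)[of s] by simp
  have vel: "velocity \<phi> s = \<phi>1 s" if "s \<in> ball 0 r" for s
    using r3(2) r(2)[OF that] has_vd_velocity by blast
  have tan: "tangent_line ?a (\<phi> s) = line_dir (\<phi> s) (\<phi>1 s)" if "s \<in> ball 0 r" for s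
    using tangent_line_chart[OF U(1) hom] an r(2)[OF that] vel[OF that] by metis
  have "framed_chart \<alpha> p r \<phi> \<phi>1 \<phi>2 n n1 \<psi>"
  proof
    show "r > 0" by (rule r(1))
    show "\<phi> 0 = fst p" by (rule \<phi>0)
    show "p = (\<phi> 0, line_dir (\<phi> 0) (n 0))" using eq[of 0] \<Phi>0 r(1) by simp
    fix t :: 'k assume t: "t \<in> ball 0 r"
    show "has_vd \<phi> (\<phi>1 t) t" "has_vd \<phi>1 (\<phi>2 t) t" "isCont \<phi>2 t" "has_vd n (n1 t) t"
      using r(2)[OF t] r3 n by blast+
    show mem: "(\<phi> t, line_dir (\<phi> t) (n t)) \<in> \<alpha>"
      using \<Phi>(1)[of t] r(2)[OF t] eq[OF t] by simp
    show "tangent_line ?a (\<phi> t) = line_dir (\<phi> t) (\<phi>1 t)" by (rule tan[OF t])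
    have "line_dir (\<phi> t) (n t) \<noteq> line_dir (\<phi> t) (\<phi>1 t)"
      using lf mem tan[OF t] unfolding line_framed_curve_def by auto
    then show "cross2 (\<phi>1 t) (n t) \<noteq> 0"
      using line_dir_eq_iff[of "n t" "\<phi>1 t" "\<phi> t"] n(2) an(2)[of t] vel[OF t] r(2)[OF t]
        cross2_commute[of "\<phi>1 t" "n t"] by auto
    show "\<psi> (\<phi> t) = t" using hom r(2)[OF t] by (simp add: homeomorphism_def)
  next
    have "\<phi> ` ball 0 r \<subseteq> ?a \<inter> U" using \<phi>a r(2) by blast
    then show "continuous_on (\<phi> ` ball 0 r) \<psi>"
      by (rule continuous_on_subset[rotated]) (use hom in \<open>simp add: homeomorphism_def\<close>)
  next
    fix e :: real assume e: "0 < e" "e \<le> r"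
    have "continuous_on (?a \<inter> U) \<psi>" using hom by (simp add: homeomorphism_def)
    then obtain T where T: "open T" "T \<inter> (?a \<inter> U) = \<psi> -` ball 0 e \<inter> (?a \<inter> U)"
      unfolding continuous_on_open_invariant using open_ball by metis
    show "\<exists>O'. open O' \<and> fst p \<in> O' \<and>
      (\<forall>x\<in>\<alpha>. fst x \<in> O' \<longrightarrow> (\<exists>t\<in>ball 0 e. x = (\<phi> t, line_dir (\<phi> t) (n t))))"
    proof (intro exI conjI ballI impI)
      show "open (U \<inter> T)" using U T by auto
      have "\<psi> (fst p) = 0" using hom r0 \<phi>0 unfolding homeomorphism_def by (metis centre_in_ball)
      then have "fst p \<in> \<psi> -` ball 0 e \<inter> (?a \<inter> U)" using e U p by simp
      then show "fst p \<in> U \<inter> T" using T by blast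
      fix x assume x: "x \<in> \<alpha>" "fst x \<in> U \<inter> T"
      then have "fst x \<in> T \<inter> (?a \<inter> U)" by auto
      then have "\<psi> (fst x) \<in> ball 0 e" "fst x \<in> ?a \<inter> U" using T by auto
      moreover have "\<phi> (\<psi> (fst x)) = fst x"
        using hom \<open>fst x \<in> ?a \<inter> U\<close> by (simp add: homeomorphism_def)
      then have "\<Phi> (\<psi> (fst x)) = x" using inv[OF x(1)] by (simp add: \<Phi>_def)
      ultimately show "\<exists>t\<in>ball 0 e. x = (\<phi> t, line_dir (\<phi> t) (n t))"
        using eq[of "\<psi> (fst x)"] e by auto
    qed
  next
    fix W assume W: "openin PT_topology W" "p \<in> W"
    then have "\<forall>\<^sub>F s in nhds 0. \<Phi> s \<in> W"
      using PT_analytic_arc_direction(2)[OF arc W(1)] \<Phi>0 by simp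
    then obtain d where d: "d > 0" "\<And>s. s \<in> ball 0 d \<Longrightarrow> \<Phi> s \<in> W"
      unfolding eventually_nhds_metric by (auto simp: dist_commute)
    show "\<exists>e>0. e \<le> r \<and> (\<forall>t\<in>ball 0 e. (\<phi> t, line_dir (\<phi> t) (n t)) \<in> W)"
      using d eq r(1) by (intro exI[of _ "min d r"]) (metis (no_types) min_less_iff_conj min.cobounded2 mem_ball_0)
  qed
  then show ?thesis by blast
qed

subsection \<open>Covectors, right-spherical germs and straight arcs\<close>

lemma isCont_cross2:
  fixes f g :: "'a::t2_space \<Rightarrow> 'k::real_normed_field ^ 2"
  shows "isCont f x \<Longrightarrow> isCont g x \<Longrightarrow> isCont (\<lambda>y. cross2 (f y) (g y)) x"
  unfolding cross2_def by (intro continuous_intros)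

lemma isCont_scale_vec:
  fixes f :: "'a::t2_space \<Rightarrow> 'k::real_normed_field" and g :: "'a \<Rightarrow> 'k ^ 'n"
  assumes "isCont f x" "isCont g x"
  shows "isCont (\<lambda>y. f y *s g y) x"
  unfolding isCont_def
proof (rule vec_tendstoI)
  fix i
  have "f \<midarrow>x\<rightarrow> f x" "(\<lambda>y. g y $ i) \<midarrow>x\<rightarrow> g x $ i"
    using assms by (auto simp: isCont_def intro: tendsto_vec_nth)
  then show "(\<lambda>y. (f y *s g y) $ i) \<midarrow>x\<rightarrow> (f x *s g x) $ i"
    by (simp add: tendsto_mult)
qed

text \<open>Division by \<open>f'\<close> is a right inverse of the derivative, so Sussmann's open
  mapping theorem applies; differentiability at one point is enough for it. The lemma serves to fill
  a neighbourhood on a line or in a parameter ball.\<close>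

lemma locally_surjective:
  fixes f :: "'k::{real_normed_field,euclidean_space} \<Rightarrow> 'k"
  assumes cont: "continuous_on (ball 0 e) f" and e: "e > 0"
    and f: "(f has_field_derivative f') (at 0)" "f' \<noteq> 0"
  shows "\<exists>\<delta>>0. ball (f 0) \<delta> \<subseteq> f ` ball 0 e"
proof -
  have "f 0 \<in> interior (f ` ball 0 e)"
  proof (rule sussmann_open_mapping)
    show "(f has_derivative (*) f') (at 0)"
      using f(1) by (simp add: has_field_derivative_def)
    show "bounded_linear (\<lambda>h. h / f')" by (rule bounded_linear_divide)
    show "(*) f' \<circ> (\<lambda>h. h / f') = id" using f(2) by (auto simp: fun_eq_iff)
    show "0 \<in> interior (ball (0::'k) e)" using e by simp
  qed (use cont e in auto)
  then show ?thesis by (simp add: mem_interior)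
qed

text \<open>The covector of the line through \<open>A\<close> in the direction \<open>v\<close>, so
  that tangents and framing lines can be intersected by \<open>vprod\<close>.\<close>

definition line_covec :: "'k::comm_ring_1 ^ 2 \<Rightarrow> 'k ^ 2 \<Rightarrow> 'k ^ 3" where
  "line_covec A v = vector [- v $ 2, v $ 1, - cross2 v A]"

lemma line_covec_nth [simp]:
  "line_covec A v $ 1 = - v $ 2" "line_covec A v $ 2 = v $ 1" "line_covec A v $ 3 = - cross2 v A"
  by (simp_all add: line_covec_def)

lemma sprod_line_covec: "sprod (line_covec A v) (chart_vec X) = cross2 v (X - A)"
  by (simp add: sprod_def cross2_def algebra_simps)

lemma line_covec_shift:
  fixes A B v w :: "'k::field ^ 2"
  assumes "v \<noteq> 0" "w \<noteq> 0" "cross2 v w = 0" "cross2 v (B - A) = 0"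
  obtains k where "k \<noteq> 0" "line_covec B w = k *s line_covec A v"
proof -
  obtain k where k: "w = k *s v" using cross2_parallel assms by blast
  have "cross2 v B = cross2 v A" using assms(4) by (simp add: cross2_simps)
  then have "line_covec B w = k *s line_covec A v"
    by (simp add: vec3_eq_iff k cross2_simps)
  moreover have "k \<noteq> 0" using k assms(2) by auto
  ultimately show thesis using that by blast
qed

section \<open>Determinants of covectors and concurrency\<close>

lemma sprod_simps:
  fixes x y z :: "'k::comm_ring_1 ^ 3"
  shows "sprod (x + y) z = sprod x z + sprod y z" "sprod z (x + y) = sprod z x + sprod z y"
    "sprod (c *s x) y = c * sprod x y" "sprod x (c *s y) = c * sprod x y"
    "sprod x (vprod x y) = 0" "sprod y (vprod x y) = 0" "sprod (vprod x y) x = 0" "sprod (vprod x y) y = 0"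
    "sprod x 0 = 0" "sprod 0 x = 0"
  by (simp_all add: sprod_def algebra_simps)

lemma vprod_scale:
  fixes x y :: "'k::comm_ring_1 ^ 3"
  shows "vprod (c *s x) y = c *s vprod x y" "vprod x (c *s y) = c *s vprod x y"
  by (simp_all add: vec3_eq_iff algebra_simps)

lemma vprod_vprod:
  fixes a b c :: "'k::comm_ring_1 ^ 3"
  shows "vprod (vprod c a) (vprod a b) = sprod (vprod a b) c *s a"
  by (simp add: vec3_eq_iff sprod_def algebra_simps)

lemma det_eq_0_if_common_zero:
  fixes a b c x :: "'k::idom ^ 3"
  assumes "sprod a x = 0" "sprod b x = 0" "sprod c x = 0" "x \<noteq> 0"
  shows "sprod (vprod a b) c = 0"
proof -
  have "sprod (vprod a b) c *s x
    = sprod a x *s vprod b c + sprod b x *s vprod c a + sprod c x *s vprod a b"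
    by (simp add: vec3_eq_iff sprod_def algebra_simps)
  then have "sprod (vprod a b) c *s x = 0" using assms by simp
  then show ?thesis using assms(4) by (auto simp: vec3_eq_iff)
qed

text \<open>Multiplicativity of determinants: on the right stands the determinant of the matrix of
  pairings.\<close>

lemma det_mult:
  fixes a b c x y z :: "'k::comm_ring_1 ^ 3"
  shows "sprod (vprod a b) c * sprod (vprod x y) z =
    sprod a x * (sprod b y * sprod c z - sprod b z * sprod c y)
    - sprod a y * (sprod b x * sprod c z - sprod b z * sprod c x)
    + sprod a z * (sprod b x * sprod c y - sprod b y * sprod c x)"
  by (simp add: sprod_def algebra_simps)

text \<open>Each tangent vanishes at its own vertex, so the matrix of pairings of tangents with
  vertices has zero diagonal and its determinant is a sum of two products. The balance makes them
  equal, so they add up instead of cancelling.\<close>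

lemma mirror_tangents_independent:
  fixes A B C A1 B1 C1 :: "'k::field_char_0 ^ 2"
  assumes "cross2 (B - A) (C - A) \<noteq> 0"
    and nz: "cross2 A1 (B - A) \<noteq> 0" "cross2 B1 (C - B) \<noteq> 0" "cross2 C1 (A - C) \<noteq> 0"
    and bal: "cross2 A1 (C - A) * cross2 B1 (A - B) * cross2 C1 (B - C)
      = cross2 A1 (B - A) * cross2 B1 (C - B) * cross2 C1 (A - C)"
  shows "sprod (vprod (line_covec A A1) (line_covec B B1)) (line_covec C C1) \<noteq> 0"
proof
  assume zero: "sprod (vprod (line_covec A A1) (line_covec B B1)) (line_covec C C1) = 0"
  have "0 = cross2 A1 (B - A) * cross2 B1 (C - B) * cross2 C1 (A - C)
      + cross2 A1 (C - A) * cross2 B1 (A - B) * cross2 C1 (B - C)"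
    using det_mult[of "line_covec A A1" "line_covec B B1" "line_covec C C1" "chart_vec A" "chart_vec B" "chart_vec C"]
    by (simp add: zero sprod_line_covec cross2_simps(10) algebra_simps)
  also have "\<dots> = 2 * (cross2 A1 (B - A) * cross2 B1 (C - B) * cross2 C1 (A - C))"
    unfolding bal by simp
  finally show False using nz by simp
qed

text \<open>Passing from a tangent to its harmonic conjugate with respect to the sides flips the
  sign in Ceva's condition; this turns the collinear feet of the three tangents into concurrency of
  one framing line with the other two tangents.\<close>

lemma framing_concurrent_with_tangents:
  fixes A B C A1 B1 C1 N :: "'k::field_char_0 ^ 2"
  assumes D: "cross2 (B - A) (C - A) \<noteq> 0"
    and m: "mirror A A1 N B C"
    and nz: "cross2 B1 (C - B) \<noteq> 0" "cross2 C1 (A - C) \<noteq> 0" "cross2 B1 (A - B) \<noteq> 0" "cross2 C1 (B - C) \<noteq> 0"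
    and bal: "cross2 A1 (C - A) * cross2 B1 (A - B) * cross2 C1 (B - C)
      = cross2 A1 (B - A) * cross2 B1 (C - B) * cross2 C1 (A - C)"
  shows "sprod (line_covec A N) (vprod (line_covec B B1) (line_covec C C1)) = 0"
proof -
  define f1 where "f1 = cross2 A1 (B - A)"
  define f2 where "f2 = cross2 A1 (C - A)"
  define g1 where "g1 = cross2 B1 (A - B)"
  define g2 where "g2 = cross2 B1 (C - B)"
  define h1 where "h1 = cross2 C1 (A - C)"
  define h2 where "h2 = cross2 C1 (B - C)"
  \<comment> \<open>The common point of the tangents at \<open>B\<close> and \<open>C\<close>, in
    homogeneous barycentric coordinates with respect to the triangle.\<close>
  define x where "x = (- (g2 * h2)) *s chart_vec A + (g2 * h1) *s chart_vec B + (g1 * h2) *s chart_vec C"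
  have f1: "f1 \<noteq> 0" and mi: "f1 * cross2 N (C - A) = - (f2 * cross2 N (B - A))"
    using m unfolding mirror_def f1_def f2_def by (simp_all add: eq_neg_iff_add_eq_0)
  have bal': "f2 * g1 * h2 = f1 * g2 * h1" using bal by (simp add: f1_def f2_def g1_def g2_def h1_def h2_def)
  have "sprod (line_covec A N) x = g2 * h1 * cross2 N (B - A) + g1 * h2 * cross2 N (C - A)"
    unfolding x_def sprod_simps sprod_line_covec by (simp add: cross2_simps(10))
  then have "f1 * sprod (line_covec A N) x = g2 * h1 * (f1 * cross2 N (B - A)) + g1 * h2 * (f1 * cross2 N (C - A))"
    by (simp add: algebra_simps)
  also have "\<dots> = (f1 * g2 * h1 - f2 * g1 * h2) * cross2 N (B - A)"
    unfolding mi by (simp add: algebra_simps)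
  finally have "f1 * sprod (line_covec A N) x = 0" unfolding bal' by simp
  then have 1: "sprod (line_covec A N) x = 0" using f1 by simp
  have 2: "sprod (line_covec B B1) x = 0" "sprod (line_covec C C1) x = 0"
    unfolding x_def sprod_simps sprod_line_covec
    by (simp_all add: cross2_simps(10) g1_def g2_def h1_def h2_def algebra_simps)
  have "sprod (line_covec A (C - A)) x = g2 * h1 * cross2 (C - A) (B - A)"
    unfolding x_def sprod_simps sprod_line_covec by (simp add: cross2_simps(9,10))
  moreover have "cross2 (C - A) (B - A) \<noteq> 0" using D cross2_commute[of "C - A" "B - A"] by simp
  ultimately have "sprod (line_covec A (C - A)) x \<noteq> 0" using nz by (simp add: g2_def h1_def)
  then have "x \<noteq> 0" by (auto simp: sprod_simps)
  from det_eq_0_if_common_zero[OF 2 1 this] show ?thesis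
    by (simp add: sprod_def algebra_simps)
qed

text \<open>The direction from \<open>A\<close> to the projective point \<open>r\<close>,
  homogeneous in \<open>r\<close>; for a point at infinity, where \<open>r $ 3 = 0\<close>, it is
  the direction of that point.\<close>

definition dir_to :: "'k::comm_ring_1 ^ 2 \<Rightarrow> 'k ^ 3 \<Rightarrow> 'k ^ 2" where
  "dir_to A r = vector [r $ 1 - r $ 3 * A $ 1, r $ 2 - r $ 3 * A $ 2]"

lemma dir_to_nth [simp]: "dir_to A r $ 1 = r $ 1 - r $ 3 * A $ 1" "dir_to A r $ 2 = r $ 2 - r $ 3 * A $ 2"
  by (simp_all add: dir_to_def)

lemma cross2_dir_to: "cross2 v (dir_to A r) = sprod (line_covec A v) r"
  by (simp add: cross2_def sprod_def algebra_simps)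

text \<open>On the line of \<open>p\<close> and \<open>q\<close> the direction
  \<open>dir_to A r\<close> cannot vanish: otherwise \<open>r\<close> would be a multiple of
  \<open>chart_vec A\<close> and lie on that line.\<close>

lemma omega_eq:
  fixes p q r :: "'k::field ^ 3"
  assumes det: "sprod (vprod p q) r \<noteq> 0"
  shows "omega (proj_join (vec.span {p}) (vec.span {q})) (vec.span {r})
    = {(A, line_dir A (dir_to A r)) | A. sprod (vprod p q) (chart_vec A) = 0}" (is ?goal_a)
    and "sprod (vprod p q) (chart_vec A) = 0 \<Longrightarrow> dir_to A r \<noteq> 0"
proof -
  have pq: "vprod p q \<noteq> 0" using det by (auto simp: sprod_simps)
  have mem: "chart_point A \<subseteq> proj_join (vec.span {p}) (vec.span {q}) \<longleftrightarrow> sprod (vprod p q) (chart_vec A) = 0" for A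
    unfolding proj_join_span chart_point_def
    by (simp add: span_singleton_subset_iff mem_span_pair_iff[OF pq])
  have ne: "dir_to A r \<noteq> 0" if "sprod (vprod p q) (chart_vec A) = 0" for A
  proof
    assume "dir_to A r = 0"
    then have "r = (r $ 3) *s chart_vec A"
      by (simp add: vec2_eq_iff vec3_eq_iff)
    then have "sprod (vprod p q) r = (r $ 3) * sprod (vprod p q) (chart_vec A)"
      by (metis sprod_simps(4))
    then show False using that det by simp
  qed
  then show "sprod (vprod p q) (chart_vec A) = 0 \<Longrightarrow> dir_to A r \<noteq> 0" .
  have line: "{B. chart_point B \<subseteq> proj_join (chart_point A) (vec.span {r})} = line_dir A (dir_to A r)"
    if A: "sprod (vprod p q) (chart_vec A) = 0" for A
  proof -
    have id: "sprod (vprod (chart_vec A) r) (chart_vec B) = cross2 (dir_to A r) (B - A)" for B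
      by (simp add: sprod_def cross2_def algebra_simps)
    have "vprod (chart_vec A) r \<noteq> 0"
    proof
      assume "vprod (chart_vec A) r = 0"
      then have "cross2 (dir_to A r) (B - A) = 0" for B
        using id[of B] by (simp add: sprod_simps)
      from this[of "A + vector [1, 0]"] this[of "A + vector [0, 1]"] ne[OF A]
      show False by (simp add: cross2_def vec2_eq_iff)
    qed
    from mem_span_pair_iff[OF this] show ?thesis
      unfolding chart_point_def proj_join_span
      by (auto simp: span_singleton_subset_iff id mem_line_dir_iff[OF ne[OF A]])
  qed
  show ?goal_a
    unfolding omega_def mem using line by blast
qed

section \<open>Neighbourhoods in the bundle, and arcs without curvature\<close>

lemma line_dir_mem_PT: "v \<noteq> 0 \<Longrightarrow> (A, line_dir A v) \<in> PT"
  using rangeI[of "\<lambda>t. A + t *s v" 0] by (auto simp: PT_def is_line_def line_dir_def)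

lemma openin_PT_fst:
  fixes O' :: "('k::real_normed_field ^ 2) set"
  assumes "open O'"
  shows "openin PT_topology {x \<in> PT. fst x \<in> O'}"
proof -
  have PT: "PT_param1 w \<in> PT" "PT_param2 w \<in> PT" for w :: "'k ^ 3"
    unfolding PT_param1_def PT_param2_def by (rule line_dir_mem_PT, simp add: vec2_eq_iff)+
  have cont: "continuous_on UNIV (\<lambda>w :: 'k ^ 3. vector [w $ 1, w $ 2] :: 'k ^ 2)"
  proof -
    have eq: "(\<lambda>w :: 'k ^ 3. vector [w $ 1, w $ 2] :: 'k ^ 2) = (\<lambda>w. \<chi> i. if i = 1 then w $ 1 else w $ 2)"
      by (auto simp: fun_eq_iff vec2_eq_iff)
    have "continuous_on UNIV (\<lambda>w :: 'k ^ 3. (\<chi> i. if i = 1 then w $ 1 else w $ 2) :: 'k ^ 2)"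
    proof (rule continuous_on_vec_lambda)
      show "continuous_on UNIV (\<lambda>w :: 'k ^ 3. if i = 1 then w $ 1 else w $ 2)" for i :: 2
        by (cases "i = 1") (simp_all add: continuous_on_component)
    qed
    then show ?thesis unfolding eq .
  qed
  have "PT_param1 -` {x \<in> PT. fst x \<in> O'} = (\<lambda>w. vector [w $ 1, w $ 2]) -` O'"
    "PT_param2 -` {x \<in> PT. fst x \<in> O'} = (\<lambda>w. vector [w $ 1, w $ 2]) -` O'"
    using PT by (auto simp: PT_param1_def PT_param2_def)
  then show ?thesis
    unfolding openin_PT_topology using open_vimage[OF assms cont] by auto
qed

text \<open>When the acceleration is a multiple of the velocity,
  \<open>cross2 (\<phi>1 0) (\<phi>1 t)\<close> and a nonzero component of \<open>\<phi>1 t\<close>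
  solve the same equation \<open>y' = k * y\<close>. Their quotient is therefore constant, namely 0,
  and one more integration puts the arc on a line.\<close>

lemma straight_if_curvature_zero:
  fixes \<phi> \<phi>1 \<phi>2 :: "'k::{real_normed_field,banach} \<Rightarrow> 'k ^ 2"
  assumes r: "r > 0" and der: "\<And>t. t \<in> ball 0 r \<Longrightarrow> has_vd \<phi> (\<phi>1 t) t" "\<And>t. t \<in> ball 0 r \<Longrightarrow> has_vd \<phi>1 (\<phi>2 t) t"
    and zero: "\<And>t. t \<in> ball 0 r \<Longrightarrow> cross2 (\<phi>1 t) (\<phi>2 t) = 0" and nz: "\<phi>1 0 \<noteq> 0"
  shows "\<exists>e>0. e \<le> r \<and> (\<forall>t\<in>ball 0 e. cross2 (\<phi>1 0) (\<phi>1 t) = 0 \<and> cross2 (\<phi>1 0) (\<phi> t - \<phi> 0) = 0)"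
proof -
  obtain i where i: "\<phi>1 0 $ i \<noteq> 0" using nz by (auto simp: vec_eq_iff)
  have "((\<lambda>t. \<phi>1 t $ i) has_field_derivative \<phi>2 0 $ i) (at 0)"
    using der(2)[of 0] r by (intro has_vd_componentD) simp
  from isCont_eventually_nonzero[OF DERIV_isCont[OF this] i]
  obtain d where "d > 0" and nz_i: "\<forall>t. dist t 0 < d \<longrightarrow> \<phi>1 t $ i \<noteq> 0"
    unfolding eventually_nhds_metric by blast
  then have d: "d > 0" "\<And>t. t \<in> ball 0 d \<Longrightarrow> \<phi>1 t $ i \<noteq> 0"
    by (simp_all add: dist_commute)
  define e where "e = min d r"
  have e: "e > 0" "e \<le> r" "\<And>t. t \<in> ball (0::'k) e \<Longrightarrow> t \<in> ball 0 d" "\<And>t. t \<in> ball (0::'k) e \<Longrightarrow> t \<in> ball 0 r"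
    using d(1) r by (simp_all add: e_def)
  have e0: "0 \<in> ball (0::'k) e" using e(1) by simp
  have quot: "((\<lambda>t. cross2 (\<phi>1 0) (\<phi>1 t) / \<phi>1 t $ i) has_field_derivative 0) (at t)" if t: "t \<in> ball 0 e" for t
  proof -
    have "\<phi>1 t \<noteq> 0" using d(2)[OF e(3)[OF t]] by auto
    then obtain k where k: "\<phi>2 t = k *s \<phi>1 t"
      by (rule cross2_parallel[OF zero[OF e(4)[OF t]]])
    have vd: "has_vd \<phi>1 (\<phi>2 t) t" by (rule der(2)[OF e(4)[OF t]])
    have d1: "((\<lambda>t. cross2 (\<phi>1 0) (\<phi>1 t)) has_field_derivative k * cross2 (\<phi>1 0) (\<phi>1 t)) (at t)"
      using has_vd_cross2[OF has_vd_const vd, of "\<phi>1 0"] by (simp add: k cross2_simps)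
    have d2: "((\<lambda>t. \<phi>1 t $ i) has_field_derivative k * \<phi>1 t $ i) (at t)"
      using has_vd_componentD[OF vd, of i] by (simp add: k)
    show ?thesis
      by (rule DERIV_cong[OF DERIV_divide[OF d1 d2 d(2)[OF e(3)[OF t]]]]) simp
  qed
  have const: "f t = f 0" if "\<And>t. t \<in> ball 0 e \<Longrightarrow> (f has_field_derivative 0) (at t)" "t \<in> ball 0 e"
    for f :: "'k \<Rightarrow> 'k" and t
  proof -
    have "\<exists>c. \<forall>x\<in>ball 0 e. f x = c"
      by (rule has_field_derivative_zero_constant[OF convex_ball])
        (rule has_field_derivative_at_within, rule that(1))
    then show ?thesis using that(2) e0 by auto
  qed
  have par: "cross2 (\<phi>1 0) (\<phi>1 t) = 0" if t: "t \<in> ball 0 e" for t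
    using const[OF quot t] d(2)[OF e(3)[OF t]] by (simp add: cross2_simps(9))
  have "cross2 (\<phi>1 0) (\<phi> t - \<phi> 0) = 0" if t: "t \<in> ball 0 e" for t
  proof -
    have "((\<lambda>t. cross2 (\<phi>1 0) (\<phi> t - \<phi> 0)) has_field_derivative 0) (at t)" if t: "t \<in> ball 0 e" for t
      using has_vd_cross2[OF has_vd_const has_vd_diff[OF der(1)[OF e(4)[OF t]] has_vd_const], of "\<phi>1 0" "\<phi> 0"] par[OF t]
      by (simp add: cross2_simps)
    from const[OF this t] show ?thesis by (simp add: cross2_simps)
  qed
  with par e show ?thesis by blast
qed

subsection \<open>The billiard in local charts\<close>

lemma (in framed_chart) isCont_chart:
  assumes "t \<in> ball 0 r"
  shows "isCont \<phi> t" "isCont \<phi>1 t" "isCont n t"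
  using der[OF assms] by (auto intro: has_vd_imp_isCont)

lemma (in framed_chart) nonzero_dirs:
  assumes "t \<in> ball 0 r"
  shows "\<phi>1 t \<noteq> 0" "n t \<noteq> 0"
  using transversal[OF assms] by (auto simp: cross2_simps)

lemma (in framed_chart) zero_mem: "0 \<in> ball (0::'k) r"
  using r_pos by simp

lemma all_less_3: "(\<forall>j<length [x, y, z]. Q j) \<longleftrightarrow> Q 0 \<and> Q 1 \<and> Q 2"
  by (auto simp: less_Suc_eq numeral_2_eq_2)

locale billiard_charts =
  a: framed_chart \<alpha> p ra A A1 A2 NA NA1 \<psi>a +
  b: framed_chart \<beta> q rb B B1 B2 NB NB1 \<psi>b +
  c: framed_chart \<gamma> r rc C C1 C2 NC NC1 \<psi>c
  for \<alpha> \<beta> \<gamma> :: "'k::{real_normed_field,banach,euclidean_space} framed_point set"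
    and p q r ra rb rc A A1 A2 NA NA1 \<psi>a B B1 B2 NB NB1 \<psi>b C C1 C2 NC NC1 \<psi>c
begin

definition closes :: "'k \<Rightarrow> 'k \<Rightarrow> 'k \<Rightarrow> bool" where
  "closes s t u \<longleftrightarrow> mirror (A s) (A1 s) (NA s) (B t) (C u) \<and>
    mirror (B t) (B1 t) (NB t) (A s) (C u) \<and> mirror (C u) (C1 u) (NC u) (A s) (B t)"

definition PA where "PA s = (A s, line_dir (A s) (NA s))"
definition PB where "PB t = (B t, line_dir (B t) (NB t))"
definition PC where "PC u = (C u, line_dir (C u) (NC u))"

lemma periodic_orbit_iff_closes:
  assumes s: "s \<in> ball 0 ra" and t: "t \<in> ball 0 rb" and u: "u \<in> ball 0 rc"
  shows "periodic_orbit [\<alpha>, \<beta>, \<gamma>] [PA s, PB t, PC u] \<longleftrightarrow> closes s t u"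
proof -
  \<comment> \<open>In the cyclic order the predecessor of \<open>A\<close> is \<open>C\<close> and
    that of \<open>C\<close> is \<open>B\<close>, so the laws at \<open>A\<close> and
    \<open>C\<close> are read the other way round.\<close>
  have "closes s t u \<longleftrightarrow> mirror (A s) (A1 s) (NA s) (C u) (B t) \<and>
    mirror (B t) (B1 t) (NB t) (A s) (C u) \<and> mirror (C u) (C1 u) (NC u) (B t) (A s)"
    unfolding closes_def using mirror_commute by blast
  then show ?thesis
    unfolding mirror_iff_symmetric[OF a.transversal[OF s], symmetric]
      mirror_iff_symmetric[OF b.transversal[OF t], symmetric]
      mirror_iff_symmetric[OF c.transversal[OF u], symmetric]
    unfolding periodic_orbit_def all_less_3 Let_def
    using a.mem[OF s] b.mem[OF t] c.mem[OF u]
    by (simp add: PA_def PB_def PC_def a.tangent[OF s] b.tangent[OF t] c.tangent[OF u])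
qed

lemma base_points: "p = PA 0" "q = PB 0" "r = PC 0"
  using a.base(2) b.base(2) c.base(2) by (simp_all add: PA_def PB_def PC_def)

lemma base_closes:
  assumes "periodic_orbit [\<alpha>, \<beta>, \<gamma>] [p, q, r]"
  shows "closes 0 0 0"
  using assms periodic_orbit_iff_closes[OF a.zero_mem b.zero_mem c.zero_mem] by (simp add: base_points)

text \<open>The radius \<open>e\<close> keeps the third parameter as small as desired, which the
  continuity argument at a degenerate base orbit relies on.\<close>

lemma reflective_imp_closes:
  assumes refl: "reflective [\<alpha>, \<beta>, \<gamma>] [p, q, r]" and e: "0 < e" "e \<le> rc"
  shows "\<exists>d>0. d \<le> ra \<and> d \<le> rb \<and> (\<forall>s\<in>ball 0 d. \<forall>t\<in>ball 0 d. \<exists>u\<in>ball 0 e. closes s t u)"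
proof -
  obtain O' where O': "open O'" "fst r \<in> O'"
    "\<forall>x\<in>\<gamma>. fst x \<in> O' \<longrightarrow> (\<exists>u\<in>ball 0 e. x = (C u, line_dir (C u) (NC u)))"
    using c.covers[OF e] by blast
  \<comment> \<open>Only the third vertex is confined; for the first two the whole bundle serves as
    neighbourhood.\<close>
  define W where "W j = (if j = (2::nat) then {x \<in> PT. fst x \<in> O'} else {x \<in> PT. fst x \<in> UNIV})" for j
  have PT: "p \<in> PT" "q \<in> PT" "r \<in> PT"
    using line_dir_mem_PT a.nonzero_dirs(2)[OF a.zero_mem] b.nonzero_dirs(2)[OF b.zero_mem]
      c.nonzero_dirs(2)[OF c.zero_mem] by (simp_all add: base_points PA_def PB_def PC_def)
  have "\<forall>j<length [\<alpha>, \<beta>, \<gamma>]. openin PT_topology (W j) \<and> [p, q, r] ! j \<in> W j"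
    unfolding all_less_3 W_def using PT O' openin_PT_fst[OF O'(1)] openin_PT_fst[OF open_UNIV]
    by (simp add: numeral_2_eq_2)
  then obtain U V where UV: "openin PT_topology U" "openin PT_topology V" "p \<in> U" "q \<in> V"
    and orb: "\<forall>p' \<in> \<alpha> \<inter> U. \<forall>q' \<in> \<beta> \<inter> V. \<exists>qs. periodic_orbit [\<alpha>, \<beta>, \<gamma>] qs \<and> qs ! 0 = p' \<and> qs ! 1 = q' \<and>
      (\<forall>j<length [\<alpha>, \<beta>, \<gamma>]. qs ! j \<in> W j)"
    using refl unfolding reflective_def by (auto simp del: length_Cons) 
  obtain e1 where e1: "e1 > 0" "e1 \<le> ra" "\<forall>t\<in>ball 0 e1. PA t \<in> U"
    using a.continuous[OF UV(1,3)] unfolding PA_def by blast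
  obtain e2 where e2: "e2 > 0" "e2 \<le> rb" "\<forall>t\<in>ball 0 e2. PB t \<in> V"
    using b.continuous[OF UV(2,4)] unfolding PB_def by blast
  have "\<exists>u\<in>ball 0 e. closes s t u" if s: "s \<in> ball 0 (min e1 e2)" and t: "t \<in> ball 0 (min e1 e2)" for s t
  proof -
    have st: "s \<in> ball 0 ra" "t \<in> ball 0 rb" "s \<in> ball 0 e1" "t \<in> ball 0 e2"
      using s t e1(2) e2(2) by auto
    have "PA s \<in> \<alpha> \<inter> U" "PB t \<in> \<beta> \<inter> V"
      using st e1(3) e2(3) a.mem b.mem by (auto simp: PA_def PB_def)
    then obtain qs where qs: "periodic_orbit [\<alpha>, \<beta>, \<gamma>] qs" "qs ! 0 = PA s" "qs ! 1 = PB t"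
      "\<forall>j<length [\<alpha>, \<beta>, \<gamma>]. qs ! j \<in> W j"
      using orb by blast
    have len: "length qs = 3" "qs ! 2 \<in> \<gamma>"
      using qs(1) unfolding periodic_orbit_def by (auto simp: numeral_2_eq_2 dest: spec[of _ 2])
    have "fst (qs ! 2) \<in> O'"
      using qs(4) unfolding all_less_3 W_def by simp
    then obtain u where u: "u \<in> ball 0 e" "qs ! 2 = PC u"
      using O'(3) len(2) unfolding PC_def by blast
    have "qs = [PA s, PB t, PC u]"
      using len(1) qs(2,3) u(2) by (intro nth_equalityI) (auto simp: less_Suc_eq numeral_3_eq_3 numeral_2_eq_2)
    then have "closes s t u"
      using periodic_orbit_iff_closes[OF st(1,2), of u] u(1) e(2) qs(1) by auto
    then show ?thesis using u(1) by blast
  qed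
  then show ?thesis
    using e1 e2 by (intro exI[of _ "min e1 e2"]) auto
qed

text \<open>If the sides at \<open>A\<close> were parallel with ratio \<open>k\<close>, the law
  there would equate \<open>2 * k\<close> times two nonzero brackets to 0. If the framing line at
  \<open>B\<close> or \<open>C\<close> contained one side, the law would force the other side into
  it, and the triangle would be flat.\<close>

lemma closes_non_degenerate:
  assumes cl: "closes s t u" and nz: "cross2 (NA s) (B t - A s) \<noteq> 0"
    and dom: "s \<in> ball 0 ra" "t \<in> ball 0 rb" "u \<in> ball 0 rc"
  shows "cross2 (B t - A s) (C u - A s) \<noteq> 0"
    and "cross2 (NB t) (A s - B t) \<noteq> 0" and "cross2 (NC u) (A s - C u) \<noteq> 0"
proof -
  define x where "x = B t - A s"
  define y where "y = C u - A s"
  have d: "A s - B t = - x" "C u - B t = y - x" "A s - C u = - y" "B t - C u = x - y"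
    by (simp_all add: x_def y_def)
  have m: "cross2 (A1 s) x \<noteq> 0" "cross2 (A1 s) y \<noteq> 0"
    "cross2 (A1 s) x * cross2 (NA s) y + cross2 (A1 s) y * cross2 (NA s) x = 0"
    "cross2 (B1 t) x \<noteq> 0" "cross2 (B1 t) (y - x) \<noteq> 0"
    "cross2 (B1 t) (- x) * cross2 (NB t) (y - x) + cross2 (B1 t) (y - x) * cross2 (NB t) (- x) = 0"
    "cross2 (C1 u) y \<noteq> 0" "cross2 (C1 u) (x - y) \<noteq> 0"
    "cross2 (C1 u) (- y) * cross2 (NC u) (x - y) + cross2 (C1 u) (x - y) * cross2 (NC u) (- y) = 0"
    using cl unfolding closes_def mirror_def d x_def[symmetric] y_def[symmetric]
    by (simp_all add: cross2_simps)
  have x: "x \<noteq> 0" using m(1) by (auto simp: cross2_simps)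
  have D: "cross2 x y \<noteq> 0"
  proof
    assume "cross2 x y = 0"
    then obtain k where k: "y = k *s x" using cross2_parallel x by blast
    have "k * (2 * (cross2 (A1 s) x * cross2 (NA s) x)) = 0"
      using m(3) by (simp add: k cross2_simps algebra_simps)
    then have "k = 0" using m(1) nz by (simp add: x_def)
    then show False using m(2) k by (simp add: cross2_simps)
  qed
  then show "cross2 (B t - A s) (C u - A s) \<noteq> 0" by (simp add: x_def y_def)
  have par: "cross2 v w = 0" if z: "cross2 N v = 0" "cross2 N w = 0" "N \<noteq> 0" for N v w :: "'k ^ 2"
  proof -
    obtain k where "v = k *s N" by (rule cross2_parallel[OF z(1,3)])
    moreover obtain l where "w = l *s N" by (rule cross2_parallel[OF z(2,3)])
    ultimately show ?thesis by (simp add: cross2_simps)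
  qed
  have yx: "cross2 y x = - cross2 x y" by (rule cross2_commute)
  show "cross2 (NB t) (A s - B t) \<noteq> 0"
  proof
    assume "cross2 (NB t) (A s - B t) = 0"
    then have 1: "cross2 (NB t) (- x) = 0" by (simp add: d)
    then have "cross2 (NB t) (y - x) = 0" using m(4,6) by (simp add: cross2_simps)
    from par[OF 1 this b.nonzero_dirs(2)[OF dom(2)]] show False using D by (simp add: cross2_simps)
  qed
  show "cross2 (NC u) (A s - C u) \<noteq> 0"
  proof
    assume "cross2 (NC u) (A s - C u) = 0"
    then have 1: "cross2 (NC u) (- y) = 0" by (simp add: d)
    then have "cross2 (NC u) (x - y) = 0" using m(7,9) by (simp add: cross2_simps)
    from par[OF 1 this c.nonzero_dirs(2)[OF dom(3)]] show False using D yx by (simp add: cross2_simps)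
  qed
qed

text \<open>The reflected lines at \<open>A s\<close> and \<open>B t\<close> have directions \<open>vA\<close> and \<open>vB\<close>; the third vertex
  is their intersection, hence determined by the first two.\<close>

definition vA where "vA s t = cross2 (A1 s) (B t - A s) *s NA s + cross2 (NA s) (B t - A s) *s A1 s"
definition vB where "vB s t = cross2 (B1 t) (A s - B t) *s NB t + cross2 (NB t) (A s - B t) *s B1 t"
definition third where
  "third s t = A s + (cross2 (vB s t) (B t - A s) / cross2 (vB s t) (vA s t)) *s vA s t"

text \<open>The law at \<open>A\<close> is linear in \<open>C u - A s\<close> and says that its
  bracket with \<open>vA\<close> vanishes; similarly at \<open>B\<close>. With
  \<open>B t - A s\<close> written as a combination of \<open>vA\<close> and \<open>vB\<close>, the
  bracket with \<open>vB\<close> yields the coefficient of \<open>vA\<close>.\<close>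

lemma third_vertex:
  assumes cl: "closes s t u" and nz: "cross2 (NA s) (B t - A s) \<noteq> 0"
    and dom: "s \<in> ball 0 ra" "t \<in> ball 0 rb" "u \<in> ball 0 rc"
  shows "C u = third s t" "cross2 (vB s t) (vA s t) \<noteq> 0"
proof -
  note nd = closes_non_degenerate[OF assms]
  have eA: "cross2 (vA s t) (C u - A s) = 0" and eB: "cross2 (vB s t) (C u - B t) = 0"
    using cl unfolding closes_def mirror_def vA_def vB_def by (simp_all add: cross2_simps algebra_simps)
  have "cross2 (A1 s) (vA s t) \<noteq> 0"
    using cl a.transversal[OF dom(1)] unfolding closes_def mirror_def vA_def by (simp add: cross2_simps)
  then have vA: "vA s t \<noteq> 0" by (auto simp: cross2_simps)
  have "cross2 (B1 t) (vB s t) \<noteq> 0"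
    using cl b.transversal[OF dom(2)] unfolding closes_def mirror_def vB_def by (simp add: cross2_simps)
  then have vB: "vB s t \<noteq> 0" by (auto simp: cross2_simps)
  obtain x where x: "C u - A s = x *s vA s t" using cross2_parallel[OF eA vA] .
  obtain y where y: "C u - B t = y *s vB s t" using cross2_parallel[OF eB vB] .
  have BA: "B t - A s = x *s vA s t - y *s vB s t"
    unfolding x[symmetric] y[symmetric] by simp
  show vv: "cross2 (vB s t) (vA s t) \<noteq> 0"
  proof
    assume "cross2 (vB s t) (vA s t) = 0"
    then have "cross2 (B t - A s) (C u - A s) = 0"
      unfolding BA x by (simp add: cross2_simps cross2_commute[of "vA s t" "vB s t"])
    then show False using nd(1) by simp
  qed
  have "cross2 (vB s t) (B t - A s) / cross2 (vB s t) (vA s t) = x"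
    unfolding BA using vv by (simp add: cross2_simps)
  then have "third s t = A s + (C u - A s)"
    unfolding third_def x by simp
  then show "C u = third s t" by simp
qed

text \<open>However \<open>u\<close> is chosen pointwise, it equals
  \<open>\<psi>c (third s t)\<close> and is therefore continuous: \<open>third\<close> is rational
  in continuous data with a nonzero denominator, its values lie on the chart of \<open>C\<close>,
  and \<open>\<psi>c\<close> is continuous there.\<close>

lemma family:
  assumes S: "open S" "\<And>s t. (s, t) \<in> S \<Longrightarrow> s \<in> ball 0 ra \<and> t \<in> ball 0 rb"
    and nz: "\<And>s t. (s, t) \<in> S \<Longrightarrow> cross2 (NA s) (B t - A s) \<noteq> 0"
    and u: "\<And>s t. (s, t) \<in> S \<Longrightarrow> u s t \<in> ball 0 rc \<and> closes s t (u s t)"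
  shows "triangle_family A A1 A2 NA B B1 B2 NB C C1 C2 NC NC1 S u"
proof
  fix s t assume st: "(s, t) \<in> S"
  have dom: "s \<in> ball 0 ra" "t \<in> ball 0 rb" "u s t \<in> ball 0 rc" and cl: "closes s t (u s t)"
    using S(2)[OF st] u[OF st] by blast+
  note nd = closes_non_degenerate[OF cl nz[OF st] dom]
  show "has_vd A (A1 s) s" "has_vd A1 (A2 s) s" using a.der dom by blast+
  show "has_vd B (B1 t) t" "has_vd B1 (B2 t) t" "isCont B2 t" using b.der dom by blast+
  show "has_vd C (C1 (u s t)) (u s t)" "has_vd C1 (C2 (u s t)) (u s t)" "isCont C2 (u s t)"
    "has_vd NC (NC1 (u s t)) (u s t)" using c.der dom by blast+
  show "cross2 (A1 s) (NA s) \<noteq> 0" "cross2 (B1 t) (NB t) \<noteq> 0" "cross2 (C1 (u s t)) (NC (u s t)) \<noteq> 0"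
    using a.transversal b.transversal c.transversal dom by blast+
  show "cross2 (NA s) (B t - A s) \<noteq> 0" by (rule nz[OF st])
  show "cross2 (NB t) (A s - B t) \<noteq> 0" "cross2 (NC (u s t)) (A s - C (u s t)) \<noteq> 0"
    "cross2 (B t - A s) (C (u s t) - A s) \<noteq> 0" using nd by blast+
  show "cross2 (A1 s) (B t - A s) * cross2 (NA s) (C (u s t) - A s)
      + cross2 (A1 s) (C (u s t) - A s) * cross2 (NA s) (B t - A s) = 0"
    "cross2 (B1 t) (A s - B t) * cross2 (NB t) (C (u s t) - B t)
      + cross2 (B1 t) (C (u s t) - B t) * cross2 (NB t) (A s - B t) = 0"
    "cross2 (C1 (u s t)) (A s - C (u s t)) * cross2 (NC (u s t)) (B t - C (u s t))
      + cross2 (C1 (u s t)) (B t - C (u s t)) * cross2 (NC (u s t)) (A s - C (u s t)) = 0"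
    "cross2 (A1 s) (B t - A s) \<noteq> 0" "cross2 (A1 s) (C (u s t) - A s) \<noteq> 0"
    "cross2 (B1 t) (A s - B t) \<noteq> 0" "cross2 (B1 t) (C (u s t) - B t) \<noteq> 0"
    "cross2 (C1 (u s t)) (A s - C (u s t)) \<noteq> 0" "cross2 (C1 (u s t)) (B t - C (u s t)) \<noteq> 0"
    using cl unfolding closes_def mirror_def by blast+
  show "isCont (\<lambda>x. u (fst x) (snd x)) (s, t)"
  proof -
    have th: "C (u s' t') = third s' t'" "cross2 (vB s' t') (vA s' t') \<noteq> 0" if "(s', t') \<in> S" for s' t'
      using third_vertex[OF _ nz[OF that]] u[OF that] S(2)[OF that] by blast+
    define X where "X = (s, t)"
    have X: "fst X = s" "snd X = t" by (simp_all add: X_def)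
    have cA: "isCont (\<lambda>x. F (fst x)) X" if "isCont F s" for F :: "'k \<Rightarrow> 'k ^ 2"
      using isCont_o2[of X fst F] that X by (simp add: isCont_fst)
    have cB: "isCont (\<lambda>x. F (snd x)) X" if "isCont F t" for F :: "'k \<Rightarrow> 'k ^ 2"
      using isCont_o2[of X snd F] that X by (simp add: isCont_snd)
    have c: "isCont (\<lambda>x. A (fst x)) X" "isCont (\<lambda>x. A1 (fst x)) X" "isCont (\<lambda>x. NA (fst x)) X"
      "isCont (\<lambda>x. B (snd x)) X" "isCont (\<lambda>x. B1 (snd x)) X" "isCont (\<lambda>x. NB (snd x)) X"
      using a.isCont_chart[OF dom(1)] b.isCont_chart[OF dom(2)] by (auto intro!: cA cB)
    have cv: "isCont (\<lambda>x. vA (fst x) (snd x)) X" "isCont (\<lambda>x. vB (fst x) (snd x)) X"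
      unfolding vA_def vB_def by (intro continuous_add isCont_scale_vec isCont_cross2 continuous_diff c)+
    have cont: "isCont (\<lambda>x. third (fst x) (snd x)) X"
      unfolding third_def
      by (intro continuous_add isCont_scale_vec isCont_cross2 continuous_diff c cv continuous_divide)
        (use th(2)[OF st] X in simp)
    have ev: "\<forall>\<^sub>F x in nhds X. x \<in> S"
      using S(1) st by (intro eventually_nhds_in_open) (simp_all add: X_def)
    have img: "third (fst x) (snd x) \<in> C ` ball 0 rc \<and> \<psi>c (third (fst x) (snd x)) = u (fst x) (snd x)"
      if "x \<in> S" for x
    proof -
      have x: "(fst x, snd x) \<in> S" using that by simp
      then have "u (fst x) (snd x) \<in> ball 0 rc" using u by blast
      then show ?thesis unfolding th(1)[OF x, symmetric] using c.inverse(1) by simp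
    qed
    have "((\<lambda>x. \<psi>c (third (fst x) (snd x))) \<longlongrightarrow> \<psi>c (third s t)) (at X)"
    proof (rule continuous_on_tendsto_compose[OF c.inverse(2)])
      show "((\<lambda>x. third (fst x) (snd x)) \<longlongrightarrow> third s t) (at X)"
        using cont by (simp add: isCont_def X)
      show "third s t \<in> C ` ball 0 rc" using img[OF st] by simp
      have "\<forall>\<^sub>F x in at X. x \<in> S" using ev by (simp add: eventually_nhds_conv_at)
      then show "\<forall>\<^sub>F x in at X. third (fst x) (snd x) \<in> C ` ball 0 rc"
        by eventually_elim (use img in blast)
    qed
    moreover have "\<forall>\<^sub>F x in at X. \<psi>c (third (fst x) (snd x)) = u (fst x) (snd x)"
    proof -
      have "\<forall>\<^sub>F x in at X. x \<in> S" using ev by (simp add: eventually_nhds_conv_at)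
      then show ?thesis by eventually_elim (use img in blast)
    qed
    ultimately have "((\<lambda>x. u (fst x) (snd x)) \<longlongrightarrow> \<psi>c (third s t)) (at X)"
      by (rule Lim_transform_eventually)
    then show ?thesis using img[OF st] by (simp add: isCont_def X_def)
  qed
qed (use S in auto)

end

section \<open>Curves lying on a line, and germs of right-spherical billiards\<close>

lemma covector_parallel:
  fixes v w :: "'k::field ^ 2" and l :: "'k ^ 3"
  assumes "l $ 1 \<noteq> 0 \<or> l $ 2 \<noteq> 0" "sprod l (dir_vec v) = 0" "sprod l (dir_vec w) = 0"
  shows "cross2 v w = 0"
proof -
  have e: "l $ 1 * v $ 1 + l $ 2 * v $ 2 = 0" "l $ 1 * w $ 1 + l $ 2 * w $ 2 = 0"
    using assms(2,3) by (simp_all add: sprod_def)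
  have "l $ 1 * cross2 v w = 0" "l $ 2 * cross2 v w = 0"
    using e unfolding cross2_def by algebra+
  then show ?thesis using assms(1) by auto
qed

lemma covector_chart_nonzero:
  fixes l :: "'k::field ^ 3"
  assumes "l \<noteq> 0" "sprod l (chart_vec X) = 0"
  shows "l $ 1 \<noteq> 0 \<or> l $ 2 \<noteq> 0"
  using assms by (auto simp: sprod_def vec3_eq_iff)

lemma sprod_chart_diff: "sprod l (dir_vec (X - Y)) = sprod l (chart_vec X) - sprod l (chart_vec (Y :: 'k::field ^ 2))"
  by (simp add: sprod_def algebra_simps)

lemma (in framed_chart) tangent_of_line:
  assumes on: "\<And>t. t \<in> ball 0 e \<Longrightarrow> sprod l (chart_vec (\<phi> t)) = 0" and t: "t \<in> ball 0 e" "t \<in> ball 0 r"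
  shows "sprod l (dir_vec (\<phi>1 t)) = 0"
proof -
  note d = has_vd_componentD[OF der(1)[OF t(2)]]
  have "((\<lambda>t. l $ 1 * \<phi> t $ 1 + l $ 2 * \<phi> t $ 2 + l $ 3 * 1) has_field_derivative
      l $ 1 * \<phi>1 t $ 1 + l $ 2 * \<phi>1 t $ 2) (at t)"
    using d[of 1] d[of 2] by (auto intro!: derivative_eq_intros)
  then have "((\<lambda>t. sprod l (chart_vec (\<phi> t))) has_field_derivative sprod l (dir_vec (\<phi>1 t))) (at t)"
    by (simp add: sprod_def)
  moreover have "\<forall>\<^sub>F s in nhds t. s \<in> ball 0 e"
    using t(1) by (intro eventually_nhds_in_open) auto
  then have ev: "\<forall>\<^sub>F s in nhds t. sprod l (chart_vec (\<phi> s)) = 0"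
    by eventually_elim (rule on)
  ultimately have "((\<lambda>t. 0) has_field_derivative sprod l (dir_vec (\<phi>1 t))) (at t)"
    unfolding DERIV_cong_ev[OF refl ev refl] by blast
  then show ?thesis using DERIV_unique DERIV_const by blast
qed

text \<open>A component with nonzero velocity is locally onto, and on the line that component
  determines the point.\<close>

lemma chart_covers_line:
  fixes \<alpha> :: "'k::{real_normed_field,banach,euclidean_space} framed_point set"
  assumes fc: "framed_chart \<alpha> p r \<phi> \<phi>1 \<phi>2 n n1 \<psi>" and e: "0 < e" "e \<le> r"
    and on: "\<And>t. t \<in> ball 0 e \<Longrightarrow> sprod l (chart_vec (\<phi> t)) = 0" and l: "l \<noteq> 0"
  shows "\<exists>\<delta>>0. \<forall>X\<in>ball (\<phi> 0) \<delta>. sprod l (chart_vec X) = 0 \<longrightarrow> (\<exists>t\<in>ball 0 e. X = \<phi> t)"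
proof -
  interpret framed_chart \<alpha> p r \<phi> \<phi>1 \<phi>2 n n1 \<psi> by fact
  have z: "0 \<in> ball (0::'k) e" using e by simp
  note tan = tangent_of_line[OF on z zero_mem]
  have l12: "l $ 1 \<noteq> 0 \<or> l $ 2 \<noteq> 0" using covector_chart_nonzero[OF l on[OF z]] .
  have par: "cross2 (\<phi>1 0) (X - \<phi> 0) = 0" if "sprod l (chart_vec X) = 0" for X
  proof (rule covector_parallel[OF l12 tan])
    have "sprod l (dir_vec (X - \<phi> 0)) = sprod l (chart_vec X) - sprod l (chart_vec (\<phi> 0))"
      by (rule sprod_chart_diff)
    also have "\<dots> = 0" by (simp only: that on[OF z] diff_self)
    finally show "sprod l (dir_vec (X - \<phi> 0)) = 0" .
  qed
  obtain i where i: "\<phi>1 0 $ i \<noteq> 0" using nonzero_dirs(1)[OF zero_mem] by (auto simp: vec_eq_iff)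
  have "continuous_on (ball 0 e) (\<lambda>t. \<phi> t $ i)"
  proof (rule continuous_at_imp_continuous_on, rule ballI)
    fix t :: 'k assume "t \<in> ball 0 e"
    then have "t \<in> ball 0 r" using e by auto
    from DERIV_isCont[OF has_vd_componentD[OF der(1)[OF this]]] show "isCont (\<lambda>t. \<phi> t $ i) t" .
  qed
  from locally_surjective[OF this e(1) has_vd_componentD[OF der(1)[OF zero_mem]] i]
  obtain \<delta> where \<delta>: "\<delta> > 0" "ball (\<phi> 0 $ i) \<delta> \<subseteq> (\<lambda>t. \<phi> t $ i) ` ball 0 e" by blast
  show ?thesis
  proof (intro exI conjI ballI impI)
    show "\<delta> > 0" by fact
    fix X assume X: "X \<in> ball (\<phi> 0) \<delta>" "sprod l (chart_vec X) = 0"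
    have "dist (\<phi> 0 $ i) (X $ i) \<le> dist (\<phi> 0) X" by (rule dist_vec_nth_le)
    then have "X $ i \<in> ball (\<phi> 0 $ i) \<delta>" using X(1) by simp
    then obtain t where t: "t \<in> ball 0 e" "X $ i = \<phi> t $ i" using \<delta>(2) by auto
    have "cross2 (\<phi>1 0) (X - \<phi> t) = 0"
      using par[OF X(2)] par[OF on[OF t(1)]] by (simp add: cross2_simps)
    then obtain k where k: "X - \<phi> t = k *s \<phi>1 0"
      using cross2_parallel[OF _ nonzero_dirs(1)[OF zero_mem]] by blast
    then have "(X - \<phi> t) $ i = k * \<phi>1 0 $ i" by simp
    then have "k = 0" using t(2) i by simp
    then have "X = \<phi> t" using k by simp
    then show "\<exists>t\<in>ball 0 e. X = \<phi> t" using t(1) by blast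
  qed
qed

text \<open>One inclusion holds because the chart exhausts \<alpha> near \<open>p\<close>, the other
  because a straight chart fills its line near the base point.\<close>

lemma chart_same_germ_omega:
  fixes \<alpha> :: "'k::{real_normed_field,banach,euclidean_space} framed_point set"
  assumes fc: "framed_chart \<alpha> p r \<phi> \<phi>1 \<phi>2 n n1 \<psi>" and e: "0 < e" "e \<le> r"
    and det: "sprod (vprod x y) z \<noteq> 0"
    and on: "\<And>t. t \<in> ball 0 e \<Longrightarrow> sprod (vprod x y) (chart_vec (\<phi> t)) = 0"
    and dir: "\<And>t. t \<in> ball 0 e \<Longrightarrow> sprod (line_covec (\<phi> t) (n t)) z = 0"
  shows "same_germ p \<alpha> (omega (proj_join (vec.span {x}) (vec.span {y})) (vec.span {z}))"
proof -
  interpret framed_chart \<alpha> p r \<phi> \<phi>1 \<phi>2 n n1 \<psi> by fact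
  have xy: "vprod x y \<noteq> 0" using det by (auto simp: sprod_simps)
  obtain \<delta> where \<delta>: "\<delta> > 0"
    "\<forall>X\<in>ball (\<phi> 0) \<delta>. sprod (vprod x y) (chart_vec X) = 0 \<longrightarrow> (\<exists>t\<in>ball 0 e. X = \<phi> t)"
    using chart_covers_line[OF fc e on xy] by blast
  obtain O' where O': "open O'" "fst p \<in> O'"
    "\<forall>x\<in>\<alpha>. fst x \<in> O' \<longrightarrow> (\<exists>t\<in>ball 0 e. x = (\<phi> t, line_dir (\<phi> t) (n t)))"
    using covers[OF e] by blast
  define U where "U = {x \<in> PT. fst x \<in> O' \<inter> ball (\<phi> 0) \<delta>}"
  have line: "line_dir (\<phi> t) (n t) = line_dir (\<phi> t) (dir_to (\<phi> t) z)" if t: "t \<in> ball 0 e" for t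
  proof -
    have "t \<in> ball 0 r" using t e by auto
    then have "n t \<noteq> 0" by (rule nonzero_dirs(2))
    moreover have "dir_to (\<phi> t) z \<noteq> 0" by (rule omega_eq(2)[OF det on[OF t]])
    ultimately show ?thesis by (simp add: line_dir_eq_iff cross2_dir_to dir[OF t])
  qed
  have om: "omega (proj_join (vec.span {x}) (vec.span {y})) (vec.span {z})
    = {(A, line_dir A (dir_to A z)) | A. sprod (vprod x y) (chart_vec A) = 0}"
    by (rule omega_eq(1)[OF det])
  have "\<alpha> \<inter> U = omega (proj_join (vec.span {x}) (vec.span {y})) (vec.span {z}) \<inter> U"
  proof (intro equalityI subsetI)
    fix w assume w: "w \<in> \<alpha> \<inter> U"
    then obtain t where t: "t \<in> ball 0 e" "w = (\<phi> t, line_dir (\<phi> t) (n t))"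
      using O'(3) by (auto simp: U_def)
    then have "w \<in> omega (proj_join (vec.span {x}) (vec.span {y})) (vec.span {z})"
      unfolding om using line[OF t(1)] on[OF t(1)] by auto
    then show "w \<in> omega (proj_join (vec.span {x}) (vec.span {y})) (vec.span {z}) \<inter> U"
      using w by simp
  next
    fix w assume w: "w \<in> omega (proj_join (vec.span {x}) (vec.span {y})) (vec.span {z}) \<inter> U"
    then obtain A where A: "w = (A, line_dir A (dir_to A z))" "sprod (vprod x y) (chart_vec A) = 0"
      unfolding om by blast
    then obtain t where t: "t \<in> ball 0 e" "A = \<phi> t" using \<delta>(2) w by (auto simp: U_def)
    then have "w = (\<phi> t, line_dir (\<phi> t) (n t))" using A line by simp
    moreover have "t \<in> ball 0 r" using t e by auto
    ultimately show "w \<in> \<alpha> \<inter> U" using mem w by auto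
  qed
  moreover have "openin PT_topology U" unfolding U_def using O'(1) by (intro openin_PT_fst) auto
  moreover have "p \<in> U"
    using O'(2) \<delta>(1) base line_dir_mem_PT[OF nonzero_dirs(2)[OF zero_mem]] unfolding U_def
    by (metis (mono_tags, lifting) Int_iff centre_in_ball mem_Collect_eq)
  ultimately show ?thesis unfolding same_germ_def by blast
qed

section \<open>Reflective billiards are right-spherical\<close>

context billiard_charts
begin

text \<open>The cyclic symmetry of the triangle turns one concurrency statement into three. The
  nonzero \<open>s\<close>-derivative of \<open>u\<close> serves to reach every parameter of
  \<open>C\<close> near 0.\<close>

lemma family_consequences:
  assumes S: "open S" and fam: "\<forall>(s, t)\<in>S. s \<in> ball 0 ra \<and> t \<in> ball 0 rb \<and>
      cross2 (NA s) (B t - A s) \<noteq> 0 \<and> u s t \<in> ball 0 rc \<and> closes s t (u s t)"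
    and st: "(s, t) \<in> S"
  defines "lA \<equiv> line_covec (A s) (A1 s)" and "lB \<equiv> line_covec (B t) (B1 t)"
    and "lC \<equiv> line_covec (C (u s t)) (C1 (u s t))"
  shows "sprod (line_covec (A s) (NA s)) (vprod lB lC) = 0"
    and "sprod (line_covec (B t) (NB t)) (vprod lC lA) = 0"
    and "sprod (line_covec (C (u s t)) (NC (u s t))) (vprod lA lB) = 0"
    and "sprod (vprod lA lB) lC \<noteq> 0"
    and "cross2 (A1 s) (A2 s) = 0" "cross2 (B1 t) (B2 t) = 0" "cross2 (C1 (u s t)) (C2 (u s t)) = 0"
    and "isCont (\<lambda>s. u s t) s" "isCont (\<lambda>t. u s t) t"
    and "\<exists>g. g \<noteq> 0 \<and> ((\<lambda>s. u s t) has_field_derivative g) (at s)" (is ?goal_a)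
proof -
  interpret tf: triangle_family A A1 A2 NA B B1 B2 NB C C1 C2 NC NC1 S u
    by (rule family[OF S]) (use fam in blast)+
  have cl: "closes s t (u s t)" and dom: "u s t \<in> ball 0 rc" using fam st by blast+
  note bal = tf.brackets_balanced[OF st, unfolded tf.bracket_defs]
  note nt = tf.not_tangent[OF st]
  have D: "cross2 (B t - A s) (C (u s t) - A s) \<noteq> 0" by (rule tf.non_degenerate[OF st])
  have D': "cross2 (C (u s t) - B t) (A s - B t) \<noteq> 0" "cross2 (A s - C (u s t)) (B t - C (u s t)) \<noteq> 0"
    using D by (simp_all add: cross2_def algebra_simps)
  have mA: "mirror (A s) (A1 s) (NA s) (B t) (C (u s t))"
    and mB: "mirror (B t) (B1 t) (NB t) (C (u s t)) (A s)"
    and mC: "mirror (C (u s t)) (C1 (u s t)) (NC (u s t)) (A s) (B t)"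
    using cl mirror_commute unfolding closes_def by blast+
  show "sprod (line_covec (A s) (NA s)) (vprod lB lC) = 0"
    unfolding lB_def lC_def by (rule framing_concurrent_with_tangents[OF D mA nt(4,5,3,6) bal])
  show "sprod (line_covec (B t) (NB t)) (vprod lC lA) = 0"
    unfolding lC_def lA_def
    by (rule framing_concurrent_with_tangents[OF D'(1) mB nt(5,1,6,2)]) (use bal in \<open>simp add: mult_ac\<close>)
  show "sprod (line_covec (C (u s t)) (NC (u s t))) (vprod lA lB) = 0"
    unfolding lA_def lB_def
    by (rule framing_concurrent_with_tangents[OF D'(2) mC nt(1,4,2,3)]) (use bal in \<open>simp add: mult_ac\<close>)
  show "sprod (vprod lA lB) lC \<noteq> 0"
    unfolding lA_def lB_def lC_def by (rule mirror_tangents_independent[OF D nt(1,4,5) bal])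
  show "cross2 (A1 s) (A2 s) = 0" "cross2 (B1 t) (B2 t) = 0" "cross2 (C1 (u s t)) (C2 (u s t)) = 0"
    using tf.curvatures_vanish[OF st] by blast+
  show "isCont (\<lambda>s. u s t) s" "isCont (\<lambda>t. u s t) t" using tf.cont_u_slices[OF st] by blast+
  have "tf.G s t \<noteq> 0" unfolding tf.G_def using tf.nonzero[OF st] by simp
  then show ?goal_a
    using tf.u_partials(1)[OF st] by blast
qed

text \<open>A base orbit lying on a single line is excluded by continuity: neighbouring orbits do not lie
  on a line, so there the framing line at \<open>A 0\<close> is concurrent with the tangents at the other two
  vertices; in the limit the tangent at \<open>C 0\<close> would pass through \<open>B 0\<close>.\<close>

lemma base_non_degenerate:
  assumes reflects: "reflective [\<alpha>, \<beta>, \<gamma>] [p, q, r]"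
  shows "cross2 (NA 0) (B 0 - A 0) \<noteq> 0"
proof
  assume zero: "cross2 (NA 0) (B 0 - A 0) = 0"
  have cl0: "closes 0 0 0" using reflects base_closes by (simp add: reflective_def)
  have m: "cross2 (B1 0) (A 0 - B 0) \<noteq> 0" "cross2 (C1 0) (B 0 - C 0) \<noteq> 0"
    using cl0 by (simp_all add: closes_def mirror_def)
  have NA0: "NA 0 \<noteq> 0" by (rule a.nonzero_dirs(2)[OF a.zero_mem])
  obtain k where k: "B 0 - A 0 = k *s NA 0" using cross2_parallel[OF zero NA0] .
  have "A 0 - B 0 = - (k *s NA 0)" using k by (metis minus_diff_eq)
  \<comment> \<open>The side \<open>B 0 - A 0\<close> is parallel to \<open>NA 0\<close> and not
    tangent at \<open>B 0\<close>, so the curve \<open>B\<close> crosses the framing line of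
    \<open>A 0\<close> transversally.\<close>
  then have BN: "cross2 (NA 0) (B1 0) \<noteq> 0"
    using m(1) cross2_commute[of "NA 0" "B1 0"] by (auto simp: cross2_simps)
  \<comment> \<open>The determinant whose vanishing expresses concurrency of the framing line at
    \<open>A 0\<close> with a tangent of \<open>B\<close> and a tangent of \<open>C\<close>.\<close>
  define F where "F x = sprod (line_covec (A 0) (NA 0))
    (vprod (line_covec (B (fst x)) (B1 (fst x))) (line_covec (C (snd x)) (C1 (snd x))))" for x
  have "F (0, 0) = cross2 (NA 0) (B1 0) * cross2 (C1 0) (B 0 - C 0)"
  proof -
    have "F (0, 0) = cross2 (NA 0) (B1 0) * cross2 (C1 0) (B 0 - C 0)
        + cross2 (NA 0) (B 0 - A 0) * cross2 (B1 0) (C1 0)"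
      unfolding F_def by (simp add: sprod_def cross2_def algebra_simps)
    then show ?thesis using zero by simp
  qed
  then have F0: "F (0, 0) \<noteq> 0" using BN m(2) by simp
  have cB: "isCont (\<lambda>x :: 'k \<times> 'k. f (fst x)) (0, 0)" if "isCont f 0" for f :: "'k \<Rightarrow> 'k ^ 2"
    using isCont_o2[of "(0, 0)" fst f] that by (simp add: isCont_fst)
  have cC: "isCont (\<lambda>x :: 'k \<times> 'k. f (snd x)) (0, 0)" if "isCont f 0" for f :: "'k \<Rightarrow> 'k ^ 2"
    using isCont_o2[of "(0, 0)" snd f] that by (simp add: isCont_snd)
  have "isCont F (0, 0)"
    unfolding F_def sprod_def vprod_nth line_covec_nth
    by (intro continuous_intros isCont_cross2 continuous_component cB cC
        b.isCont_chart[OF b.zero_mem] c.isCont_chart[OF c.zero_mem])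
  from isCont_eventually_nonzero[OF this F0]
  obtain e0 where e0: "e0 > 0" "\<forall>x. dist x (0, 0) < e0 \<longrightarrow> F x \<noteq> 0"
    unfolding eventually_nhds_metric by blast
  define e where "e = min (e0 / 2) rc"
  have e: "0 < e" "e \<le> rc" "e \<le> e0 / 2" using e0(1) c.r_pos by (simp_all add: e_def)
  obtain d where d: "d > 0" "d \<le> ra" "d \<le> rb" "\<forall>s\<in>ball 0 d. \<forall>t\<in>ball 0 d. \<exists>u\<in>ball 0 e. closes s t u"
    using reflective_imp_closes[OF reflects e(1,2)] by blast
  define d' where "d' = min d (e0 / 2)"
  have d': "d' > 0" using d(1) e0(1) by (simp add: d'_def)
  \<comment> \<open>As \<open>B\<close> crosses the framing line of \<open>A 0\<close>
    transversally, it leaves that line within every ball.\<close>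
  have "\<exists>t\<in>ball 0 d'. cross2 (NA 0) (B t - A 0) \<noteq> 0"
  proof (rule ccontr)
    assume "\<not> ?thesis"
    then have all0: "\<And>t. t \<in> ball 0 d' \<Longrightarrow> cross2 (NA 0) (B t - A 0) = 0" by blast
    have "\<forall>\<^sub>F t in nhds 0. t \<in> ball (0::'k) d'"
      using d' by (intro eventually_nhds_in_open) auto
    then have ev: "\<forall>\<^sub>F t in nhds 0. cross2 (NA 0) (B t - A 0) = 0"
      by eventually_elim (rule all0)
    have "((\<lambda>t. cross2 (NA 0) (B t - A 0)) has_field_derivative cross2 (NA 0) (B1 0)) (at 0)"
      using has_vd_cross2[OF has_vd_const has_vd_diff[OF b.der(1)[OF b.zero_mem] has_vd_const], of "NA 0" "A 0"]
      by (simp add: cross2_simps)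
    then have "((\<lambda>t. 0) has_field_derivative cross2 (NA 0) (B1 0)) (at (0::'k))"
      unfolding DERIV_cong_ev[OF refl ev refl] .
    then show False using BN DERIV_unique DERIV_const by blast
  qed
  then obtain t where t: "t \<in> ball 0 d'" "cross2 (NA 0) (B t - A 0) \<noteq> 0" by blast
  \<comment> \<open>An open set of nondegenerate pairs. It avoids \<open>(0, 0)\<close> under the
    assumption to be refuted, but contains \<open>(0, t)\<close>.\<close>
  define S where "S = {x \<in> ball 0 d \<times> ball 0 d. cross2 (NA (fst x)) (B (snd x) - A (fst x)) \<noteq> 0}"
  have S: "open S"
  proof -
    have "continuous_on (ball 0 d \<times> ball 0 d) (\<lambda>x. cross2 (NA (fst x)) (B (snd x) - A (fst x)))"
    proof (rule continuous_at_imp_continuous_on, rule ballI)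
      fix x :: "'k \<times> 'k" assume "x \<in> ball 0 d \<times> ball 0 d"
      then have x: "fst x \<in> ball 0 ra" "snd x \<in> ball 0 rb" using d by auto
      show "isCont (\<lambda>x. cross2 (NA (fst x)) (B (snd x) - A (fst x))) x"
        by (intro isCont_cross2 continuous_diff isCont_o2[where g = NA, OF isCont_fst[OF continuous_ident]]
            isCont_o2[where g = A, OF isCont_fst[OF continuous_ident]]
            isCont_o2[where g = B, OF isCont_snd[OF continuous_ident]]
            a.isCont_chart[OF x(1)] b.isCont_chart[OF x(2)])
    qed
    then have "open (ball 0 d \<times> ball 0 d \<inter> (\<lambda>x. cross2 (NA (fst x)) (B (snd x) - A (fst x))) -` (- {0}))"
      by (rule continuous_open_preimage) (auto intro: open_Times)
    moreover have "S = ball 0 d \<times> ball 0 d \<inter> (\<lambda>x. cross2 (NA (fst x)) (B (snd x) - A (fst x))) -` (- {0})"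
      by (auto simp: S_def)
    ultimately show ?thesis by simp
  qed
  define u where "u s t = (SOME u. u \<in> ball 0 e \<and> closes s t u)" for s t
  have u: "u s t \<in> ball 0 e \<and> closes s t (u s t)" if "(s, t) \<in> S" for s t
  proof -
    have "s \<in> ball 0 d" "t \<in> ball 0 d" using that by (auto simp: S_def)
    then have "\<exists>u. u \<in> ball 0 e \<and> closes s t u" using d(4) by blast
    then show ?thesis unfolding u_def by (rule someI_ex)
  qed
  have st: "(0, t) \<in> S" using t d(1) by (auto simp: S_def d'_def)
  have "sprod (line_covec (A 0) (NA 0)) (vprod (line_covec (B t) (B1 t))
      (line_covec (C (u 0 t)) (C1 (u 0 t)))) = 0"
  proof (rule family_consequences(1)[OF S _ st], safe)
    fix s t assume st: "(s, t) \<in> S"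
    show "s \<in> ball 0 ra" "t \<in> ball 0 rb" using st d(2,3) by (auto simp: S_def)
    show "cross2 (NA s) (B t - A s) = 0 \<Longrightarrow> False" using st by (simp add: S_def)
    show "u s t \<in> ball 0 rc" "closes s t (u s t)" using u[OF st] e(2) by auto
  qed
  then have "F (t, u 0 t) = 0" by (simp add: F_def)
  moreover have "dist (t, u 0 t) (0, 0) < e0"
  proof -
    have "dist (t, u 0 t) (0, 0) \<le> dist t 0 + dist (u 0 t) 0"
      by (simp add: dist_prod_def sqrt_sum_squares_le_sum)
    also have "\<dots> < e0 / 2 + e0 / 2"
      using t(1) u[OF st] e(3) by (intro add_strict_mono) (auto simp: d'_def)
    finally show ?thesis by simp
  qed
  ultimately show False using e0(2) by blast
qed


text \<open>The family is evaluated on the axes \<open>t = 0\<close> and \<open>s = 0\<close>: there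
  one of the two relevant tangents is proportional to a base tangent by choice, the other by
  straightness, so that the framing lines pass through a fixed point.\<close>

lemma reflective_imp_right_spherical:
  assumes reflects: "reflective [\<alpha>, \<beta>, \<gamma>] [p, q, r]"
  shows "\<exists>P Q R. proj_point P \<and> proj_point Q \<and> proj_point R \<and> non_collinear P Q R \<and>
    same_germ p \<alpha> (omega (proj_join P Q) R) \<and>
    same_germ q \<beta> (omega (proj_join Q R) P) \<and>
    same_germ r \<gamma> (omega (proj_join R P) Q)"
proof -
  have cl0: "closes 0 0 0" using reflects base_closes by (simp add: reflective_def)
  have N0: "cross2 (NA 0) (B 0 - A 0) \<noteq> 0" by (rule base_non_degenerate[OF reflects])
  have "isCont (\<lambda>x :: 'k \<times> 'k. cross2 (NA (fst x)) (B (snd x) - A (fst x))) (0, 0)"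
    by (intro isCont_cross2 continuous_diff isCont_o2[where g = NA, OF isCont_fst[OF continuous_ident]]
        isCont_o2[where g = A, OF isCont_fst[OF continuous_ident]]
        isCont_o2[where g = B, OF isCont_snd[OF continuous_ident]])
      (use a.isCont_chart[OF a.zero_mem] b.isCont_chart[OF b.zero_mem] in simp_all)
  from isCont_eventually_nonzero[OF this] N0
  obtain d0 where d0: "d0 > 0"
    "\<forall>x. dist x (0, 0) < d0 \<longrightarrow> cross2 (NA (fst x)) (B (snd x) - A (fst x)) \<noteq> 0"
    unfolding eventually_nhds_metric by auto
  obtain d where d: "d > 0" "d \<le> ra" "d \<le> rb" "\<forall>s\<in>ball 0 d. \<forall>t\<in>ball 0 d. \<exists>u\<in>ball 0 rc. closes s t u"
    using reflective_imp_closes[OF reflects c.r_pos order_refl] by blast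
  define d1 where "d1 = min d (d0 / 2)"
  have d1: "d1 > 0" "d1 \<le> ra" "d1 \<le> rb" "d1 \<le> d" "d1 \<le> d0 / 2"
    using d d0(1) by (auto simp: d1_def)
  define S where "S = ball (0::'k) d1 \<times> ball (0::'k) d1"
  have S: "open S" by (auto simp: S_def intro: open_Times)
  have dom: "s \<in> ball 0 ra \<and> t \<in> ball 0 rb" if "(s, t) \<in> S" for s t
    using that d1 by (auto simp: S_def)
  have nz: "cross2 (NA s) (B t - A s) \<noteq> 0" if "(s, t) \<in> S" for s t
  proof -
    have "dist (s, t) (0, 0) \<le> dist s 0 + dist t 0"
      by (simp add: dist_prod_def sqrt_sum_squares_le_sum)
    also have "\<dots> < d0 / 2 + d0 / 2"
      using that d1(5) by (intro add_strict_mono) (auto simp: S_def)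
    finally show ?thesis using d0(2) by (metis field_sum_of_halves fst_conv snd_conv)
  qed
  define u where "u s t = (SOME u. u \<in> ball 0 rc \<and> closes s t u)" for s t
  have u: "u s t \<in> ball 0 rc \<and> closes s t (u s t)" if "(s, t) \<in> S" for s t
  proof -
    have "s \<in> ball 0 d" "t \<in> ball 0 d" using that d1(4) by (auto simp: S_def)
    then have "\<exists>u. u \<in> ball 0 rc \<and> closes s t u" using d(4) by blast
    then show ?thesis unfolding u_def by (rule someI_ex)
  qed
  have "\<forall>(s, t)\<in>S. s \<in> ball 0 ra \<and> t \<in> ball 0 rb \<and>
      cross2 (NA s) (B t - A s) \<noteq> 0 \<and> u s t \<in> ball 0 rc \<and> closes s t (u s t)"
    using dom nz u by blast
  note fc = family_consequences[OF S this]
  have S0: "(s, 0) \<in> S" "(0, s) \<in> S" if "s \<in> ball 0 d1" for s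
    using that d1(1) by (auto simp: S_def)
  have z: "0 \<in> ball (0::'k) d1" using d1(1) by simp
  \<comment> \<open>The chosen \<open>u 0 0\<close> is the base parameter, because the third vertex
    is determined by the first two and \<open>\<psi>c\<close> inverts the chart.\<close>
  have u00: "u 0 0 = 0"
  proof -
    have "C (u 0 0) = third 0 0" "C 0 = third 0 0"
      using third_vertex(1) u[OF S0(1)[OF z]] cl0 N0 a.zero_mem b.zero_mem c.zero_mem by blast+
    then show ?thesis
      using c.inverse(1)[of "u 0 0"] c.inverse(1)[OF c.zero_mem] u[OF S0(1)[OF z]] by simp
  qed
  have sub: "s \<in> ball 0 ra" "s \<in> ball 0 rb" if "s \<in> ball 0 d1" for s
    using that d1 by auto
  obtain ea where ea: "ea > 0" "ea \<le> d1"
    "\<forall>s\<in>ball 0 ea. cross2 (A1 0) (A1 s) = 0 \<and> cross2 (A1 0) (A s - A 0) = 0"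
  proof -
    have "\<exists>e>0. e \<le> d1 \<and> (\<forall>s\<in>ball 0 e. cross2 (A1 0) (A1 s) = 0 \<and> cross2 (A1 0) (A s - A 0) = 0)"
      by (rule straight_if_curvature_zero[OF d1(1)], rule a.der(1)[OF sub(1)], assumption,
          rule a.der(2)[OF sub(1)], assumption, rule fc(5)[OF S0(1)], assumption,
          rule a.nonzero_dirs(1)[OF a.zero_mem])
    with that show thesis by blast
  qed
  obtain eb where eb: "eb > 0" "eb \<le> d1"
    "\<forall>t\<in>ball 0 eb. cross2 (B1 0) (B1 t) = 0 \<and> cross2 (B1 0) (B t - B 0) = 0"
  proof -
    have "\<exists>e>0. e \<le> d1 \<and> (\<forall>t\<in>ball 0 e. cross2 (B1 0) (B1 t) = 0 \<and> cross2 (B1 0) (B t - B 0) = 0)"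
      by (rule straight_if_curvature_zero[OF d1(1)], rule b.der(1)[OF sub(2)], assumption,
          rule b.der(2)[OF sub(2)], assumption, rule fc(6)[OF S0(2)], assumption,
          rule b.nonzero_dirs(1)[OF b.zero_mem])
    with that show thesis by blast
  qed
  obtain g where g: "g \<noteq> 0" "((\<lambda>s. u s 0) has_field_derivative g) (at 0)"
    using fc(10)[OF S0(1)[OF z]] by blast
  have cont_u: "continuous_on (ball 0 ea) (\<lambda>s. u s 0)"
    using fc(8)[OF S0(1)] ea(2) by (intro continuous_at_imp_continuous_on) auto
  \<comment> \<open>The curvature and framing of \<open>C\<close> are known at parameters
    \<open>u s 0\<close> only; these fill a ball around 0.\<close>
  obtain \<delta> where \<delta>: "\<delta> > 0" "ball 0 \<delta> \<subseteq> (\<lambda>s. u s 0) ` ball 0 ea"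
    using locally_surjective[OF cont_u ea(1) g(2,1)] u00 by auto
  define d2 where "d2 = min \<delta> rc"
  have d2: "d2 > 0" "d2 \<le> rc" "d2 \<le> \<delta>" using \<delta>(1) c.r_pos by (simp_all add: d2_def)
  have hit: "\<exists>s\<in>ball 0 ea. v = u s 0" if "v \<in> ball 0 d2" for v
  proof -
    have "v \<in> ball 0 \<delta>" using that d2(3) by auto
    then show ?thesis using \<delta>(2) by blast
  qed
  obtain ec where ec: "ec > 0" "ec \<le> d2"
    "\<forall>v\<in>ball 0 ec. cross2 (C1 0) (C1 v) = 0 \<and> cross2 (C1 0) (C v - C 0) = 0"
  proof -
    have curv: "cross2 (C1 v) (C2 v) = 0" if v: "v \<in> ball 0 d2" for v
    proof -
      obtain s where s: "s \<in> ball 0 ea" "v = u s 0" using hit[OF v] by blast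
      then have "s \<in> ball 0 d1" using ea(2) by auto
      from fc(7)[OF S0(1)[OF this]] show ?thesis by (simp add: s(2))
    qed
    have sub': "v \<in> ball 0 rc" if "v \<in> ball 0 d2" for v using that d2(2) by auto
    have "\<exists>e>0. e \<le> d2 \<and> (\<forall>v\<in>ball 0 e. cross2 (C1 0) (C1 v) = 0 \<and> cross2 (C1 0) (C v - C 0) = 0)"
      by (rule straight_if_curvature_zero[OF d2(1)], rule c.der(1)[OF sub'], assumption,
          rule c.der(2)[OF sub'], assumption, rule curv, assumption,
          rule c.nonzero_dirs(1)[OF c.zero_mem])
    with that show thesis by blast
  qed
  define lA where "lA = line_covec (A 0) (A1 0)"
  define lB where "lB = line_covec (B 0) (B1 0)"
  define lC where "lC = line_covec (C 0) (C1 0)"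
  define \<Delta> where "\<Delta> = sprod (vprod lA lB) lC"
  have \<Delta>: "\<Delta> \<noteq> 0"
    using fc(4)[OF S0(1)[OF z]] by (simp add: u00 \<Delta>_def lA_def lB_def lC_def)
  have \<Delta>': "sprod (vprod lB lC) lA = \<Delta>" "sprod (vprod lC lA) lB = \<Delta>"
    unfolding \<Delta>_def by (metis vprod_swap)+
  \<comment> \<open>On a straight arc all tangent covectors agree up to nonzero factors, which do
    not affect concurrency.\<close>
  have shiftA: "\<exists>k. k \<noteq> 0 \<and> line_covec (A s) (A1 s) = k *s lA" if s: "s \<in> ball 0 ea" for s
  proof -
    have "s \<in> ball 0 ra" using s ea(2) d1(2) by auto
    then show ?thesis
      unfolding lA_def using line_covec_shift[OF a.nonzero_dirs(1)[OF a.zero_mem] a.nonzero_dirs(1)] ea(3) s by blast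
  qed
  have shiftC: "\<exists>k. k \<noteq> 0 \<and> line_covec (C v) (C1 v) = k *s lC" if v: "v \<in> ball 0 ec" for v
  proof -
    have "v \<in> ball 0 rc" using v ec(2) d2(2) by auto
    then show ?thesis
      unfolding lC_def using line_covec_shift[OF c.nonzero_dirs(1)[OF c.zero_mem] c.nonzero_dirs(1)] ec(3) v by blast
  qed
  \<comment> \<open>The vertices of the triangle formed by the three boundary lines:
    \<open>P\<close> and \<open>Q\<close> lie on \<open>lA\<close>, and \<open>R\<close>, through
    which the framing lines of \<alpha> pass, is the intersection of \<open>lB\<close> and
    \<open>lC\<close>.\<close>
  define P where "P = vprod lC lA"
  define Q where "Q = vprod lA lB"
  define R where "R = vprod lB lC"
  have PQ: "vprod P Q = \<Delta> *s lA" and QR: "vprod Q R = \<Delta> *s lB" and RP: "vprod R P = \<Delta> *s lC"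
    unfolding P_def Q_def R_def by (simp_all only: vprod_vprod \<Delta>' \<Delta>_def[symmetric])
  have det: "sprod (vprod P Q) R \<noteq> 0" "sprod (vprod Q R) P \<noteq> 0" "sprod (vprod R P) Q \<noteq> 0"
  proof -
    have "sprod lA R = \<Delta>" using \<Delta>'(1) unfolding R_def by (simp add: sprod_def mult.commute)
    then show 1: "sprod (vprod P Q) R \<noteq> 0" using \<Delta> by (simp add: PQ sprod_simps)
    then show "sprod (vprod Q R) P \<noteq> 0" "sprod (vprod R P) Q \<noteq> 0"
      by (metis vprod_swap)+
  qed
  have PQR: "P \<noteq> 0" "Q \<noteq> 0" "R \<noteq> 0" using \<Delta> \<Delta>' by (auto simp: P_def Q_def R_def \<Delta>_def sprod_simps)
  \<comment> \<open>Here \<open>s\<close> is restricted so that \<open>u s 0\<close> stays in the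
    part of \<open>C\<close> known to be straight.\<close>
  obtain e1 where e1: "e1 > 0" "\<forall>s. dist s 0 < e1 \<longrightarrow> u s 0 \<in> ball 0 ec"
  proof -
    have "\<forall>\<^sub>F v in nhds (u 0 0). v \<in> ball 0 ec"
      using ec(1) by (intro eventually_nhds_in_open) (simp_all add: u00)
    from isCont_eventually[OF fc(8)[OF S0(1)[OF z]] this] that show thesis
      unfolding eventually_nhds_metric by blast
  qed
  obtain e2 where e2: "e2 > 0" "\<forall>t. dist t 0 < e2 \<longrightarrow> u 0 t \<in> ball 0 ec"
  proof -
    have "\<forall>\<^sub>F v in nhds (u 0 0). v \<in> ball 0 ec"
      using ec(1) by (intro eventually_nhds_in_open) (simp_all add: u00)
    from isCont_eventually[OF fc(9)[OF S0(1)[OF z]] this] that show thesis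
      unfolding eventually_nhds_metric by blast
  qed
  have "same_germ p \<alpha> (omega (proj_join (vec.span {P}) (vec.span {Q})) (vec.span {R}))"
  proof (rule chart_same_germ_omega[OF a.framed_chart_axioms _ _ det(1)])
    show "0 < min ea e1" "min ea e1 \<le> ra" using ea e1 d1 by auto
    fix s :: 'k assume s: "s \<in> ball 0 (min ea e1)"
    then have s': "s \<in> ball 0 ea" "s \<in> ball 0 d1" "u s 0 \<in> ball 0 ec" using ea(2) e1(2) by auto
    show "sprod (vprod P Q) (chart_vec (A s)) = 0"
      using ea(3) s'(1) by (simp add: PQ sprod_simps lA_def sprod_line_covec)
    obtain k where k: "k \<noteq> 0" "line_covec (C (u s 0)) (C1 (u s 0)) = k *s lC"
      using shiftC[OF s'(3)] by blast
    from fc(1)[OF S0(1)[OF s'(2)]] show "sprod (line_covec (A s) (NA s)) R = 0"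
      using k(1) by (simp add: k(2) vprod_scale sprod_simps R_def lB_def)
  qed
  moreover have "same_germ q \<beta> (omega (proj_join (vec.span {Q}) (vec.span {R})) (vec.span {P}))"
  proof (rule chart_same_germ_omega[OF b.framed_chart_axioms _ _ det(2)])
    show "0 < min eb e2" "min eb e2 \<le> rb" using eb e2 d1 by auto
    fix t :: 'k assume t: "t \<in> ball 0 (min eb e2)"
    then have t': "t \<in> ball 0 eb" "t \<in> ball 0 d1" "u 0 t \<in> ball 0 ec" using eb(2) e2(2) by auto
    show "sprod (vprod Q R) (chart_vec (B t)) = 0"
      using eb(3) t'(1) by (simp add: QR sprod_simps lB_def sprod_line_covec)
    obtain k where k: "k \<noteq> 0" "line_covec (C (u 0 t)) (C1 (u 0 t)) = k *s lC"
      using shiftC[OF t'(3)] by blast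
    from fc(2)[OF S0(2)[OF t'(2)]] show "sprod (line_covec (B t) (NB t)) P = 0"
      using k(1) by (simp add: k(2) vprod_scale sprod_simps P_def lA_def)
  qed
  moreover have "same_germ r \<gamma> (omega (proj_join (vec.span {R}) (vec.span {P})) (vec.span {Q}))"
  proof (rule chart_same_germ_omega[OF c.framed_chart_axioms _ _ det(3)])
    show "0 < ec" "ec \<le> rc" using ec d2 by auto
    fix v :: 'k assume v: "v \<in> ball 0 ec"
    show "sprod (vprod R P) (chart_vec (C v)) = 0"
      using ec(3) v by (simp add: RP sprod_simps lC_def sprod_line_covec)
    have "v \<in> ball 0 d2" using v ec(2) by auto
    then obtain s where s: "s \<in> ball 0 ea" "v = u s 0" using hit by blast
    then have s': "s \<in> ball 0 d1" using ea(2) by auto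
    obtain k where k: "k \<noteq> 0" "line_covec (A s) (A1 s) = k *s lA"
      using shiftA[OF s(1)] by blast
    from fc(3)[OF S0(1)[OF s']] show "sprod (line_covec (C v) (NC v)) Q = 0"
      using k(1) by (simp add: k(2) vprod_scale sprod_simps Q_def lB_def s(2))
  qed
  moreover have "non_collinear (vec.span {P}) (vec.span {Q}) (vec.span {R})"
    using non_collinear_iff[OF PQR(1)] det(1) by blast
  ultimately show ?thesis
    using PQR[THEN proj_point_span_singleton] by blast
qed

end

section \<open>Right-spherical billiards are reflective\<close>

lemma (in framed_chart) germ_of_omega:
  assumes germ: "same_germ p \<alpha> (omega (proj_join (vec.span {x}) (vec.span {y})) (vec.span {z}))"
    and det: "sprod (vprod x y) z \<noteq> 0"
  shows "\<exists>e>0. e \<le> r \<and> (\<forall>t\<in>ball 0 e. sprod (vprod x y) (chart_vec (\<phi> t)) = 0 \<and>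
    sprod (vprod x y) (dir_vec (\<phi>1 t)) = 0 \<and> sprod (line_covec (\<phi> t) (n t)) z = 0)"
proof -
  obtain U where U: "openin PT_topology U" "p \<in> U"
    "\<alpha> \<inter> U = omega (proj_join (vec.span {x}) (vec.span {y})) (vec.span {z}) \<inter> U"
    using germ unfolding same_germ_def by blast
  obtain e where e: "e > 0" "e \<le> r" "\<forall>t\<in>ball 0 e. (\<phi> t, line_dir (\<phi> t) (n t)) \<in> U"
    using continuous[OF U(1,2)] by blast
  have *: "sprod (vprod x y) (chart_vec (\<phi> t)) = 0 \<and> sprod (line_covec (\<phi> t) (n t)) z = 0"
    if t: "t \<in> ball 0 e" for t
  proof -
    have tr: "t \<in> ball 0 r" using t e by auto
    then have "(\<phi> t, line_dir (\<phi> t) (n t)) \<in> omega (proj_join (vec.span {x}) (vec.span {y})) (vec.span {z})"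
      using U(3) e(3) t mem by blast
    then have 1: "sprod (vprod x y) (chart_vec (\<phi> t)) = 0"
      and 2: "line_dir (\<phi> t) (n t) = line_dir (\<phi> t) (dir_to (\<phi> t) z)"
      unfolding omega_eq(1)[OF det] by auto
    have "cross2 (n t) (dir_to (\<phi> t) z) = 0"
      using 2 line_dir_eq_iff[OF nonzero_dirs(2)[OF tr] omega_eq(2)[OF det 1]] by blast
    with 1 show ?thesis by (simp add: cross2_dir_to)
  qed
  moreover have "sprod (vprod x y) (dir_vec (\<phi>1 t)) = 0" if t: "t \<in> ball 0 e" for t
    by (rule tangent_of_line[where e = e]) (use * t e in auto)
  ultimately show ?thesis using e by blast
qed

lemma orthogonal_imp_parallel:
  fixes l p q :: "'k::field ^ 3"
  assumes "sprod l p = 0" "sprod l q = 0" "l \<noteq> 0"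
  obtains k where "vprod p q = k *s l"
proof -
  have "vprod l (vprod p q) = sprod l q *s p - sprod l p *s q"
    by (simp add: vec3_eq_iff sprod_def algebra_simps)
  then have "vprod l (vprod p q) = 0" using assms by simp
  then show thesis using vprod_parallel assms(3) that by blast
qed

lemma line_covec_eq_vprod: "line_covec A v = vprod (chart_vec A) (dir_vec v)"
  by (simp add: vec3_eq_iff cross2_def)

lemma line_covec_nonzero: "v \<noteq> 0 \<Longrightarrow> line_covec A v \<noteq> 0"
  by (auto simp: vec3_eq_iff vec2_eq_iff)

lemma tangent_covec:
  fixes A T X :: "'k::field ^ 2"
  assumes "sprod l (chart_vec A) = 0" "sprod l (dir_vec T) = 0" "l \<noteq> 0" "T \<noteq> 0"
  obtains k where "k \<noteq> 0" "\<And>X. cross2 T (X - A) = k * sprod l (chart_vec X)"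
proof -
  obtain k where k: "line_covec A T = k *s l"
    unfolding line_covec_eq_vprod using orthogonal_imp_parallel[OF assms(1-3)] .
  have "k \<noteq> 0" using k line_covec_nonzero[OF assms(4), of A] by auto
  moreover have "cross2 T (X - A) = k * sprod l (chart_vec X)" for X
    unfolding sprod_line_covec[symmetric] k by (simp add: sprod_simps)
  ultimately show thesis using that by blast
qed

text \<open>Up to nonzero factors, \<open>T\<close>-brackets are coordinates along \<open>z\<close>
  and \<open>N\<close>-brackets are pairings with the line joining \<open>A\<close> to
  \<open>z\<close>. The resulting equation is invariant under cyclic permutation of the
  vertices.\<close>

lemma mirror_equation_coordinates:
  fixes x y z :: "'k::field ^ 3" and A B C T N :: "'k ^ 2"
  assumes det: "sprod (vprod x y) z \<noteq> 0" and nz: "T \<noteq> 0" "N \<noteq> 0"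
    and T: "sprod (vprod x y) (dir_vec T) = 0" and N: "sprod (line_covec A N) z = 0"
    and A: "chart_vec A = a1 *s x + a2 *s y" and B: "chart_vec B = b1 *s y + b2 *s z"
    and C: "chart_vec C = c1 *s z + c2 *s x"
  shows "cross2 T (B - A) * cross2 N (C - A) + cross2 T (C - A) * cross2 N (B - A) = 0
    \<longleftrightarrow> a2 * b2 * c2 = a1 * b1 * c1"
proof -
  let ?d = "sprod (vprod x y) z"
  have l: "vprod x y \<noteq> 0" using det by (auto simp: sprod_simps)
  have lA: "sprod (vprod x y) (chart_vec A) = 0" by (simp only: A sprod_simps) simp
  obtain k where k: "k \<noteq> 0" "\<And>X. cross2 T (X - A) = k * sprod (vprod x y) (chart_vec X)"
    using tangent_covec[OF lA T l nz(1)] by blast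
  have "sprod (line_covec A N) (chart_vec A) = 0" by (simp add: sprod_line_covec cross2_simps(10))
  then obtain m where m: "vprod (chart_vec A) z = m *s line_covec A N"
    using orthogonal_imp_parallel[OF _ N line_covec_nonzero[OF nz(2)]] by blast
  \<comment> \<open>The points \<open>A\<close> and \<open>z\<close> are distinct: otherwise both
    coordinates of \<open>A\<close> would vanish, although the third component of
    \<open>chart_vec A\<close> is 1.\<close>
  have "m \<noteq> 0"
  proof
    assume "m = 0"
    then have 0: "vprod (chart_vec A) z = 0" using m by simp
    have "sprod (vprod (chart_vec A) z) x = a2 * ?d" "sprod (vprod (chart_vec A) z) y = a1 * - ?d"
      unfolding A by (simp_all add: sprod_def algebra_simps)
    then have "a1 = 0" "a2 = 0" using det unfolding 0 by (simp_all add: sprod_simps)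
    then have "chart_vec A $ 3 = 0" using A by simp
    then show False by simp
  qed
  have mN: "m * cross2 N (X - A) = sprod (vprod (chart_vec A) z) (chart_vec X)" for X
    unfolding m by (simp add: sprod_simps sprod_line_covec)
  have "m * (cross2 T (B - A) * cross2 N (C - A) + cross2 T (C - A) * cross2 N (B - A))
    = cross2 T (B - A) * (m * cross2 N (C - A)) + cross2 T (C - A) * (m * cross2 N (B - A))"
    by (simp add: algebra_simps)
  also have "\<dots> = k * (sprod (vprod x y) (chart_vec B) * sprod (vprod (chart_vec A) z) (chart_vec C)
      + sprod (vprod x y) (chart_vec C) * sprod (vprod (chart_vec A) z) (chart_vec B))"
    unfolding mN k(2) by (simp add: algebra_simps)
  also have "\<dots> = k * ((b2 * ?d) * - (a2 * c2 * - ?d) + (c1 * ?d) * (a1 * b1 * - ?d))"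
  proof -
    have "sprod (vprod x y) (chart_vec B) = b2 * ?d" "sprod (vprod x y) (chart_vec C) = c1 * ?d"
      unfolding B C by (simp_all only: sprod_simps) simp_all
    moreover have "sprod (vprod (chart_vec A) z) (chart_vec C) = - (a2 * c2 * - ?d)"
      unfolding A C by (simp add: sprod_def algebra_simps)
    moreover have "sprod (vprod (chart_vec A) z) (chart_vec B) = a1 * b1 * - ?d"
      unfolding A B by (simp add: sprod_def algebra_simps)
    ultimately show ?thesis by (simp only:)
  qed
  finally have "m * (cross2 T (B - A) * cross2 N (C - A) + cross2 T (C - A) * cross2 N (B - A))
    = k * ?d\<^sup>2 * (a2 * b2 * c2 - a1 * b1 * c1)"
    by (simp add: algebra_simps power2_eq_square)
  then show ?thesis
    using \<open>m \<noteq> 0\<close> k(1) det by (metis mult_eq_0_iff power_not_zero eq_iff_diff_eq_0)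
qed

lemma coordinates_in_basis:
  fixes x y z v :: "'k::field ^ 3"
  assumes det: "sprod (vprod x y) z \<noteq> 0" and v: "sprod (vprod x y) v = 0"
  shows "v = (sprod (vprod y z) v / sprod (vprod x y) z) *s x + (sprod (vprod z x) v / sprod (vprod x y) z) *s y"
proof -
  have "sprod (vprod x y) z *s v = sprod (vprod y z) v *s x + sprod (vprod z x) v *s y + sprod (vprod x y) v *s z"
    by (simp add: vec3_eq_iff sprod_def algebra_simps)
  then have e: "sprod (vprod x y) z *s v = sprod (vprod y z) v *s x + sprod (vprod z x) v *s y"
    using v by simp
  have "v = (1 / sprod (vprod x y) z) *s (sprod (vprod x y) z *s v)"
    using det by (simp add: vector_smult_assoc)
  then show ?thesis unfolding e by (simp add: vec_eq_iff add_divide_distrib)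
qed

lemma isCont_sprod_chart:
  fixes f :: "'a::t2_space \<Rightarrow> 'k::real_normed_field ^ 2"
  assumes "isCont f a"
  shows "isCont (\<lambda>y. sprod l (chart_vec (f y))) a"
  unfolding sprod_def chart_vec_nth using assms by (intro continuous_intros continuous_component)

context billiard_charts
begin

text \<open>For given first two vertices the closing equation is linear in the coordinates of the
  third and is solved by \<open>Z\<close>. This point is affine, lies on the line of \<gamma> and is
  close to the base point, hence it belongs to the arc.\<close>

lemma right_spherical_imp_reflective:
  assumes orbit: "periodic_orbit [\<alpha>, \<beta>, \<gamma>] [p, q, r]"
    and det: "sprod (vprod x y) z \<noteq> 0"
    and germs: "same_germ p \<alpha> (omega (proj_join (vec.span {x}) (vec.span {y})) (vec.span {z}))"
      "same_germ q \<beta> (omega (proj_join (vec.span {y}) (vec.span {z})) (vec.span {x}))"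
      "same_germ r \<gamma> (omega (proj_join (vec.span {z}) (vec.span {x})) (vec.span {y}))"
  shows "reflective [\<alpha>, \<beta>, \<gamma>] [p, q, r]"
proof -
  let ?d = "sprod (vprod x y) z"
  have dets: "sprod (vprod y z) x = ?d" "sprod (vprod z x) y = ?d"
    using vprod_swap by metis+
  obtain ea where ea: "ea > 0" "ea \<le> ra" "\<forall>s\<in>ball 0 ea. sprod (vprod x y) (chart_vec (A s)) = 0 \<and>
    sprod (vprod x y) (dir_vec (A1 s)) = 0 \<and> sprod (line_covec (A s) (NA s)) z = 0"
    using a.germ_of_omega[OF germs(1) det] by blast
  obtain eb where eb: "eb > 0" "eb \<le> rb" "\<forall>s\<in>ball 0 eb. sprod (vprod y z) (chart_vec (B s)) = 0 \<and>
    sprod (vprod y z) (dir_vec (B1 s)) = 0 \<and> sprod (line_covec (B s) (NB s)) x = 0"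
    using b.germ_of_omega[OF germs(2)] dets det by auto
  obtain ec where ec: "ec > 0" "ec \<le> rc" "\<forall>s\<in>ball 0 ec. sprod (vprod z x) (chart_vec (C s)) = 0 \<and>
    sprod (vprod z x) (dir_vec (C1 s)) = 0 \<and> sprod (line_covec (C s) (NC s)) y = 0"
    using c.germ_of_omega[OF germs(3)] dets det by auto
  \<comment> \<open>Coordinates with respect to \<open>x\<close>, \<open>y\<close>,
    \<open>z\<close>, left undivided by the determinant \<open>?d\<close>.\<close>
  define a1 where "a1 s = sprod (vprod y z) (chart_vec (A s))" for s
  define a2 where "a2 s = sprod (vprod z x) (chart_vec (A s))" for s
  define b1 where "b1 t = sprod (vprod z x) (chart_vec (B t))" for t
  define b2 where "b2 t = sprod (vprod x y) (chart_vec (B t))" for t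
  define c1 where "c1 u = sprod (vprod x y) (chart_vec (C u))" for u
  define c2 where "c2 u = sprod (vprod y z) (chart_vec (C u))" for u
  have coords:
    "s \<in> ball 0 ea \<Longrightarrow> chart_vec (A s) = (a1 s / ?d) *s x + (a2 s / ?d) *s y"
    "t \<in> ball 0 eb \<Longrightarrow> chart_vec (B t) = (b1 t / ?d) *s y + (b2 t / ?d) *s z"
    "u \<in> ball 0 ec \<Longrightarrow> chart_vec (C u) = (c1 u / ?d) *s z + (c2 u / ?d) *s x" for s t u
    using coordinates_in_basis[of x y z "chart_vec (A s)"] coordinates_in_basis[of y z x "chart_vec (B t)"]
      coordinates_in_basis[of z x y "chart_vec (C u)"] ea(3) eb(3) ec(3) det dets
    unfolding a1_def a2_def b1_def b2_def c1_def c2_def by simp_all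
  have sub: "s \<in> ball 0 ea \<Longrightarrow> s \<in> ball 0 ra" "s \<in> ball 0 eb \<Longrightarrow> s \<in> ball 0 rb"
    "s \<in> ball 0 ec \<Longrightarrow> s \<in> ball 0 rc" for s
    using ea(2) eb(2) ec(2) by auto
  have d3: "a / ?d * (b / ?d) * (c / ?d) = a' / ?d * (b' / ?d) * (c' / ?d) \<longleftrightarrow> a * b * c = a' * b' * c'" for a b c a' b' c'
    using det by (simp add: field_simps)
  have eqA: "cross2 (A1 s) (B t - A s) * cross2 (NA s) (C u - A s) + cross2 (A1 s) (C u - A s) * cross2 (NA s) (B t - A s) = 0
      \<longleftrightarrow> a2 s * b2 t * c2 u = a1 s * b1 t * c1 u"
    and eqB: "cross2 (B1 t) (C u - B t) * cross2 (NB t) (A s - B t) + cross2 (B1 t) (A s - B t) * cross2 (NB t) (C u - B t) = 0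
      \<longleftrightarrow> a2 s * b2 t * c2 u = a1 s * b1 t * c1 u"
    and eqC: "cross2 (C1 u) (A s - C u) * cross2 (NC u) (B t - C u) + cross2 (C1 u) (B t - C u) * cross2 (NC u) (A s - C u) = 0
      \<longleftrightarrow> a2 s * b2 t * c2 u = a1 s * b1 t * c1 u"
    if s: "s \<in> ball 0 ea" and t: "t \<in> ball 0 eb" and u: "u \<in> ball 0 ec" for s t u
  proof -
    note na = a.nonzero_dirs[OF sub(1)[OF s]] and nb = b.nonzero_dirs[OF sub(2)[OF t]]
      and nc = c.nonzero_dirs[OF sub(3)[OF u]]
    have "cross2 (A1 s) (B t - A s) * cross2 (NA s) (C u - A s) + cross2 (A1 s) (C u - A s) * cross2 (NA s) (B t - A s) = 0
      \<longleftrightarrow> a2 s / ?d * (b2 t / ?d) * (c2 u / ?d) = a1 s / ?d * (b1 t / ?d) * (c1 u / ?d)"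
      using ea(3) s by (intro mirror_equation_coordinates[OF det na _ _ coords(1)[OF s] coords(2)[OF t] coords(3)[OF u]]) auto
    then show "cross2 (A1 s) (B t - A s) * cross2 (NA s) (C u - A s) + cross2 (A1 s) (C u - A s) * cross2 (NA s) (B t - A s) = 0
      \<longleftrightarrow> a2 s * b2 t * c2 u = a1 s * b1 t * c1 u" unfolding d3 .
    have "cross2 (B1 t) (C u - B t) * cross2 (NB t) (A s - B t) + cross2 (B1 t) (A s - B t) * cross2 (NB t) (C u - B t) = 0
      \<longleftrightarrow> b2 t / ?d * (c2 u / ?d) * (a2 s / ?d) = b1 t / ?d * (c1 u / ?d) * (a1 s / ?d)"
      using eb(3) t det dets
      by (intro mirror_equation_coordinates[OF _ nb _ _ coords(2)[OF t] coords(3)[OF u] coords(1)[OF s]]) auto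
    then show "cross2 (B1 t) (C u - B t) * cross2 (NB t) (A s - B t) + cross2 (B1 t) (A s - B t) * cross2 (NB t) (C u - B t) = 0
      \<longleftrightarrow> a2 s * b2 t * c2 u = a1 s * b1 t * c1 u" unfolding d3 by (simp add: mult_ac)
    have "cross2 (C1 u) (A s - C u) * cross2 (NC u) (B t - C u) + cross2 (C1 u) (B t - C u) * cross2 (NC u) (A s - C u) = 0
      \<longleftrightarrow> c2 u / ?d * (a2 s / ?d) * (b2 t / ?d) = c1 u / ?d * (a1 s / ?d) * (b1 t / ?d)"
      using ec(3) u det dets
      by (intro mirror_equation_coordinates[OF _ nc _ _ coords(3)[OF u] coords(1)[OF s] coords(2)[OF t]]) auto
    then show "cross2 (C1 u) (A s - C u) * cross2 (NC u) (B t - C u) + cross2 (C1 u) (B t - C u) * cross2 (NC u) (A s - C u) = 0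
      \<longleftrightarrow> a2 s * b2 t * c2 u = a1 s * b1 t * c1 u" unfolding d3 by (simp add: mult_ac)
  qed
  have cl0: "closes 0 0 0" by (rule base_closes[OF orbit])
  note z = a.zero_mem b.zero_mem c.zero_mem
  have z': "0 \<in> ball (0::'k) ea" "0 \<in> ball (0::'k) eb" "0 \<in> ball (0::'k) ec" using ea eb ec by simp_all
  \<comment> \<open>The product of all six tangency brackets: nonzero at the base orbit and
    therefore nearby.\<close>
  define F where "F w = cross2 (A1 (fst w)) (B (fst (snd w)) - A (fst w)) * cross2 (A1 (fst w)) (C (snd (snd w)) - A (fst w))
    * (cross2 (B1 (fst (snd w))) (A (fst w) - B (fst (snd w))) * cross2 (B1 (fst (snd w))) (C (snd (snd w)) - B (fst (snd w))))
    * (cross2 (C1 (snd (snd w))) (A (fst w) - C (snd (snd w))) * cross2 (C1 (snd (snd w))) (B (fst (snd w)) - C (snd (snd w))))" for w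
  have "F (0, 0, 0) \<noteq> 0" using cl0 by (simp add: F_def closes_def mirror_def)
  moreover have "isCont F (0, 0, 0)"
    unfolding F_def
    by (intro continuous_mult isCont_cross2 continuous_diff
        isCont_o2[where g = A and f = fst] isCont_o2[where g = A1 and f = fst]
        isCont_o2[where g = B and f = "\<lambda>w. fst (snd w)"] isCont_o2[where g = B1 and f = "\<lambda>w. fst (snd w)"]
        isCont_o2[where g = C and f = "\<lambda>w. snd (snd w)"] isCont_o2[where g = C1 and f = "\<lambda>w. snd (snd w)"])
      (use a.isCont_chart[OF z(1)] b.isCont_chart[OF z(2)] c.isCont_chart[OF z(3)] in
        \<open>auto intro!: continuous_intros\<close>)
  ultimately obtain e0 where e0: "e0 > 0" "\<forall>w. dist w (0, 0, 0) < e0 \<longrightarrow> F w \<noteq> 0"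
    using isCont_eventually_nonzero[of "(0, 0, 0)" F] unfolding eventually_nhds_metric by blast
  have F_near: "F (s, t, u) \<noteq> 0" if "norm s < e0 / 3" "norm t < e0 / 3" "norm u < e0 / 3" for s t u
  proof -
    have "dist (s, t, u) (0, 0, 0) \<le> dist s 0 + dist (t, u) (0, 0)"
      unfolding dist_prod_def[of "(s, t, u)"] by (simp add: sqrt_sum_squares_le_sum)
    also have "dist (t, u) (0, 0) \<le> dist t 0 + dist u 0"
      unfolding dist_prod_def by (simp add: sqrt_sum_squares_le_sum)
    finally have "dist (s, t, u) (0, 0, 0) < e0" using that by simp
    then show ?thesis using e0(2) by blast
  qed
  have closesI: "closes s t u" if "s \<in> ball 0 ea" "t \<in> ball 0 eb" "u \<in> ball 0 ec"
    "a2 s * b2 t * c2 u = a1 s * b1 t * c1 u" "F (s, t, u) \<noteq> 0" for s t u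
  proof -
    note e = eqA[OF that(1-3), THEN iffD2, OF that(4)] eqB[OF that(1-3), THEN iffD2, OF that(4)]
      eqC[OF that(1-3), THEN iffD2, OF that(4)]
    show ?thesis using e that(5) unfolding closes_def mirror_def F_def by (simp add: add.commute)
  qed
  have abc0: "a2 0 * b2 0 * c2 0 = a1 0 * b1 0 * c1 0"
    using eqA[OF z'] cl0 by (simp add: closes_def mirror_def)
  \<comment> \<open>Up to factors, \<open>a2 0\<close> and \<open>b2 0\<close> are the brackets of
    the tangent at \<open>C\<close> with the side to \<open>A\<close> and of the tangent at
    \<open>A\<close> with the side to \<open>B\<close>.\<close>
  have ab0: "a2 0 * b2 0 \<noteq> 0"
  proof -
    have l: "vprod x y \<noteq> 0" "vprod z x \<noteq> 0" using det dets by (auto simp: sprod_simps)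
    obtain k where k: "\<And>X. cross2 (C1 0) (X - C 0) = k * sprod (vprod z x) (chart_vec X)"
      using tangent_covec[OF _ _ l(2) c.nonzero_dirs(1)[OF z(3)], of "C 0"] ec(3) z'(3) by blast
    obtain k' where k': "\<And>X. cross2 (A1 0) (X - A 0) = k' * sprod (vprod x y) (chart_vec X)"
      using tangent_covec[OF _ _ l(1) a.nonzero_dirs(1)[OF z(1)], of "A 0"] ea(3) z'(1) by blast
    have "cross2 (C1 0) (A 0 - C 0) \<noteq> 0" "cross2 (A1 0) (B 0 - A 0) \<noteq> 0"
      using cl0 by (simp_all add: closes_def mirror_def)
    then show ?thesis unfolding k k' a2_def b2_def by simp
  qed
  \<comment> \<open>The choice \<open>c1 = a2 * b2\<close>, \<open>c2 = a1 * b1\<close> solves the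
    closing equation \<open>a2 * b2 * c2 = a1 * b1 * c1\<close>.\<close>
  define Z where "Z w = (a2 (fst w) * b2 (snd w)) *s z + (a1 (fst w) * b1 (snd w)) *s x" for w
  have cZ: "isCont (\<lambda>w. Z w $ i) (0, 0)" for i
  proof -
    have "isCont (\<lambda>w. a1 (fst w)) (0, 0 :: 'k)" "isCont (\<lambda>w. a2 (fst w)) (0, 0 :: 'k)"
      "isCont (\<lambda>w. b1 (snd w)) (0 :: 'k, 0)" "isCont (\<lambda>w. b2 (snd w)) (0 :: 'k, 0)"
      unfolding a1_def a2_def b1_def b2_def
      using a.isCont_chart[OF z(1)] b.isCont_chart[OF z(2)]
      by (auto intro!: isCont_sprod_chart isCont_o2[where g = A and f = fst] isCont_o2[where g = B and f = snd]
          continuous_intros)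
    then show ?thesis unfolding Z_def by (auto intro!: continuous_intros)
  qed
  \<comment> \<open>At the base parameters \<open>Z\<close> is a nonzero multiple of
    \<open>chart_vec (C 0)\<close>; its third coordinate is then nonzero, and dehomogenising gives
    \<open>C 0\<close>.\<close>
  have "c1 0 *s Z (0, 0) = (a2 0 * b2 0 * ?d) *s chart_vec (C 0)"
  proof -
    have "?d *s chart_vec (C 0) = c1 0 *s z + c2 0 *s x"
      unfolding coords(3)[OF z'(3)] using det by (simp add: vec_eq_iff field_simps)
    then have "(a2 0 * b2 0 * ?d) *s chart_vec (C 0) = (a2 0 * b2 0) *s (c1 0 *s z + c2 0 *s x)"
      by (metis vector_smult_assoc)
    also have "\<dots> = (a2 0 * b2 0 * c1 0) *s z + (a2 0 * b2 0 * c2 0) *s x"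
      by (simp add: vec_eq_iff algebra_simps)
    also have "\<dots> = c1 0 *s Z (0, 0)"
      unfolding abc0 Z_def by (simp add: vec_eq_iff algebra_simps)
    finally show ?thesis ..
  qed
  then have Zi: "c1 0 * Z (0, 0) $ i = a2 0 * b2 0 * ?d * chart_vec (C 0) $ i" for i
    by (metis vector_smult_component)
  have Z3: "Z (0, 0) $ 3 \<noteq> 0" and c10: "c1 0 \<noteq> 0" using Zi[of 3] ab0 det by auto
  define X where "X w = (vector [Z w $ 1 / Z w $ 3, Z w $ 2 / Z w $ 3] :: 'k ^ 2)" for w
  have X0: "X (0, 0) = C 0"
  proof -
    have "c1 0 * Z (0, 0) $ 1 = c1 0 * Z (0, 0) $ 3 * C 0 $ 1" "c1 0 * Z (0, 0) $ 2 = c1 0 * Z (0, 0) $ 3 * C 0 $ 2"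
      unfolding Zi by simp_all
    then show ?thesis using Z3 c10 by (simp add: X_def vec2_eq_iff field_simps)
  qed
  have cX: "isCont X (0, 0)"
    unfolding isCont_def
  proof (rule vec_tendstoI)
    fix i :: 2
    have "isCont (\<lambda>w. Z w $ j / Z w $ 3) (0, 0)" for j by (rule isCont_divide[OF cZ cZ Z3])
    then have "(\<lambda>w. Z w $ j / Z w $ 3) \<midarrow>(0, 0)\<rightarrow> Z (0, 0) $ j / Z (0, 0) $ 3" for j
      by (simp add: isCont_def)
    then show "(\<lambda>w. X w $ i) \<midarrow>(0, 0)\<rightarrow> X (0, 0) $ i"
      using exhaust_2[of i] by (auto simp: X_def)
  qed
  show ?thesis
    unfolding reflective_def
  proof (intro conjI allI impI orbit)
    fix W assume W: "\<forall>j<length [\<alpha>, \<beta>, \<gamma>]. openin PT_topology (W j) \<and> [p, q, r] ! j \<in> W j"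
    then have W': "openin PT_topology (W 0)" "openin PT_topology (W 1)" "openin PT_topology (W 2)"
      "p \<in> W 0" "q \<in> W 1" "r \<in> W 2"
      unfolding all_less_3 by simp_all
    obtain w1 where w1: "w1 > 0" "w1 \<le> ra" "\<forall>s\<in>ball 0 w1. PA s \<in> W 0"
      using a.continuous[OF W'(1,4)] unfolding PA_def by blast
    obtain w2 where w2: "w2 > 0" "w2 \<le> rb" "\<forall>s\<in>ball 0 w2. PB s \<in> W 1"
      using b.continuous[OF W'(2,5)] unfolding PB_def by blast
    obtain w3 where w3: "w3 > 0" "w3 \<le> rc" "\<forall>s\<in>ball 0 w3. PC s \<in> W 2"
      using c.continuous[OF W'(3,6)] unfolding PC_def by blast
    define e3 where "e3 = min (min w3 ec) (e0 / 3)"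
    have e3: "e3 > 0" "e3 \<le> w3" "e3 \<le> ec" "e3 \<le> e0 / 3" "e3 \<le> rc"
      using w3 ec e0 by (auto simp: e3_def)
    have zx: "vprod z x \<noteq> 0" using det dets by (auto simp: sprod_simps)
    have onC: "sprod (vprod z x) (chart_vec (C t)) = 0" if "t \<in> ball 0 e3" for t
      using that ec(3) e3(3) by auto
    \<comment> \<open>The constructed point is known to lie on the line of \<gamma>; this radius
      makes it a point of the arc with small parameter.\<close>
    obtain \<delta> where \<delta>: "\<delta> > 0"
      "\<forall>Y\<in>ball (C 0) \<delta>. sprod (vprod z x) (chart_vec Y) = 0 \<longrightarrow> (\<exists>t\<in>ball 0 e3. Y = C t)"
      using chart_covers_line[OF c.framed_chart_axioms e3(1,5) onC zx] by blast
    have "\<forall>\<^sub>F w in nhds (0, 0). X w \<in> ball (C 0) \<delta>"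
      using isCont_eventually[OF cX] eventually_nhds_in_open[OF open_ball, of "C 0" "C 0" \<delta>] \<delta>(1) by (simp add: X0)
    with isCont_eventually_nonzero[OF cZ Z3]
    have "\<forall>\<^sub>F w in nhds (0, 0). X w \<in> ball (C 0) \<delta> \<and> Z w $ 3 \<noteq> 0"
      by eventually_elim simp
    then obtain w0 where w0: "w0 > 0" "\<forall>w. dist w (0, 0) < w0 \<longrightarrow> X w \<in> ball (C 0) \<delta> \<and> Z w $ 3 \<noteq> 0"
      unfolding eventually_nhds_metric by blast
    define e1 where "e1 = min (min w1 ea) (min (e0 / 3) (w0 / 2))"
    define e2 where "e2 = min (min w2 eb) (min (e0 / 3) (w0 / 2))"
    have e1: "e1 > 0" "e1 \<le> w1" "e1 \<le> ea" "e1 \<le> e0 / 3" "e1 \<le> w0 / 2" "e1 \<le> ra"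
      using w1 ea e0(1) w0(1) by (auto simp: e1_def)
    have e2: "e2 > 0" "e2 \<le> w2" "e2 \<le> eb" "e2 \<le> e0 / 3" "e2 \<le> w0 / 2" "e2 \<le> rb"
      using w2 eb e0(1) w0(1) by (auto simp: e2_def)
    have main: "\<exists>qs. periodic_orbit [\<alpha>, \<beta>, \<gamma>] qs \<and> qs ! 0 = PA s \<and> qs ! 1 = PB t \<and>
        (\<forall>j<length [\<alpha>, \<beta>, \<gamma>]. qs ! j \<in> W j)"
      if s: "s \<in> ball 0 e1" and t: "t \<in> ball 0 e2" for s t
    proof -
      have "dist (s, t) (0, 0) \<le> dist s 0 + dist t 0"
        by (simp add: dist_prod_def sqrt_sum_squares_le_sum)
      also have "\<dots> < w0 / 2 + w0 / 2"
        using s t e1(5) e2(5) by (intro add_strict_mono) auto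
      finally have X: "X (s, t) \<in> ball (C 0) \<delta>" "Z (s, t) $ 3 \<noteq> 0" using w0(2) by auto
      have chX: "chart_vec (X (s, t)) = (1 / Z (s, t) $ 3) *s Z (s, t)"
        using X(2) by (simp add: vec3_eq_iff X_def)
      have "sprod (vprod z x) (Z (s, t)) = 0"
        unfolding Z_def sprod_simps by simp
      then have "sprod (vprod z x) (chart_vec (X (s, t))) = 0"
        unfolding chX by (simp only: sprod_simps) simp
      then obtain u where u: "u \<in> ball 0 e3" "X (s, t) = C u" using \<delta>(2) X(1) by blast
      have st: "s \<in> ball 0 ea" "t \<in> ball 0 eb" "u \<in> ball 0 ec" "s \<in> ball 0 ra" "t \<in> ball 0 rb" "u \<in> ball 0 rc"
        using s t u(1) e1 e2 e3 by auto
      have "c1 u = (1 / Z (s, t) $ 3) * (a2 s * b2 t * ?d)"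
        unfolding c1_def u(2)[symmetric] chX Z_def by (simp only: sprod_simps) simp
      moreover have "c2 u = (1 / Z (s, t) $ 3) * (a1 s * b1 t * ?d)"
        unfolding c2_def u(2)[symmetric] chX Z_def by (simp only: sprod_simps dets) simp
      ultimately have "a2 s * b2 t * c2 u = a1 s * b1 t * c1 u"
        by (simp add: mult_ac)
      moreover have "F (s, t, u) \<noteq> 0" using s t u(1) e1 e2 e3 by (intro F_near) auto
      ultimately have "closes s t u" by (intro closesI st)
      then have "periodic_orbit [\<alpha>, \<beta>, \<gamma>] [PA s, PB t, PC u]"
        using periodic_orbit_iff_closes[OF st(4-6)] by blast
      moreover have "\<forall>j<length [\<alpha>, \<beta>, \<gamma>]. [PA s, PB t, PC u] ! j \<in> W j"
        unfolding all_less_3 using w1(3) w2(3) w3(3) s t u(1) e1(2) e2(2) e3(2) by auto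
      ultimately show ?thesis by (intro exI[of _ "[PA s, PB t, PC u]"]) simp
    qed
    obtain OA where OA: "open OA" "fst p \<in> OA"
      "\<forall>x\<in>\<alpha>. fst x \<in> OA \<longrightarrow> (\<exists>t\<in>ball 0 e1. x = (A t, line_dir (A t) (NA t)))"
      using a.covers[OF e1(1,6)] by blast
    obtain OB where OB: "open OB" "fst q \<in> OB"
      "\<forall>x\<in>\<beta>. fst x \<in> OB \<longrightarrow> (\<exists>t\<in>ball 0 e2. x = (B t, line_dir (B t) (NB t)))"
      using b.covers[OF e2(1,6)] by blast
    have PT: "p \<in> PT" "q \<in> PT"
      using line_dir_mem_PT a.nonzero_dirs(2)[OF z(1)] b.nonzero_dirs(2)[OF z(2)]
      by (simp_all add: base_points PA_def PB_def)
    show "\<exists>U V. openin PT_topology U \<and> openin PT_topology V \<and> [p, q, r] ! 0 \<in> U \<and> [p, q, r] ! 1 \<in> V \<and>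
        (\<forall>p' \<in> [\<alpha>, \<beta>, \<gamma>] ! 0 \<inter> U. \<forall>q' \<in> [\<alpha>, \<beta>, \<gamma>] ! 1 \<inter> V.
          \<exists>qs. periodic_orbit [\<alpha>, \<beta>, \<gamma>] qs \<and> qs ! 0 = p' \<and> qs ! 1 = q' \<and>
            (\<forall>j<length [\<alpha>, \<beta>, \<gamma>]. qs ! j \<in> W j))"
    proof (rule exI[of _ "{x \<in> PT. fst x \<in> OA}"], rule exI[of _ "{x \<in> PT. fst x \<in> OB}"], intro conjI ballI)
      show "openin PT_topology {x \<in> PT. fst x \<in> OA}" "openin PT_topology {x \<in> PT. fst x \<in> OB}"
        using OA OB openin_PT_fst by blast+
      show "[p, q, r] ! 0 \<in> {x \<in> PT. fst x \<in> OA}" "[p, q, r] ! 1 \<in> {x \<in> PT. fst x \<in> OB}"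
        using PT OA OB by simp_all
      fix p' q' assume "p' \<in> [\<alpha>, \<beta>, \<gamma>] ! 0 \<inter> {x \<in> PT. fst x \<in> OA}"
        "q' \<in> [\<alpha>, \<beta>, \<gamma>] ! 1 \<inter> {x \<in> PT. fst x \<in> OB}"
      then have "p' \<in> \<alpha>" "fst p' \<in> OA" "q' \<in> \<beta>" "fst q' \<in> OB" by simp_all
      then obtain s t where "s \<in> ball 0 e1" "p' = PA s" "t \<in> ball 0 e2" "q' = PB t"
        using OA(3) OB(3) unfolding PA_def PB_def by blast
      with main show "\<exists>qs. periodic_orbit [\<alpha>, \<beta>, \<gamma>] qs \<and> qs ! 0 = p' \<and> qs ! 1 = q' \<and>
            (\<forall>j<length [\<alpha>, \<beta>, \<gamma>]. qs ! j \<in> W j)" by blast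
    qed
  qed
qed

end

text \<open>Both \<open>real\<close> and \<open>complex\<close> belong to this sort, so the two
  halves of the theorem are instances of one statement.\<close>

lemma reflective_iff_right_spherical:
  fixes \<alpha> \<beta> \<gamma> :: "'k::{real_normed_field,banach,euclidean_space} framed_point set"
  assumes billiard: "local_projective_billiard [\<alpha>, \<beta>, \<gamma>] [p, q, r]"
    and orbit: "periodic_orbit [\<alpha>, \<beta>, \<gamma>] [p, q, r]"
  shows "reflective [\<alpha>, \<beta>, \<gamma>] [p, q, r] \<longleftrightarrow>
    (\<exists>P Q R. proj_point P \<and> proj_point Q \<and> proj_point R \<and> non_collinear P Q R \<and>
      same_germ p \<alpha> (omega (proj_join P Q) R) \<and>
      same_germ q \<beta> (omega (proj_join Q R) P) \<and>
      same_germ r \<gamma> (omega (proj_join R P) Q))"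
proof -
  have lf: "line_framed_curve \<alpha>" "p \<in> \<alpha>" "line_framed_curve \<beta>" "q \<in> \<beta>" "line_framed_curve \<gamma>" "r \<in> \<gamma>"
    using billiard unfolding local_projective_billiard_def all_less_3 by simp_all
  obtain ra A A1 A2 NA NA1 \<psi>a where a: "framed_chart \<alpha> p ra A A1 A2 NA NA1 \<psi>a"
    using framed_chart_exists[OF lf(1,2)] by blast
  obtain rb B B1 B2 NB NB1 \<psi>b where b: "framed_chart \<beta> q rb B B1 B2 NB NB1 \<psi>b"
    using framed_chart_exists[OF lf(3,4)] by blast
  obtain rc C C1 C2 NC NC1 \<psi>c where c: "framed_chart \<gamma> r rc C C1 C2 NC NC1 \<psi>c"
    using framed_chart_exists[OF lf(5,6)] by blast
  interpret billiard_charts \<alpha> \<beta> \<gamma> p q r ra rb rc A A1 A2 NA NA1 \<psi>a B B1 B2 NB NB1 \<psi>b C C1 C2 NC NC1 \<psi>c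
    by (intro billiard_charts.intro a b c)
  show ?thesis
  proof
    assume "\<exists>P Q R. proj_point P \<and> proj_point Q \<and> proj_point R \<and> non_collinear P Q R \<and>
      same_germ p \<alpha> (omega (proj_join P Q) R) \<and>
      same_germ q \<beta> (omega (proj_join Q R) P) \<and>
      same_germ r \<gamma> (omega (proj_join R P) Q)"
    then obtain P Q R where PQR: "proj_point P" "proj_point Q" "proj_point R" "non_collinear P Q R"
      "same_germ p \<alpha> (omega (proj_join P Q) R)" "same_germ q \<beta> (omega (proj_join Q R) P)"
      "same_germ r \<gamma> (omega (proj_join R P) Q)" by blast
    obtain x where x: "x \<noteq> 0" "P = vec.span {x}" by (rule proj_pointE[OF PQR(1)])
    obtain y where y: "y \<noteq> 0" "Q = vec.span {y}" by (rule proj_pointE[OF PQR(2)])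
    obtain z where z: "z \<noteq> 0" "R = vec.span {z}" by (rule proj_pointE[OF PQR(3)])
    have "sprod (vprod x y) z \<noteq> 0"
      using PQR(4) non_collinear_iff[OF x(1)] unfolding x(2) y(2) z(2) by blast
    then show "reflective [\<alpha>, \<beta>, \<gamma>] [p, q, r]"
      using right_spherical_imp_reflective[OF orbit] PQR(5-7) unfolding x(2) y(2) z(2) by blast
  qed (rule reflective_imp_right_spherical)
qed

theorem theorem1p15:
  shows
   "(\<forall>(\<alpha> :: real framed_point set) \<beta> \<gamma> p q r.
       local_projective_billiard [\<alpha>, \<beta>, \<gamma>] [p, q, r] \<and> periodic_orbit [\<alpha>, \<beta>, \<gamma>] [p, q, r] \<longrightarrow>
       (reflective [\<alpha>, \<beta>, \<gamma>] [p, q, r] \<longleftrightarrow>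
         (\<exists>P Q R. proj_point P \<and> proj_point Q \<and> proj_point R \<and> non_collinear P Q R \<and>
            same_germ p \<alpha> (omega (proj_join P Q) R) \<and>
            same_germ q \<beta> (omega (proj_join Q R) P) \<and>
            same_germ r \<gamma> (omega (proj_join R P) Q)))) \<and>
    (\<forall>(\<alpha> :: complex framed_point set) \<beta> \<gamma> p q r.
       local_projective_billiard [\<alpha>, \<beta>, \<gamma>] [p, q, r] \<and> periodic_orbit [\<alpha>, \<beta>, \<gamma>] [p, q, r] \<longrightarrow>
       (reflective [\<alpha>, \<beta>, \<gamma>] [p, q, r] \<longleftrightarrow>
         (\<exists>P Q R. proj_point P \<and> proj_point Q \<and> proj_point R \<and> non_collinear P Q R \<and>
            same_germ p \<alpha> (omega (proj_join P Q) R) \<and>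
            same_germ q \<beta> (omega (proj_join Q R) P) \<and>
            same_germ r \<gamma> (omega (proj_join R P) Q))))"
    by (intro conjI allI impI; elim conjE; rule reflective_iff_right_spherical)

end
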